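(* Consider the interior penalty DG discretization described in the context. Assume that there are $\tau>1$ and $\tilde\tau>0$, independent of $\boldsymbol y$ and $h$, such that for all $\boldsymbol y\in U$ $$\eta(\boldsymbol y)\ge\tau\,\frac{a_{\max}(\boldsymbol y)^2\,C_{\rm tr}^2\,N_\partial\,(\theta-1)^2}{4\,a_{\min}(\boldsymbol y)}\qquad\text{and}\qquad\eta(\boldsymbol y)\ge\tilde\tau\,\frac{a_{\max}(\boldsymbol y)^2}{a_{\min}(\boldsymbol y)}.$$ Then there are constants $C_{\rm DG}',C_{\rm DG}>0$, independent of $\boldsymbol y$ and $h$, with $C_{\rm DG}=C_{\rm equiv}^2C_{\rm DG}'$, such that for every finitely supported multi-index $\boldsymbol\nu\in\mathbb N_0^{\mathbb N}$, $\boldsymbol\nu\ne\boldsymbol0$, and $\boldsymbol y\in U$, $$\|\partial_{\boldsymbol y}^{\boldsymbol\nu}u_h(\cdot,\boldsymbol y)\|_{V_h}\le C_{\rm DG}\sum_{\boldsymbol0\ne\boldsymbol m\le\boldsymbol\nu}\binom{\boldsymbol\nu}{\boldsymbol m}\bigg[\bigg\|\frac{\partial_{\boldsymbol y}^{\boldsymbol m}a(\cdot,\boldsymbol y)}{a(\cdot,\boldsymbol y)}\bigg\|_{L^\infty(D)}+\bigg|\frac{\partial_{\boldsymbol y}^{\boldsymbol m}\eta(\boldsymbol y)}{\eta(\boldsymbol y)}\bigg|\bigg]\|\partial_{\boldsymbol y}^{\boldsymbol\nu-\boldsymbol m}u_h(\cdot,\boldsymbol y)\|_{V_h}.$$ For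 NIPDG ($\theta=1$), one may choose $C_{\rm DG}'=1$.
   Context: **Coefficient.** $D\subset\mathbb R^d$, $d\in\{1,2,3\}$, is a bounded convex polyhedron, $\emptyset\ne U\subset\mathbb R^{\mathbb N}$ is the parameter set, $f\in L^2(D)$, and the diffusion coefficient $a(\boldsymbol x,\boldsymbol y)$ is continuous in $\boldsymbol x$ and satisfies, for each $\boldsymbol y\in U$, $0<a_{\min}(\boldsymbol y)=\min_{\boldsymbol x\in\overline D}a(\boldsymbol x,\boldsymbol y)$ and $a_{\max}(\boldsymbol y)=\max_{\boldsymbol x\in\overline D}a(\boldsymbol x,\boldsymbol y)<\infty$. This setup covers the two models for which the result is used, with $a_0,\psi_j\in W^{1,\infty}(D)$ and $\sum_{j\ge1}\|\psi_j\|_{W^{1,\infty}}<\infty$: the affine and uniform model $a=a_0+\sum_{j\ge1}y_j\psi_j$ on $U=[-\frac12,\frac12]^{\mathbb N}$ (with $a$ bounded above and below by positive constants uniformly on $D\times U$), and the lognormal model $a=a_0\exp(\sum_{j\ge1}y_j\psi_j)$, $\min_{\overline D}a_0>0$, on $U=\{\boldsymbol y\in\mathbb R^{\mathbb N}:\sum_{j\ge1}\|\psi_j\|_{L^\infty}|y_j|<\infty\}$. **Mesh and DG space.** $\mathcal T_h$ is a member of a shape- and contact-regular sequence of meshes of $D$ without hanging nodes: each $\mathcal T_h$ is a partition of $D$ into polyhedral elements admitting a matching simplicial submesh $\mathcal S_h$, and there are $\rho_1,\rho_2>0$ independent of $h$ such that every simplex $T'\in\mathcal S_h$ has inradius $\ge\rho_1\operatorname{diam}T'$,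 and $\rho_2\operatorname{diam}T\le\operatorname{diam}T'$ whenever $T'\subset T\in\mathcal T_h$. $\mathcal F$ is the set of all faces; $h_F$ is the diameter of the face $F$. $N_\partial$ is the maximal number of faces of a mesh element. For a fixed polynomial degree $k$, $$V_h=\{v_h\in L^2(D): v_h|_T\in\mathcal P_k(T)\ \forall T\in\mathcal T_h\},$$ with $\mathcal P_k(T)$ the polynomials of total degree at most $k$ on $T$. On a face shared by $T^+\ne T^-$, put $\{\![v]\!\}=\frac12(v|_{T^+}+v|_{T^-})$ (componentwise for vector fields) and $[\![v]\!]=v|_{T^+}\boldsymbol n_{T^+}+v|_{T^-}\boldsymbol n_{T^-}$ with outward unit normals; on $F\subset\partial D\cap\partial T$ put $\{\![v]\!\}=v|_T$, $[\![v]\!]=v|_T\boldsymbol n$. $C_{\rm tr}$ is a constant independent of $h$ with $(\operatorname{diam}T)^{1/2}\|v_h\|_{L^2(F)}\le C_{\rm tr}\|v_h\|_{L^2(T)}$ for all $v_h\in V_h$, $T\in\mathcal T_h$, faces $F\subset\partial T$. **DG problem.** Let $\theta\in\{-1,0,1\}$, let $\eta(\boldsymbol y)>0$ be the penalty parameter, and, with $a=a(\cdot,\boldsymbol y)$, $$B_h(\boldsymbol y;w,v)=\sum_{T\in\mathcal T_h}\int_T a\nabla w\cdot\nabla v\,{\rm d}\boldsymbol x+\sum_{F\in\mathcal F}\int_F\Big[\theta\{\![a\nabla v]\!\}\cdot[\![w]\!]-\{\![a\nabla w]\!\}\cdot[\![v]\!]+\tfrac{\eta(\boldsymbol y)}{h_F}[\![w]\!]\cdot[\![v]\!]\Big]{\rm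 d}\sigma.$$ $u_h(\cdot,\boldsymbol y)\in V_h$ is the solution of $B_h(\boldsymbol y;u_h(\cdot,\boldsymbol y),v_h)=\int_Dfv_h\,{\rm d}\boldsymbol x$ for all $v_h\in V_h$. The ($\boldsymbol y$-dependent) norms are $\|v_h\|_{V_h}^2=\sum_{T\in\mathcal T_h}\|\sqrt{a(\cdot,\boldsymbol y)}\nabla v_h\|_{L^2(T)}^2+\sum_{F\in\mathcal F}\frac{\eta(\boldsymbol y)}{h_F}\|[\![v_h]\!]\|_{L^2(F)}^2$ and $\|v_h\|_{V_h^\ast}^2=\|v_h\|_{V_h}^2+\sum_{F\in\mathcal F}\frac{h_F}{\eta(\boldsymbol y)}\|\{\![a(\cdot,\boldsymbol y)\nabla v_h]\!\}\|_{L^2(F)}^2$. $C_{\rm equiv}>0$ is a constant independent of $\boldsymbol y$ and $h$ with $\|v_h\|_{V_h^\ast}\le C_{\rm equiv}\|v_h\|_{V_h}$ for all $v_h\in V_h$ (it exists under the second condition on $\eta$). Multi-index notation: $\boldsymbol m\le\boldsymbol\nu$ componentwise, $\binom{\boldsymbol\nu}{\boldsymbol m}=\prod_j\binom{\nu_j}{m_j}$; $\partial^{\boldsymbol\nu}_{\boldsymbol y}$ is the mixed partial derivative with respect to $\boldsymbol y$.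
   Formalization: All mixed y-derivatives of a (uniformly in x on the closure of D) and of η are assumed to exist, independent of order, with each y_j a limit point of its slice of U; for d=1, where a face has diameter 0, h_F is the minimum diameter of the adjacent elements. *)

theory Defs
  imports "HOL-Analysis.Analysis" "HOL-Probability.Essential_Supremum"
begin

text \<open>Derivatives in the coordinate y_j are taken within the slice of U through y in direction j,
  hence they are one-sided at boundary points of sets such as [-1/2, 1/2]^N.\<close>

type_synonym param = "nat \<Rightarrow> real"

definition coord_slice :: "param set \<Rightarrow> param \<Rightarrow> nat \<Rightarrow> real set" where
  "coord_slice U y j = {t. y(j := t) \<in> U}"

definition partial_deriv :: "param set \<Rightarrow> nat \<Rightarrow> (param \<Rightarrow> real) \<Rightarrow> param \<Rightarrow> real" where
  "partial_deriv U j g y =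
     vector_derivative (\<lambda>t. g (y(j := t))) (at (y j) within coord_slice U y j)"

definition finsupp :: "(nat \<Rightarrow> nat) \<Rightarrow> bool" where
  "finsupp \<nu> \<longleftrightarrow> finite {j. \<nu> j \<noteq> 0}"

definition mixed_partial :: "param set \<Rightarrow> (nat \<Rightarrow> nat) \<Rightarrow> (param \<Rightarrow> real) \<Rightarrow> param \<Rightarrow> real" where
  "mixed_partial U \<nu> g =
     fold (\<lambda>j. partial_deriv U j ^^ \<nu> j) (sorted_list_of_set {j. \<nu> j \<noteq> 0}) g"

text \<open>All mixed partial derivatives exist and do not depend on the order of differentiation:
  deriving the one for \<open>\<nu>\<close> once more in y_j gives the one for \<open>\<nu> + e_j\<close>, for every j.\<close>

definition has_mixed_partials :: "param set \<Rightarrow> (param \<Rightarrow> real) \<Rightarrow> bool" where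
  "has_mixed_partials U g \<longleftrightarrow>
     (\<forall>\<nu> j. \<forall>y\<in>U. finsupp \<nu> \<longrightarrow>
        ((\<lambda>t. mixed_partial U \<nu> g (y(j := t))) has_real_derivative
           mixed_partial U (\<nu>(j := Suc (\<nu> j))) g y) (at (y j) within coord_slice U y j))"

text \<open>The same for y \<open>\<mapsto>\<close> a(\<open>\<cdot>\<close>, y) as a map into the continuous functions on K with the
  supremum norm: difference quotients converge uniformly in x.\<close>

definition has_mixed_partials_uniformly ::
    "'a set \<Rightarrow> param set \<Rightarrow> ('a \<Rightarrow> param \<Rightarrow> real) \<Rightarrow> bool" where
  "has_mixed_partials_uniformly K U a \<longleftrightarrow>
     (\<forall>\<nu> j. \<forall>y\<in>U. finsupp \<nu> \<longrightarrow>
        uniform_limit K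
          (\<lambda>t x. (mixed_partial U \<nu> (a x) (y(j := t)) - mixed_partial U \<nu> (a x) y) / (t - y j))
          (\<lambda>x. mixed_partial U (\<nu>(j := Suc (\<nu> j))) (a x) y)
          (at (y j) within coord_slice U y j))"

definition multi_binomial :: "(nat \<Rightarrow> nat) \<Rightarrow> (nat \<Rightarrow> nat) \<Rightarrow> nat" where
  "multi_binomial \<nu> m = (\<Prod>j | \<nu> j \<noteq> 0. \<nu> j choose m j)"

definition L2 :: "'a::euclidean_space set \<Rightarrow> ('a \<Rightarrow> real) set" where
  "L2 S = {g. g \<in> borel_measurable (lebesgue_on S) \<and> integrable (lebesgue_on S) (\<lambda>x. (g x)\<^sup>2)}"

definition L2norm :: "'a measure \<Rightarrow> ('a \<Rightarrow> 'b::real_normed_vector) \<Rightarrow> real" where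
  "L2norm M g = sqrt (\<integral>x. (norm (g x))\<^sup>2 \<partial>M)"

definition Linf_norm :: "'a::euclidean_space set \<Rightarrow> ('a \<Rightarrow> real) \<Rightarrow> real" where
  "Linf_norm S g = real_of_ereal (esssup (lebesgue_on S) (\<lambda>x. ereal \<bar>g x\<bar>))"

text \<open>Near x, the closed set T is a half space with outward unit normal n.\<close>

definition outward_normal :: "'a::euclidean_space set \<Rightarrow> 'a \<Rightarrow> 'a \<Rightarrow> bool" where
  "outward_normal T x n \<longleftrightarrow>
     norm n = 1 \<and> (\<exists>\<epsilon>>0. T \<inter> ball x \<epsilon> = {z \<in> ball x \<epsilon>. (z - x) \<bullet> n \<le> 0})"

text \<open>A face is the closure of a maximal connected flat piece of the boundary. Elements need not
  be convex, so \<open>facet_of\<close> is not available; for a full-dimensional convex polytope the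
  sets below are its facets. In dimension one they are the singletons of the end points.\<close>

definition faces :: "'a::euclidean_space set \<Rightarrow> 'a set set" where
  "faces T = (\<Union>n. closure ` components {x. outward_normal T x n})"

definition face_normal :: "'a::euclidean_space set \<Rightarrow> 'a set \<Rightarrow> 'a" where
  "face_normal T F = (THE n. F \<in> closure ` components {x. outward_normal T x n})"

definition polyhedral_element :: "'a::euclidean_space set \<Rightarrow> bool" where
  "polyhedral_element T \<longleftrightarrow>
     T \<noteq> {} \<and> compact T \<and> T = closure (interior T) \<and> connected (interior T) \<and>
     finite (faces T) \<and> frontier T = \<Union>(faces T)"

text \<open>Elements are closed sets. The last clause excludes hanging nodes: a face that is not on the
  boundary is, as a whole, also a face of another element.\<close>

definition polyhedral_mesh :: "'a::euclidean_space set \<Rightarrow> 'a set set \<Rightarrow> bool" where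
  "polyhedral_mesh D \<T> \<longleftrightarrow>
     finite \<T> \<and> (\<forall>T\<in>\<T>. polyhedral_element T) \<and> \<Union>\<T> = closure D \<and>
     (\<forall>T\<in>\<T>. \<forall>T'\<in>\<T>. T \<noteq> T' \<longrightarrow> interior T \<inter> interior T' = {}) \<and>
     (\<forall>T\<in>\<T>. \<forall>F\<in>faces T. F \<subseteq> frontier D \<or> (\<exists>T'\<in>\<T>. T' \<noteq> T \<and> F \<in> faces T'))"

definition matching_simplicial_submesh ::
    "'a::euclidean_space set \<Rightarrow> 'a set set \<Rightarrow> 'a set set \<Rightarrow> bool" where
  "matching_simplicial_submesh D \<T> \<S> \<longleftrightarrow>
     triangulation \<S> \<and> (\<forall>S\<in>\<S>. int DIM('a) simplex S) \<and> \<Union>\<S> = closure D \<and>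
     (\<forall>S\<in>\<S>. \<exists>!T. T \<in> \<T> \<and> S \<subseteq> T) \<and> (\<forall>T\<in>\<T>. T = \<Union>{S \<in> \<S>. S \<subseteq> T})"

definition inradius :: "'a::euclidean_space set \<Rightarrow> real" where
  "inradius S = Sup {r. 0 \<le> r \<and> (\<exists>x. cball x r \<subseteq> S)}"

definition regular_mesh_sequence ::
    "'a::euclidean_space set \<Rightarrow> (nat \<Rightarrow> 'a set set) \<Rightarrow> bool" where
  "regular_mesh_sequence D \<T> \<longleftrightarrow>
     (\<forall>h. polyhedral_mesh D (\<T> h)) \<and>
     (\<exists>\<rho>1>0. \<exists>\<rho>2>0. \<forall>h. \<exists>\<S>. matching_simplicial_submesh D (\<T> h) \<S> \<and>
        (\<forall>S\<in>\<S>. inradius S \<ge> \<rho>1 * diameter S \<and>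
           (\<forall>T\<in>\<T> h. S \<subseteq> T \<longrightarrow> \<rho>2 * diameter T \<le> diameter S)))"

definition mesh_faces :: "'a::euclidean_space set set \<Rightarrow> 'a set set" where
  "mesh_faces \<T> = (\<Union>T\<in>\<T>. faces T)"

text \<open>The element(s) having F as a face: two for an interior face, one for a boundary face.\<close>

definition face_elements :: "'a::euclidean_space set set \<Rightarrow> 'a set \<Rightarrow> 'a set set" where
  "face_elements \<T> F = {T \<in> \<T>. F \<in> faces T}"

text \<open>In dimension one a face is a point, with diameter zero; there the usual convention is the
  minimum of the diameters of the adjacent elements.\<close>

definition face_size :: "'a::euclidean_space set set \<Rightarrow> 'a set \<Rightarrow> real" where
  "face_size \<T> F =
     (if DIM('a) = 1 then Min (diameter ` face_elements \<T> F) else diameter F)"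

definition max_faces :: "'a::euclidean_space set set \<Rightarrow> nat" where
  "max_faces \<T> = Max ((\<lambda>T. card (faces T)) ` \<T>)"

text \<open>(d-1)-dimensional Lebesgue measure on the hyperplane n \<open>\<bullet>\<close> x = c with unit normal n: the
  measure of A is the d-dimensional measure of the cylinder of height one over A. For d = 1
  this is the point mass.\<close>

definition hyperplane_measure :: "'a::euclidean_space \<Rightarrow> real \<Rightarrow> 'a measure" where
  "hyperplane_measure n c =
     distr (restrict_space lborel {x. c \<le> n \<bullet> x \<and> n \<bullet> x \<le> c + 1}) borel
       (\<lambda>x. x - (n \<bullet> x - c) *\<^sub>R n)"

text \<open>The pair (n, c) is determined by a face up to a common sign, which does not affect the
  measure.\<close>

definition face_measure :: "'a::euclidean_space set \<Rightarrow> 'a measure" where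
  "face_measure F =
     (let (n, c) = (SOME (n, c). norm n = 1 \<and> F \<subseteq> {x. n \<bullet> x = c})
      in restrict_space (hyperplane_measure n c) F)"

definition polynomials :: "nat \<Rightarrow> ('a::euclidean_space \<Rightarrow> real) set" where
  "polynomials k =
     {p. \<exists>c. p = (\<lambda>x. \<Sum>\<alpha> | (\<forall>b. b \<notin> Basis \<longrightarrow> \<alpha> b = 0) \<and> (\<Sum>b\<in>Basis. \<alpha> b) \<le> k.
             c \<alpha> * (\<Prod>b\<in>Basis. (x \<bullet> b) ^ \<alpha> b))}"

text \<open>Elements of V_h are represented by functions that are polynomial in the interior of each
  mesh element; their values on the mesh skeleton, a null set, are arbitrary and never used.\<close>

definition DG_space ::
    "'a::euclidean_space set \<Rightarrow> 'a set set \<Rightarrow> nat \<Rightarrow> ('a \<Rightarrow> real) set" where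
  "DG_space D \<T> k =
     {v \<in> L2 D. \<forall>T\<in>\<T>. \<exists>p\<in>polynomials k. \<forall>x\<in>interior T. v x = p x}"

definition grad :: "('a::euclidean_space \<Rightarrow> real) \<Rightarrow> 'a \<Rightarrow> 'a" where
  "grad v x = (\<Sum>b\<in>Basis. frechet_derivative v (at x) b *\<^sub>R b)"

definition interior_trace :: "'a::euclidean_space set \<Rightarrow> ('a \<Rightarrow> 'b::t2_space) \<Rightarrow> 'a \<Rightarrow> 'b" where
  "interior_trace T g x = Lim (at x within interior T) g"

definition average ::
    "'a::euclidean_space set set \<Rightarrow> 'a set \<Rightarrow> ('a \<Rightarrow> 'b::real_normed_vector) \<Rightarrow> 'a \<Rightarrow> 'b" where
  "average \<T> F g x =
     (\<Sum>T\<in>face_elements \<T> F. interior_trace T g x) /\<^sub>R real (card (face_elements \<T> F))"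

definition jump ::
    "'a::euclidean_space set set \<Rightarrow> 'a set \<Rightarrow> ('a \<Rightarrow> real) \<Rightarrow> 'a \<Rightarrow> 'a" where
  "jump \<T> F v x = (\<Sum>T\<in>face_elements \<T> F. interior_trace T v x *\<^sub>R face_normal T F)"

text \<open>In the following, \<open>a\<close> and \<open>\<eta>\<close> are the coefficient and the penalty for a fixed parameter.\<close>

definition DG_form ::
    "real \<Rightarrow> 'a::euclidean_space set set \<Rightarrow> ('a \<Rightarrow> real) \<Rightarrow> real \<Rightarrow>
       ('a \<Rightarrow> real) \<Rightarrow> ('a \<Rightarrow> real) \<Rightarrow> real" where
  "DG_form \<theta> \<T> a \<eta> w v =
     (\<Sum>T\<in>\<T>. \<integral>x. a x * (grad w x \<bullet> grad v x) \<partial>lebesgue_on T) +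
     (\<Sum>F\<in>mesh_faces \<T>. \<integral>x.
        \<theta> * (average \<T> F (\<lambda>z. a z *\<^sub>R grad v z) x \<bullet> jump \<T> F w x)
        - average \<T> F (\<lambda>z. a z *\<^sub>R grad w z) x \<bullet> jump \<T> F v x
        + \<eta> / face_size \<T> F * (jump \<T> F w x \<bullet> jump \<T> F v x) \<partial>face_measure F)"

definition DG_solution ::
    "'a::euclidean_space set \<Rightarrow> 'a set set \<Rightarrow> nat \<Rightarrow> real \<Rightarrow> ('a \<Rightarrow> real) \<Rightarrow> real \<Rightarrow>
       ('a \<Rightarrow> real) \<Rightarrow> ('a \<Rightarrow> real) \<Rightarrow> bool" where
  "DG_solution D \<T> k \<theta> a \<eta> f u \<longleftrightarrow>
     u \<in> DG_space D \<T> k \<and>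
     (\<forall>v\<in>DG_space D \<T> k. DG_form \<theta> \<T> a \<eta> u v = (\<integral>x. f x * v x \<partial>lebesgue_on D))"

definition DG_norm ::
    "'a::euclidean_space set set \<Rightarrow> ('a \<Rightarrow> real) \<Rightarrow> real \<Rightarrow> ('a \<Rightarrow> real) \<Rightarrow> real" where
  "DG_norm \<T> a \<eta> v =
     sqrt ((\<Sum>T\<in>\<T>. (L2norm (lebesgue_on T) (\<lambda>x. sqrt (a x) *\<^sub>R grad v x))\<^sup>2) +
           (\<Sum>F\<in>mesh_faces \<T>. \<eta> / face_size \<T> F * (L2norm (face_measure F) (jump \<T> F v))\<^sup>2))"

definition DG_norm_star ::
    "'a::euclidean_space set set \<Rightarrow> ('a \<Rightarrow> real) \<Rightarrow> real \<Rightarrow> ('a \<Rightarrow> real) \<Rightarrow> real" where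
  "DG_norm_star \<T> a \<eta> v =
     sqrt ((DG_norm \<T> a \<eta> v)\<^sup>2 +
           (\<Sum>F\<in>mesh_faces \<T>. face_size \<T> F / \<eta> *
              (L2norm (face_measure F) (average \<T> F (\<lambda>z. a z *\<^sub>R grad v z)))\<^sup>2))"

definition coeff_min :: "'a::euclidean_space set \<Rightarrow> ('a \<Rightarrow> real) \<Rightarrow> real" where
  "coeff_min D a = (INF x\<in>closure D. a x)"

definition coeff_max :: "'a::euclidean_space set \<Rightarrow> ('a \<Rightarrow> real) \<Rightarrow> real" where
  "coeff_max D a = (SUP x\<in>closure D. a x)"

end

(* The DG space has finite dimension modulo functions living on the mesh skeleton, so the DG equation
   is a linear system in which coefficient and penalty enter linearly. The energy norm is definite and,
   by the penalty condition and the trace inequality, the form is coercive with constant 1 for NIPDG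
   and 1 - 1/sqrt tau otherwise. Hence the system is nonsingular for every y, the coordinates of the
   solution are as smooth in y as the system, and differentiating the equation gives, for nu \<noteq> 0,
     B(y; d^nu u, v) = - sum_{0 \<noteq> m \<le> nu} binom(nu, m) B_m(y; d^(nu-m) u, v),
   where B_m is the form with coefficient d^m a and penalty d^m eta. Testing with v = d^nu u and
   bounding B_m, by Young's inequality with an optimised weight, by
   (|d^m a / a| + |d^m eta / eta|) times the product of the two star norms gives the claim. *)
theory Submission
  imports Defs
begin

section \<open>Multi-indices and mixed partial derivatives\<close>

text \<open>Nothing is known beforehand about how u_h depends on y, and \<open>mixed_partial\<close>
  differentiates in one fixed order, the largest coordinate last. Nonsingularity closes both gaps:
  it makes the solution differentiable, and since the derivative of the order-\<nu> partial in any
  direction j solves the same system as the mixed partial of order \<nu> + e_j, the two agree.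
  Symmetry of mixed partials thus comes from uniqueness. Definiteness of the energy norm is the
  geometric obstacle. Elements may be nonconvex and no adjacency graph is at hand, so constants with
  vanishing jumps are followed along a segment in general position, where every crossing happens at
  a point whose faces all lie in one hyperplane. The constant 1 - 1/sqrt tau balances two losses:
  Young's inequality with weight sigma costs the fraction sigma of the jump term, and the trace
  inequality with the penalty condition bounds the rest by the fraction 1/(sigma tau) of the volume
  term; both agree at sigma = 1/sqrt tau. C_equiv enters squared because both arguments of B_m are
  measured in the star norm.\<close>

definition msize :: "(nat \<Rightarrow> nat) \<Rightarrow> nat" where
  "msize \<nu> = (\<Sum>j | \<nu> j \<noteq> 0. \<nu> j)"

lemma finsupp_upd: "finsupp \<nu> \<Longrightarrow> finsupp (\<nu>(j := k))"
  unfolding finsupp_def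
  by (rule finite_subset[of _ "insert j {i. \<nu> i \<noteq> 0}"]) (auto split: if_splits)

lemma finsupp_zero [simp]: "finsupp (\<lambda>_. 0)"
  by (simp add: finsupp_def)

lemma finsupp_le: "finsupp \<nu> \<Longrightarrow> m \<le> \<nu> \<Longrightarrow> finsupp m"
  unfolding finsupp_def
  by (erule rev_finite_subset) (auto simp: le_fun_def, metis le_zero_eq neq0_conv)

lemma finsupp_diff: "finsupp \<nu> \<Longrightarrow> finsupp (\<lambda>j. \<nu> j - m j)"
  by (rule finsupp_le) (auto simp: le_fun_def)

text \<open>Sums over infinite sets are 0 by convention, so the Leibniz sums carry content only
  because this box is finite: entries vanish off the support and are bounded by the largest entry on
  it.\<close>

lemma finite_le_finsupp: "finsupp \<nu> \<Longrightarrow> finite {m. m \<le> \<nu>}"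
proof -
  assume f: "finsupp \<nu>"
  let ?S = "{j. \<nu> j \<noteq> 0}"
  have fin: "finite ?S" using f by (simp add: finsupp_def)
  have "finite {m. \<forall>x. (x \<in> ?S \<longrightarrow> m x \<in> {..Max (\<nu> ` ?S)}) \<and> (x \<notin> ?S \<longrightarrow> m x = 0)}"
    by (rule finite_set_of_finite_funs[OF fin]) simp
  moreover have "{m. m \<le> \<nu>} \<subseteq> {m. \<forall>x. (x \<in> ?S \<longrightarrow> m x \<in> {..Max (\<nu> ` ?S)}) \<and> (x \<notin> ?S \<longrightarrow> m x = 0)}"
  proof
    fix m assume "m \<in> {m. m \<le> \<nu>}"
    then have m: "\<And>i. m i \<le> \<nu> i" by (auto simp: le_fun_def)
    have "m x \<le> Max (\<nu> ` ?S)" if "x \<in> ?S" for x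
      by (rule order_trans[OF m Max_ge]) (use fin that in auto)
    moreover have "m x = 0" if "x \<notin> ?S" for x using m[of x] that by simp
    ultimately show "m \<in> {m. \<forall>x. (x \<in> ?S \<longrightarrow> m x \<in> {..Max (\<nu> ` ?S)}) \<and> (x \<notin> ?S \<longrightarrow> m x = 0)}"
      by auto
  qed
  ultimately show ?thesis by (rule finite_subset[rotated])
qed

lemma msize_superset: "finite S \<Longrightarrow> {j. \<nu> j \<noteq> 0} \<subseteq> S \<Longrightarrow> msize \<nu> = sum \<nu> S"
  unfolding msize_def by (rule sum.mono_neutral_left) auto

lemma msize_Suc:
  assumes "finsupp \<nu>"
  shows "msize (\<nu>(j := Suc (\<nu> j))) = Suc (msize \<nu>)"
proof -
  let ?S = "insert j {i. \<nu> i \<noteq> 0}"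
  have f: "finite ?S" using assms by (simp add: finsupp_def)
  have 1: "msize \<nu> = sum \<nu> ?S" by (rule msize_superset[OF f]) auto
  have 2: "msize (\<nu>(j := Suc (\<nu> j))) = sum (\<nu>(j := Suc (\<nu> j))) ?S"
    by (rule msize_superset[OF f]) auto
  have "sum (\<nu>(j := Suc (\<nu> j))) (?S - {j}) = sum \<nu> (?S - {j})" by (rule sum.cong) auto
  then show ?thesis unfolding 1 2 sum.remove[OF f insertI1] by simp
qed

lemma msize_eq_0: "finsupp \<nu> \<Longrightarrow> msize \<nu> = 0 \<longleftrightarrow> \<nu> = (\<lambda>_. 0)"
  unfolding msize_def finsupp_def by (auto simp: fun_eq_iff)

text \<open>The derivative in the largest active coordinate is the one that
  \<open>mixed_partial\<close> takes last, so it is the only one that can be peeled off by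
  definition.\<close>

lemma multi_index_top_cases:
  assumes "finsupp \<nu>" "\<nu> \<noteq> (\<lambda>_. 0)"
  obtains \<mu> j where "\<nu> = \<mu>(j := Suc (\<mu> j))" "\<forall>i>j. \<mu> i = 0" "finsupp \<mu>"
proof -
  let ?S = "{j. \<nu> j \<noteq> 0}"
  have S: "finite ?S" "?S \<noteq> {}" using assms by (auto simp: finsupp_def)
  define j where "j = Max ?S"
  have j: "\<nu> j \<noteq> 0" using Max_in[OF S] by (simp add: j_def)
  have top: "\<forall>i>j. \<nu> i = 0" using Max_ge[OF S(1)] unfolding j_def by (metis (mono_tags) leD mem_Collect_eq)
  show ?thesis
    by (rule that[of "\<nu>(j := \<nu> j - 1)" j]) (use j top assms(1) in \<open>auto simp: finsupp_upd\<close>)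
qed

lemma multi_index_induct [consumes 1, case_names zero top]:
  assumes "finsupp \<nu>"
    and "P (\<lambda>_. 0)"
    and "\<And>\<mu> j. finsupp \<mu> \<Longrightarrow> \<forall>i>j. \<mu> i = 0 \<Longrightarrow> P \<mu> \<Longrightarrow> P (\<mu>(j := Suc (\<mu> j)))"
  shows "P \<nu>"
  using assms(1)
proof (induction "msize \<nu>" arbitrary: \<nu> rule: less_induct)
  case less
  show ?case
  proof (cases "\<nu> = (\<lambda>_. 0)")
    case False
    then obtain \<mu> j where \<mu>: "\<nu> = \<mu>(j := Suc (\<mu> j))" "\<forall>i>j. \<mu> i = 0" "finsupp \<mu>"
      using multi_index_top_cases less.prems by blast
    have "P \<mu>" by (rule less.hyps) (use \<mu> msize_Suc in auto)
    then show ?thesis using \<mu> assms(3) by auto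
  qed (use assms(2) in simp)
qed

section \<open>Mixed partials as iterated slice derivatives\<close>

lemma mixed_partial_zero [simp]: "mixed_partial U (\<lambda>_. 0) g = g"
  by (simp add: mixed_partial_def)

lemma sorted_list_of_set_insert_top:
  assumes "finite S" "\<forall>i\<in>S. i < j"
  shows "sorted_list_of_set (insert (j::nat) S) = sorted_list_of_set S @ [j]"
proof -
  have "sorted (sorted_list_of_set S @ [j])" "distinct (sorted_list_of_set S @ [j])"
    using assms by (auto simp: sorted_append intro: less_imp_le)
  then have "sorted_list_of_set (set (sorted_list_of_set S @ [j])) = sorted_list_of_set S @ [j]"
    by (rule sorted_list_of_set.idem_if_sorted_distinct)
  then show ?thesis using assms by simp
qed

lemma mixed_partial_Suc_top:
  assumes "finsupp \<nu>" "\<forall>i>j. \<nu> i = 0"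
  shows "mixed_partial U (\<nu>(j := Suc (\<nu> j))) g = partial_deriv U j (mixed_partial U \<nu> g)"
proof -
  let ?S = "{i. \<nu> i \<noteq> 0} - {j}"
  have fin: "finite ?S" using assms by (simp add: finsupp_def)
  have lt: "\<forall>i\<in>?S. i < j" using assms(2) by (metis (mono_tags) Diff_iff insertI1 linorder_neqE_nat mem_Collect_eq)
  \<comment> \<open>Both indices share the fold over the coordinates below j. If
    \<open>\<mu> j = 0\<close>, then j is missing from the list, but the zeroth power that stands
    for it is the identity.\<close>
  have *: "mixed_partial U \<mu> g = (partial_deriv U j ^^ \<mu> j)
      (fold (\<lambda>j. partial_deriv U j ^^ \<nu> j) (sorted_list_of_set ?S) g)"
    if \<mu>: "\<And>i. i \<noteq> j \<Longrightarrow> \<mu> i = \<nu> i" for \<mu>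
  proof -
    have cong: "fold (\<lambda>j. partial_deriv U j ^^ \<mu> j) (sorted_list_of_set ?S) g =
      fold (\<lambda>j. partial_deriv U j ^^ \<nu> j) (sorted_list_of_set ?S) g"
      by (rule fold_cong) (use \<mu> fin in auto)
    show ?thesis
    proof (cases "\<mu> j = 0")
      case True
      have "{i. \<mu> i \<noteq> 0} = ?S"
      proof (rule set_eqI)
        fix i show "i \<in> {i. \<mu> i \<noteq> 0} \<longleftrightarrow> i \<in> ?S" using \<mu>[of i] True by (cases "i = j") auto
      qed
      then show ?thesis using cong True by (simp add: mixed_partial_def)
    next
      case False
      have "{i. \<mu> i \<noteq> 0} = insert j ?S"
      proof (rule set_eqI)
        fix i show "i \<in> {i. \<mu> i \<noteq> 0} \<longleftrightarrow> i \<in> insert j ?S" using \<mu>[of i] False by (cases "i = j") auto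
      qed
      then show ?thesis
        unfolding mixed_partial_def
        by (simp only: sorted_list_of_set_insert_top[OF fin lt] fold_append fold.simps comp_apply cong id_apply)
    qed
  qed
  show ?thesis by (subst (1 2) *) auto
qed

text \<open>\<open>vector_derivative\<close> is a choice; it is determined because
  \<open>y j\<close> is a limit point of the slice. Agreement on \<open>U\<close> is enough since
  moving along the slice never leaves \<open>U\<close>.\<close>

lemma partial_deriv_eqI:
  assumes "y \<in> U" "y j islimpt coord_slice U y j"
    and "\<And>z. z \<in> U \<Longrightarrow> h z = h' z"
    and "((\<lambda>t. h' (y(j := t))) has_real_derivative d) (at (y j) within coord_slice U y j)"
  shows "partial_deriv U j h y = d"
proof -
  have "y j \<in> coord_slice U y j" using assms(1) by (simp add: coord_slice_def)
  with assms(3,4) have "((\<lambda>t. h (y(j := t))) has_real_derivative d) (at (y j) within coord_slice U y j)"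
    by (subst has_field_derivative_cong_eventually[where g = "\<lambda>t. h' (y(j := t))"])
       (auto simp: eventually_at coord_slice_def intro!: exI[of _ 1])
  then show ?thesis
    unfolding partial_deriv_def using assms(2)
    by (intro vector_derivative_within) (auto simp: trivial_limit_within has_real_derivative_iff_has_vector_derivative)
qed

text \<open>The candidate family \<open>G\<close> is closed under differentiation in every
  direction. Induction along top coordinates identifies it with the mixed partials, and the
  derivatives in the other directions are then read off \<open>G\<close>, which gives independence
  of the order.\<close>

lemma mixed_partials_eqI:
  assumes limpt: "\<And>y j. y \<in> U \<Longrightarrow> y j islimpt coord_slice U y j"
    and zero: "\<And>y. y \<in> U \<Longrightarrow> G (\<lambda>_. 0) y = g y"
    and deriv: "\<And>\<nu> j y. finsupp \<nu> \<Longrightarrow> y \<in> U \<Longrightarrow>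
      ((\<lambda>t. G \<nu> (y(j := t))) has_real_derivative G (\<nu>(j := Suc (\<nu> j))) y) (at (y j) within coord_slice U y j)"
  shows "finsupp \<nu> \<Longrightarrow> y \<in> U \<Longrightarrow> mixed_partial U \<nu> g y = G \<nu> y" and "has_mixed_partials U g"
proof -
  have *: "\<forall>y\<in>U. mixed_partial U \<nu> g y = G \<nu> y" if "finsupp \<nu>" for \<nu>
    using that
  proof (induction \<nu> rule: multi_index_induct)
    case (top \<mu> j)
    then show ?case
      by (auto simp: mixed_partial_Suc_top simp del: fun_upd_apply intro!: partial_deriv_eqI[OF _ limpt _ deriv])
  qed (use zero in simp)
  then show "finsupp \<nu> \<Longrightarrow> y \<in> U \<Longrightarrow> mixed_partial U \<nu> g y = G \<nu> y" by blast
  show "has_mixed_partials U g"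
    unfolding has_mixed_partials_def
  proof (intro allI ballI impI)
    fix \<nu> j y assume y: "y \<in> U" and f: "finsupp \<nu>"
    have "y j \<in> coord_slice U y j" using y by (simp add: coord_slice_def)
    then show "((\<lambda>t. mixed_partial U \<nu> g (y(j := t))) has_real_derivative
        mixed_partial U (\<nu>(j := Suc (\<nu> j))) g y) (at (y j) within coord_slice U y j)"
      using deriv[OF f y, of j] *[OF f] *[OF finsupp_upd[OF f]] y
      by (subst has_field_derivative_cong_eventually[where g = "\<lambda>t. G \<nu> (y(j := t))"])
         (auto simp: eventually_at coord_slice_def intro!: exI[of _ 1])
  qed
qed

section \<open>Multi-binomial coefficients and the combinatorics of the Leibniz rule\<close>

lemma multi_binomial_superset:
  assumes "finite S" "{i. \<nu> i \<noteq> 0} \<subseteq> S" "m \<le> \<nu>"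
  shows "multi_binomial \<nu> m = (\<Prod>i\<in>S. \<nu> i choose m i)"
  unfolding multi_binomial_def
proof (rule prod.mono_neutral_left)
  have "m i = 0" if "\<nu> i = 0" for i using assms(3) that by (metis le_fun_def le_zero_eq)
  then show "\<forall>i\<in>S - {j. \<nu> j \<noteq> 0}. \<nu> i choose m i = 1" by auto
qed (use assms in auto)

lemma multi_binomial_zero [simp]: "multi_binomial \<nu> (\<lambda>_. 0) = 1"
  by (simp add: multi_binomial_def)

text \<open>Pascal's rule in coordinate j; the other factors split off as a common product. Both
  guards matter: natural subtraction would leave m unchanged when \<open>m j = 0\<close>, and
  \<open>multi_binomial \<nu> m\<close> skips coordinates off the support of \<nu>, so it need not
  vanish when \<open>\<nu> j = 0\<close> and \<open>m j = 1\<close>.\<close>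

lemma multi_binomial_Pascal:
  assumes "finsupp \<nu>" "m \<le> \<nu>(j := Suc (\<nu> j))"
  shows "multi_binomial (\<nu>(j := Suc (\<nu> j))) m =
    (if m j = 0 then 0 else multi_binomial \<nu> (m(j := m j - 1))) + (if m j \<le> \<nu> j then multi_binomial \<nu> m else 0)"
proof -
  let ?S = "insert j {i. \<nu> i \<noteq> 0}"
  define P where "P = (\<Prod>i\<in>?S - {j}. \<nu> i choose m i)"
  have fin: "finite ?S" using assms by (simp add: finsupp_def)
  have PR: "prod g ?S = g j * prod g (?S - {j})" for g :: "nat \<Rightarrow> nat" by (rule prod.remove[OF fin insertI1])
  have mle: "\<And>i. i \<noteq> j \<Longrightarrow> m i \<le> \<nu> i" "m j \<le> Suc (\<nu> j)"
    using assms(2) by (auto simp: le_fun_def dest: spec[of _ j] split: if_splits)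
  have 1: "multi_binomial (\<nu>(j := Suc (\<nu> j))) m = (Suc (\<nu> j) choose m j) * P"
  proof -
    have "multi_binomial (\<nu>(j := Suc (\<nu> j))) m = (\<Prod>i\<in>?S. (\<nu>(j := Suc (\<nu> j))) i choose m i)"
      by (rule multi_binomial_superset[OF fin _ assms(2)]) auto
    also have "\<dots> = (Suc (\<nu> j) choose m j) * (\<Prod>i\<in>?S - {j}. (\<nu>(j := Suc (\<nu> j))) i choose m i)"
      by (subst prod.remove[OF fin insertI1]) simp
    also have "(\<Prod>i\<in>?S - {j}. (\<nu>(j := Suc (\<nu> j))) i choose m i) = P"
      unfolding P_def by (rule prod.cong) auto
    finally show ?thesis .
  qed
  have 2: "multi_binomial \<nu> m = (\<nu> j choose m j) * P" if "m j \<le> \<nu> j"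
  proof -
    have "m \<le> \<nu>" using mle that by (metis le_funI)
    then show ?thesis
      by (subst multi_binomial_superset[OF fin]) (auto simp only: PR P_def)
  qed
  have 3: "multi_binomial \<nu> (m(j := m j - 1)) = (\<nu> j choose (m j - 1)) * P" if "m j \<noteq> 0"
  proof -
    have "m(j := m j - 1) \<le> \<nu>" using mle that by (auto simp: le_fun_def)
    then show ?thesis
      by (subst multi_binomial_superset[OF fin]) (auto simp only: PR P_def, auto intro!: prod.cong)
  qed
  show ?thesis
  proof (cases "m j")
    case 0 then show ?thesis using 1 2 by simp
  next
    case (Suc l)
    then show ?thesis using 1 2 3 mle(2) by (auto simp: algebra_simps)
  qed
qed

text \<open>Bookkeeping for one more derivative in direction j: the product rule splits each term
  according to the factor on which the new derivative falls. \<open>H m\<close> is meant as the term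
  with m derivatives on the first factor and the remaining part of \<nu> + e_j on the
  second.\<close>

lemma sum_multi_binomial_Suc:
  fixes H :: "(nat \<Rightarrow> nat) \<Rightarrow> real"
  assumes f: "finsupp \<nu>"
  shows "(\<Sum>m | m \<le> \<nu>. real (multi_binomial \<nu> m) * (H (m(j := Suc (m j))) + H m)) =
    (\<Sum>m | m \<le> \<nu>(j := Suc (\<nu> j)). real (multi_binomial (\<nu>(j := Suc (\<nu> j))) m) * H m)"
proof -
  let ?\<nu>' = "\<nu>(j := Suc (\<nu> j))"
  let ?A = "{m. m \<le> ?\<nu>'}"
  have fin: "finite ?A" using finite_le_finsupp[OF finsupp_upd[OF f]] .
  have "(\<Sum>m\<in>?A. real (multi_binomial ?\<nu>' m) * H m) =
    (\<Sum>m\<in>?A. (if m j = 0 then 0 else real (multi_binomial \<nu> (m(j := m j - 1))) * H m))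
    + (\<Sum>m\<in>?A. if m j \<le> \<nu> j then real (multi_binomial \<nu> m) * H m else 0)"
    unfolding sum.distrib[symmetric]
    by (rule sum.cong) (auto simp: multi_binomial_Pascal[OF f] algebra_simps)
  also have "(\<Sum>m\<in>?A. (if m j = 0 then 0 else real (multi_binomial \<nu> (m(j := m j - 1))) * H m))
    = (\<Sum>m\<in>{m\<in>?A. m j \<noteq> 0}. real (multi_binomial \<nu> (m(j := m j - 1))) * H m)"
    by (rule sum.mono_neutral_cong_right) (use fin in auto)
  \<comment> \<open>Shifting m by e_j identifies the indices with a positive j-th entry below \<nu>
    + e_j with all indices below \<nu>.\<close>
  also have "\<dots> = (\<Sum>m | m \<le> \<nu>. real (multi_binomial \<nu> m) * H (m(j := Suc (m j))))"
    by (rule sum.reindex_bij_witness[of _ "\<lambda>m. m(j := Suc (m j))" "\<lambda>m. m(j := m j - 1)"])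
       (auto simp: le_fun_def fun_upd_idem split: if_splits)
  also have "(\<Sum>m\<in>?A. if m j \<le> \<nu> j then real (multi_binomial \<nu> m) * H m else 0) =
     (\<Sum>m | m \<le> \<nu>. real (multi_binomial \<nu> m) * H m)"
  proof (rule sum.mono_neutral_cong_right[OF fin])
    show "{m. m \<le> \<nu>} \<subseteq> ?A" by (auto simp: le_fun_def intro: le_SucI)
    show "\<forall>i\<in>?A - {m. m \<le> \<nu>}. (if i j \<le> \<nu> j then real (multi_binomial \<nu> i) * H i else 0) = 0"
      by (auto simp: le_fun_def split: if_splits)
  qed (auto simp: le_fun_def)
  finally show ?thesis by (simp add: distrib_left sum.distrib del: fun_upd_apply)
qed

section \<open>Linear systems depending smoothly on parameters\<close>

text \<open>Induction on the number of functionals: subtracting a multiple of the last one makes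
  \<open>\<gamma>\<close> vanish on the common kernel of the others.\<close>

lemma functional_in_span:
  fixes L :: "'i \<Rightarrow> ('j \<Rightarrow> real) \<Rightarrow> real" and \<gamma> :: "('j \<Rightarrow> real) \<Rightarrow> real"
  assumes "finite P"
    and "\<And>p. p \<in> P \<Longrightarrow> \<forall>c w z. L p (\<lambda>i. w i + c * z i) = L p w + c * L p z"
    and "\<forall>c w z. \<gamma> (\<lambda>i. w i + c * z i) = \<gamma> w + c * \<gamma> z"
    and "\<And>w. (\<And>p. p \<in> P \<Longrightarrow> L p w = 0) \<Longrightarrow> \<gamma> w = 0"
  shows "\<exists>N. \<forall>w. \<gamma> w = (\<Sum>p\<in>P. N p * L p w)"
  using assms
proof (induction P arbitrary: \<gamma> rule: finite_induct)
  case empty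
  then show ?case by auto
next
  case (insert r P)
  show ?case
  proof (cases "\<forall>w. (\<forall>p\<in>P. L p w = 0) \<longrightarrow> L r w = 0")
    case True
    have "\<gamma> w = 0" if "\<And>p. p \<in> P \<Longrightarrow> L p w = 0" for w
      by (rule insert.prems(3)) (use that True in blast)
    then have "\<exists>N. \<forall>w. \<gamma> w = (\<Sum>p\<in>P. N p * L p w)"
      by (intro insert.IH) (use insert.prems in auto)
    then obtain N where N: "\<forall>w. \<gamma> w = (\<Sum>p\<in>P. N p * L p w)" by blast
    have "\<forall>w. \<gamma> w = (\<Sum>p\<in>insert r P. (if p = r then 0 else N p) * L p w)"
      using N insert.hyps by (auto intro!: sum.cong)
    then show ?thesis by (intro exI)
  next
    case False
    then obtain z where z: "\<forall>p\<in>P. L p z = 0" "L r z \<noteq> 0" by blast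
    define \<gamma>' where "\<gamma>' w = \<gamma> w + (- (\<gamma> z / L r z)) * L r w" for w
    have linr: "\<forall>c w z. L r (\<lambda>i. w i + c * z i) = L r w + c * L r z" using insert.prems(1) by blast
    have "\<exists>N. \<forall>w. \<gamma>' w = (\<Sum>p\<in>P. N p * L p w)"
    proof (rule insert.IH)
      show "\<forall>c w z. \<gamma>' (\<lambda>i. w i + c * z i) = \<gamma>' w + c * \<gamma>' z"
        using linr insert.prems(2) by (simp add: \<gamma>'_def algebra_simps)
      fix w assume w: "\<And>p. p \<in> P \<Longrightarrow> L p w = 0"
      have "\<gamma> (\<lambda>i. w i + (- (L r w / L r z)) * z i) = 0"
      proof (rule insert.prems(3))
        fix p assume p: "p \<in> insert r P"
        then have "L p (\<lambda>i. w i + (- (L r w / L r z)) * z i) = L p w + (- (L r w / L r z)) * L p z"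
          using insert.prems(1) by blast
        then show "L p (\<lambda>i. w i + (- (L r w / L r z)) * z i) = 0"
          using p w z by auto
      qed
      then have "\<gamma> w + (- (L r w / L r z)) * \<gamma> z = 0"
        by (simp only: insert.prems(2)[rule_format, of w "- (L r w / L r z)" z])
      then show "\<gamma>' w = 0" by (simp add: \<gamma>'_def mult.commute)
    qed (use insert.prems(1) in auto)
    then obtain N where N: "\<forall>w. \<gamma>' w = (\<Sum>p\<in>P. N p * L p w)" by blast
    have "\<gamma> w = (\<Sum>p\<in>insert r P. (if p = r then \<gamma> z / L r z else N p) * L p w)" for w
    proof -
      have "(\<Sum>p\<in>P. (if p = r then \<gamma> z / L r z else N p) * L p w) = (\<Sum>p\<in>P. N p * L p w)"
        by (rule sum.cong) (use insert.hyps in auto)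
      moreover have "\<gamma> w = \<gamma>' w + \<gamma> z / L r z * L r w" by (simp add: \<gamma>'_def)
      ultimately show ?thesis using N insert.hyps by simp
    qed
    then show ?thesis by (intro exI allI)
  qed
qed

text \<open>A trivial kernel means that each coordinate functional vanishes wherever all rows do, so
  it is a combination of the rows; its coefficients form one row of a left inverse.\<close>

lemma nonsingular_left_inverse:
  fixes A :: "'p \<Rightarrow> 'i \<Rightarrow> real"
  assumes P: "finite P" and Q: "finite Q"
    and nonsing: "\<forall>z. (\<forall>p\<in>P. (\<Sum>q\<in>Q. A p q * z q) = 0) \<longrightarrow> (\<forall>q\<in>Q. z q = 0)"
  shows "\<exists>N. \<forall>q\<in>Q. \<forall>x. x q = (\<Sum>p\<in>P. N q p * (\<Sum>q'\<in>Q. A p q' * x q'))"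
proof -
  have "\<forall>q\<in>Q. \<exists>N. \<forall>x. x q = (\<Sum>p\<in>P. N p * (\<Sum>q'\<in>Q. A p q' * x q'))"
  proof
    fix q assume q: "q \<in> Q"
    show "\<exists>N. \<forall>x. x q = (\<Sum>p\<in>P. N p * (\<Sum>q'\<in>Q. A p q' * x q'))"
      by (rule functional_in_span[OF P, where L = "\<lambda>p x. \<Sum>q'\<in>Q. A p q' * x q'" and \<gamma> = "\<lambda>x. x q"])
         (use nonsing q in \<open>auto simp: algebra_simps sum.distrib sum_distrib_left\<close>)
  qed
  then show ?thesis by (rule bchoice)
qed

text \<open>The solution carries no regularity hypothesis. A left inverse N of the matrix at s gives
  x t = N (r t - E t x t), where E t = A t - A s tends to 0. This bounds x near s, the bound sends E
  t x t to 0, so x is continuous at s, and the same formula divided by t - s has a limit.\<close>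

lemma linear_system_has_derivative:
  fixes A :: "real \<Rightarrow> 'p \<Rightarrow> 'i \<Rightarrow> real" and x :: "real \<Rightarrow> 'i \<Rightarrow> real" and r :: "real \<Rightarrow> 'p \<Rightarrow> real"
  assumes P: "finite P" and Q: "finite Q" and s: "s \<in> S" "s islimpt S"
    and A: "\<And>p q. p \<in> P \<Longrightarrow> q \<in> Q \<Longrightarrow> ((\<lambda>t. A t p q) has_real_derivative A' p q) (at s within S)"
    and r: "\<And>p. p \<in> P \<Longrightarrow> ((\<lambda>t. r t p) has_real_derivative r' p) (at s within S)"
    and nonsing: "\<forall>z. (\<forall>p\<in>P. (\<Sum>q\<in>Q. A s p q * z q) = 0) \<longrightarrow> (\<forall>q\<in>Q. z q = 0)"
    and eq: "\<And>t p. t \<in> S \<Longrightarrow> p \<in> P \<Longrightarrow> (\<Sum>q\<in>Q. A t p q * x t q) = r t p"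
  shows "\<exists>x'. (\<forall>q\<in>Q. ((\<lambda>t. x t q) has_real_derivative x' q) (at s within S)) \<and>
    (\<forall>p\<in>P. (\<Sum>q\<in>Q. A' p q * x s q + A s p q * x' q) = r' p)"
proof -
  let ?F = "at s within S"
  obtain N where "\<forall>q\<in>Q. \<forall>x. x q = (\<Sum>p\<in>P. N q p * (\<Sum>q'\<in>Q. A s p q' * x q'))"
    using nonsingular_left_inverse[OF P Q nonsing] by blast
  then have N: "x q = (\<Sum>p\<in>P. N q p * (\<Sum>q'\<in>Q. A s p q' * x q'))" if "q \<in> Q" for x q
    using that by blast
  define E where "E t p q = A t p q - A s p q" for t p q
  have E0: "((\<lambda>t. E t p q) \<longlongrightarrow> 0) ?F" if "p \<in> P" "q \<in> Q" for p q
  proof -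
    have "((\<lambda>t. A t p q) \<longlongrightarrow> A s p q) ?F"
      using DERIV_isCont A[OF that] s by (metis DERIV_continuous continuous_within)
    then show ?thesis unfolding E_def by (rule LIM_zero)
  qed
  have r0: "((\<lambda>t. r t p) \<longlongrightarrow> r s p) ?F" if "p \<in> P" for p
    using r[OF that] by (metis DERIV_continuous continuous_within)
  have inS: "\<forall>\<^sub>F t in ?F. t \<in> S" by (auto simp: eventually_at intro!: exI[of _ 1])
  \<comment> \<open>Only the fixed inverse at s occurs here; the unknown on the right is multiplied
    by the small perturbation \<open>E t\<close>.\<close>
  have xt: "x t q = (\<Sum>p\<in>P. N q p * (r t p - (\<Sum>q'\<in>Q. E t p q' * x t q')))" if "t \<in> S" "q \<in> Q" for t q
  proof -
    have "(\<Sum>q'\<in>Q. A s p q' * x t q') = r t p - (\<Sum>q'\<in>Q. E t p q' * x t q')" if "p \<in> P" for p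
      using eq[OF \<open>t \<in> S\<close> that] by (simp add: E_def algebra_simps sum_subtractf)
    with N[OF \<open>q \<in> Q\<close>, of "x t"] show ?thesis by simp
  qed
  define n where "n t = (\<Sum>q\<in>Q. \<bar>x t q\<bar>)" for t
  define \<alpha> where "\<alpha> t = (\<Sum>q\<in>Q. \<Sum>p\<in>P. \<bar>N q p\<bar> * \<bar>r t p\<bar>)" for t
  define \<beta> where "\<beta> t = (\<Sum>q\<in>Q. \<Sum>p\<in>P. \<bar>N q p\<bar> * (\<Sum>q'\<in>Q. \<bar>E t p q'\<bar>))" for t
  have nle: "n t \<le> \<alpha> t + \<beta> t * n t" if t: "t \<in> S" for t
  proof -
    have n1: "\<bar>x t q\<bar> \<le> n t" if "q \<in> Q" for q
      unfolding n_def using Q that by (intro member_le_sum) auto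
    have "\<bar>x t q\<bar> \<le> (\<Sum>p\<in>P. \<bar>N q p\<bar> * \<bar>r t p\<bar>) + (\<Sum>p\<in>P. \<bar>N q p\<bar> * (\<Sum>q'\<in>Q. \<bar>E t p q'\<bar>)) * n t"
      if q: "q \<in> Q" for q
    proof -
      have "\<bar>x t q\<bar> \<le> (\<Sum>p\<in>P. \<bar>N q p * (r t p - (\<Sum>q'\<in>Q. E t p q' * x t q'))\<bar>)"
        unfolding xt[OF t q] by (rule sum_abs)
      also have "\<dots> \<le> (\<Sum>p\<in>P. \<bar>N q p\<bar> * (\<bar>r t p\<bar> + (\<Sum>q'\<in>Q. \<bar>E t p q'\<bar>) * n t))"
        unfolding abs_mult
      proof (intro sum_mono mult_left_mono)
        fix p
        have "\<bar>\<Sum>q'\<in>Q. E t p q' * x t q'\<bar> \<le> (\<Sum>q'\<in>Q. \<bar>E t p q'\<bar>) * n t"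
          unfolding sum_distrib_right
          by (rule order_trans[OF sum_abs]) (auto simp: abs_mult intro!: sum_mono mult_left_mono n1)
        then show "\<bar>r t p - (\<Sum>q'\<in>Q. E t p q' * x t q')\<bar> \<le> \<bar>r t p\<bar> + (\<Sum>q'\<in>Q. \<bar>E t p q'\<bar>) * n t"
          by linarith
      qed auto
      also have "\<dots> = (\<Sum>p\<in>P. \<bar>N q p\<bar> * \<bar>r t p\<bar>) + (\<Sum>p\<in>P. \<bar>N q p\<bar> * (\<Sum>q'\<in>Q. \<bar>E t p q'\<bar>)) * n t"
        by (simp add: distrib_left sum.distrib sum_distrib_right mult.assoc)
      finally show ?thesis .
    qed
    then have "n t \<le> (\<Sum>q\<in>Q. (\<Sum>p\<in>P. \<bar>N q p\<bar> * \<bar>r t p\<bar>) + (\<Sum>p\<in>P. \<bar>N q p\<bar> * (\<Sum>q'\<in>Q. \<bar>E t p q'\<bar>)) * n t)"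
      \<comment> \<open>Only the \<open>n t\<close> on the left is unfolded; the one on the right is
        the quantity to be absorbed.\<close>
      unfolding n_def[of t, THEN arg_cong[of _ _ "\<lambda>z. z \<le> _"]] by (rule sum_mono)
    then show ?thesis by (simp add: \<alpha>_def \<beta>_def sum.distrib sum_distrib_right)
  qed
  have "(\<alpha> \<longlongrightarrow> \<alpha> s) ?F" unfolding \<alpha>_def by (intro tendsto_intros r0)
  then have "\<forall>\<^sub>F t in ?F. \<alpha> t < \<alpha> s + 1" by (rule order_tendstoD) simp
  moreover have "(\<beta> \<longlongrightarrow> (\<Sum>q\<in>Q. \<Sum>p\<in>P. \<bar>N q p\<bar> * (\<Sum>q'\<in>Q. \<bar>0\<bar>))) ?F"
    unfolding \<beta>_def by (intro tendsto_intros E0)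
  then have "\<forall>\<^sub>F t in ?F. \<beta> t < 1/2" by (rule order_tendstoD) simp
  \<comment> \<open>As soon as the perturbation factor is below 1/2, half of \<open>n t\<close>
    moves to the left. This is the a priori bound near s.\<close>
  ultimately have nb: "\<forall>\<^sub>F t in ?F. n t \<le> 2 * (\<alpha> s + 1)"
    using inS
  proof eventually_elim
    case (elim t)
    have "0 \<le> n t" by (simp add: n_def sum_nonneg)
    then have "\<beta> t * n t \<le> 1/2 * n t" using elim by (intro mult_right_mono) auto
    then have "n t \<le> \<alpha> t + 1/2 * n t" using nle[OF elim(3)] by linarith
    moreover have "x \<le> 2 * (a + 1)" if "x \<le> b + 1/2 * x" "b < a + 1" for x a b :: real
      using that by (simp add: field_simps)
    ultimately show ?case using elim(1) by blast
  qed
  have Ex0: "((\<lambda>t. E t p q * x t q) \<longlongrightarrow> 0) ?F" if pq: "p \<in> P" "q \<in> Q" for p q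
  proof (rule tendsto_0_le[where K = "2 * (\<alpha> s + 1)", OF E0[OF pq]])
    show "\<forall>\<^sub>F t in ?F. norm (E t p q * x t q) \<le> norm (E t p q) * (2 * (\<alpha> s + 1))"
      using nb
    proof eventually_elim
      case (elim t)
      have "\<bar>x t q\<bar> \<le> n t" unfolding n_def using Q pq by (intro member_le_sum) auto
      then show ?case using elim by (auto simp: abs_mult intro!: mult_left_mono)
    qed
  qed
  have x0: "((\<lambda>t. x t q) \<longlongrightarrow> x s q) ?F" if q: "q \<in> Q" for q
  proof -
    have "((\<lambda>t. \<Sum>p\<in>P. N q p * (r t p - (\<Sum>q'\<in>Q. E t p q' * x t q'))) \<longlongrightarrow>
       (\<Sum>p\<in>P. N q p * (r s p - (\<Sum>q'\<in>Q. 0)))) ?F"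
      by (intro tendsto_intros r0 Ex0)
    also have "(\<Sum>p\<in>P. N q p * (r s p - (\<Sum>q'\<in>Q. 0))) = x s q"
      using xt[OF s(1) q] by (simp add: E_def)
    finally show ?thesis
      by (rule Lim_transform_eventually) (use inS xt[OF _ q] in \<open>auto elim!: eventually_mono\<close>)
  qed
  \<comment> \<open>The formal derivative of the solution: the inverse applied to r' - A' x.\<close>
  define x' where "x' q = (\<Sum>p\<in>P. N q p * (r' p - (\<Sum>q'\<in>Q. A' p q' * x s q')))" for q
  have der: "((\<lambda>t. x t q) has_real_derivative x' q) ?F" if q: "q \<in> Q" for q
    unfolding has_field_derivative_iff
  proof (rule Lim_transform_eventually)
    show "((\<lambda>t. \<Sum>p\<in>P. N q p * ((r t p - r s p) / (t - s) - (\<Sum>q'\<in>Q. ((A t p q' - A s p q') / (t - s)) * x t q')))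
       \<longlongrightarrow> x' q) ?F"
      unfolding x'_def
      by (intro tendsto_intros x0 A[unfolded has_field_derivative_iff] r[unfolded has_field_derivative_iff])
    show "\<forall>\<^sub>F t in ?F. (\<Sum>p\<in>P. N q p * ((r t p - r s p) / (t - s) - (\<Sum>q'\<in>Q. ((A t p q' - A s p q') / (t - s)) * x t q'))) =
      (x t q - x s q) / (t - s)"
      using inS
    proof eventually_elim
      case (elim t)
      have "x t q - x s q = (\<Sum>p\<in>P. N q p * (r t p - r s p - (\<Sum>q'\<in>Q. E t p q' * x t q')))"
        unfolding xt[OF elim q] xt[OF s(1) q] by (simp add: E_def sum_subtractf sum.distrib algebra_simps)
      moreover have "(\<Sum>q'\<in>Q. (A t p q' - A s p q') / (t - s) * x t q') = (\<Sum>q'\<in>Q. E t p q' * x t q') / (t - s)" for p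
        by (simp add: E_def sum_divide_distrib)
      ultimately show ?case
        by (simp add: sum_divide_distrib[of _ P] diff_divide_distrib[symmetric])
    qed
  qed
  \<comment> \<open>The equation holds on all of \<open>S\<close>, so both sides have the same
    derivative, which is unique at a limit point.\<close>
  have "(\<Sum>q\<in>Q. A' p q * x s q + A s p q * x' q) = r' p" if p: "p \<in> P" for p
  proof -
    have 1: "((\<lambda>t. \<Sum>q\<in>Q. A t p q * x t q) has_real_derivative (\<Sum>q\<in>Q. A' p q * x s q + x' q * A s p q)) ?F"
      by (rule DERIV_sum, rule DERIV_cong, rule DERIV_mult', rule A[OF p], assumption, rule der, assumption)
         (simp add: algebra_simps)
    have 2: "((\<lambda>t. \<Sum>q\<in>Q. A t p q * x t q) has_real_derivative r' p) ?F"
      by (rule has_field_derivative_transform_within[OF r[OF p] zero_less_one s(1)]) (use eq p in auto)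
    have "(\<Sum>q\<in>Q. A' p q * x s q + x' q * A s p q) = r' p"
      by (rule vector_derivative_unique_within[OF _ 1[unfolded has_real_derivative_iff_has_vector_derivative]
            2[unfolded has_real_derivative_iff_has_vector_derivative]])
         (simp add: trivial_limit_within s(2))
    then show ?thesis by (simp add: mult.commute)
  qed
  with der show ?thesis by blast
qed

text \<open>\<open>M m\<close> plays the role of the derivative of order m of the system matrix
  \<open>M (\<lambda>_. 0)\<close>; since differentiating it in any direction j leads to the index m
  + e_j, independence of the order is built in. The right-hand side \<open>b\<close> is constant in
  y, and \<open>c\<close> is any solution, without assumed smoothness.\<close>

locale parametric_linear_system =
  fixes U :: "param set" and P :: "'p set" and Q :: "'i set"
    and M :: "(nat \<Rightarrow> nat) \<Rightarrow> param \<Rightarrow> 'p \<Rightarrow> 'i \<Rightarrow> real"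
    and b :: "'p \<Rightarrow> real" and c :: "param \<Rightarrow> 'i \<Rightarrow> real"
  assumes limpt: "y \<in> U \<Longrightarrow> y j islimpt coord_slice U y j"
    and finite_rows: "finite P" and finite_cols: "finite Q"
    and M_deriv: "finsupp m \<Longrightarrow> y \<in> U \<Longrightarrow> p \<in> P \<Longrightarrow> q \<in> Q \<Longrightarrow>
      ((\<lambda>t. M m (y(j := t)) p q) has_real_derivative M (m(j := Suc (m j))) y p q) (at (y j) within coord_slice U y j)"
    and nonsing: "y \<in> U \<Longrightarrow> (\<And>p. p \<in> P \<Longrightarrow> (\<Sum>q\<in>Q. M (\<lambda>_. 0) y p q * z q) = 0) \<Longrightarrow> q \<in> Q \<Longrightarrow> z q = 0"
    and sol: "y \<in> U \<Longrightarrow> p \<in> P \<Longrightarrow> (\<Sum>q\<in>Q. M (\<lambda>_. 0) y p q * c y q) = b p"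
begin

definition sol_deriv :: "(nat \<Rightarrow> nat) \<Rightarrow> param \<Rightarrow> 'i \<Rightarrow> real" where
  "sol_deriv \<nu> y q = mixed_partial U \<nu> (\<lambda>z. c z q) y"

definition row_sum :: "(nat \<Rightarrow> nat) \<Rightarrow> (nat \<Rightarrow> nat) \<Rightarrow> param \<Rightarrow> 'p \<Rightarrow> real" where
  "row_sum m \<mu> y p = (\<Sum>q\<in>Q. M m y p q * sol_deriv \<mu> y q)"

definition leibniz :: "(nat \<Rightarrow> nat) \<Rightarrow> bool" where
  "leibniz \<nu> \<longleftrightarrow> (\<forall>y\<in>U. \<forall>p\<in>P. (\<Sum>m | m \<le> \<nu>. real (multi_binomial \<nu> m) * row_sum m (\<lambda>i. \<nu> i - m i) y p) =
      (if \<nu> = (\<lambda>_. 0) then b p else 0))"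

text \<open>More than existence of a derivative: its value is the mixed partial of index \<nu> + e_j
  even when j is not the largest coordinate, where \<open>mixed_partial\<close> differentiates in a
  different order.\<close>

definition sol_differentiable :: "(nat \<Rightarrow> nat) \<Rightarrow> nat \<Rightarrow> bool" where
  "sol_differentiable \<nu> j \<longleftrightarrow> (\<forall>y\<in>U. \<forall>q\<in>Q. ((\<lambda>t. sol_deriv \<nu> (y(j := t)) q) has_real_derivative
      sol_deriv (\<nu>(j := Suc (\<nu> j))) y q) (at (y j) within coord_slice U y j))"

lemma leibniz_split:
  assumes "finsupp \<nu>"
  shows "(\<Sum>m | m \<le> \<nu>. real (multi_binomial \<nu> m) * g m) =
    g (\<lambda>_. 0) + (\<Sum>m | m \<noteq> (\<lambda>_. 0) \<and> m \<le> \<nu>. real (multi_binomial \<nu> m) * g m)"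
proof -
  have "{m. m \<le> \<nu>} = insert (\<lambda>_. 0) {m. m \<noteq> (\<lambda>_. 0) \<and> m \<le> \<nu>}" by (auto simp: le_fun_def)
  moreover have "finite {m. m \<noteq> (\<lambda>_. 0) \<and> m \<le> \<nu>}"
    by (rule finite_subset[OF _ finite_le_finsupp[OF assms]]) auto
  ultimately show ?thesis by simp
qed

lemma leibniz_zero: "leibniz (\<lambda>_. 0)"
proof -
  have "{m. m \<le> (\<lambda>_::nat. 0::nat)} = {\<lambda>_. 0}" by (auto simp: le_fun_def)
  then show ?thesis by (simp only: leibniz_def row_sum_def sol_deriv_def mixed_partial_zero) (simp add: sol)
qed

text \<open>Differentiating the Leibniz identity for \<open>\<nu>\<close> in direction j yields the identity for
  \<open>\<nu> + e_j\<close>, with the derivative d of the highest-order term in place of the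
  mixed partial of order \<open>\<nu> + e_j\<close>.\<close>

lemma sol_deriv_step:
  assumes f: "finsupp \<nu>" and L: "leibniz \<nu>" and y: "y \<in> U"
    and D: "\<And>m. m \<le> \<nu> \<Longrightarrow> m \<noteq> (\<lambda>_. 0) \<Longrightarrow> sol_differentiable (\<lambda>i. \<nu> i - m i) j"
  shows "\<exists>d. (\<forall>q\<in>Q. ((\<lambda>t. sol_deriv \<nu> (y(j := t)) q) has_real_derivative d q) (at (y j) within coord_slice U y j)) \<and>
    (\<forall>p\<in>P. (\<Sum>q\<in>Q. M (\<lambda>_. 0) y p q * d q) +
      (\<Sum>m | m \<noteq> (\<lambda>_. 0) \<and> m \<le> \<nu>(j := Suc (\<nu> j)).
        real (multi_binomial (\<nu>(j := Suc (\<nu> j))) m) * row_sum m (\<lambda>i. (\<nu>(j := Suc (\<nu> j))) i - m i) y p) = 0)"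
proof -
  let ?S = "coord_slice U y j" and ?\<nu>' = "\<nu>(j := Suc (\<nu> j))"

  have yS: "y j \<in> ?S" using y by (simp add: coord_slice_def)
  have US: "y(j := t) \<in> U" if "t \<in> ?S" for t using that by (simp add: coord_slice_def)
  \<comment> \<open>With all lower-order terms moved to the right, the partial of order \<nu> solves
    a system with the original matrix, and \<open>D\<close> makes the new right-hand side
    differentiable.\<close>
  define R where "R z p = (if \<nu> = (\<lambda>_. 0) then b p else 0) -
     (\<Sum>m | m \<noteq> (\<lambda>_. 0) \<and> m \<le> \<nu>. real (multi_binomial \<nu> m) * row_sum m (\<lambda>i. \<nu> i - m i) z p)" for z p
  define R' where "R' p = - (\<Sum>m | m \<noteq> (\<lambda>_. 0) \<and> m \<le> \<nu>. real (multi_binomial \<nu> m) *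
       (row_sum (m(j := Suc (m j))) (\<lambda>i. \<nu> i - m i) y p + row_sum m (\<lambda>i. ?\<nu>' i - m i) y p))" for p
  have row_deriv: "((\<lambda>t. row_sum m (\<lambda>i. \<nu> i - m i) (y(j := t)) p) has_real_derivative
      row_sum (m(j := Suc (m j))) (\<lambda>i. \<nu> i - m i) y p + row_sum m (\<lambda>i. ?\<nu>' i - m i) y p) (at (y j) within ?S)"
    if m: "m \<le> \<nu>" "m \<noteq> (\<lambda>_. 0)" and p: "p \<in> P" for m p
  proof -
    have e: "(\<lambda>i. ?\<nu>' i - m i) = (\<lambda>i. \<nu> i - m i)(j := Suc (\<nu> j - m j))"
      using m(1) by (auto simp: le_fun_def Suc_diff_le)
    have 1: "((\<lambda>t. sol_deriv (\<lambda>i. \<nu> i - m i) (y(j := t)) q) has_real_derivative sol_deriv (\<lambda>i. ?\<nu>' i - m i) y q)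
      (at (y j) within ?S)" if "q \<in> Q" for q
      using D[OF m, unfolded sol_differentiable_def, rule_format, OF y that] unfolding e .
    have fm: "finsupp m" using finsupp_le[OF f m(1)] .
    show ?thesis unfolding row_sum_def sum.distrib[symmetric]
      by (rule DERIV_sum, rule DERIV_cong, rule DERIV_mult', rule M_deriv[OF fm y p], assumption, rule 1, assumption)
         auto
  qed
  have Rd: "((\<lambda>t. R (y(j := t)) p) has_real_derivative R' p) (at (y j) within ?S)" if "p \<in> P" for p
    unfolding R_def R'_def
    by (rule DERIV_cong, rule DERIV_diff, rule DERIV_const, rule DERIV_sum, rule DERIV_cmult, rule row_deriv)
       (use that in auto)
  have eq: "(\<Sum>q\<in>Q. M (\<lambda>_. 0) (y(j := t)) p q * sol_deriv \<nu> (y(j := t)) q) = R (y(j := t)) p"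
    if t: "t \<in> ?S" and p: "p \<in> P" for t p
    using L[unfolded leibniz_def leibniz_split[OF f] row_sum_def[of "\<lambda>_. 0"], rule_format, OF US[OF t] p]
    unfolding R_def by (simp add: eq_diff_eq)
  have ns: "\<forall>z. (\<forall>p\<in>P. (\<Sum>q\<in>Q. M (\<lambda>_. 0) y p q * z q) = 0) \<longrightarrow> (\<forall>q\<in>Q. z q = 0)"
    using nonsing[OF y] by blast
  obtain d where d0: "(\<forall>q\<in>Q. ((\<lambda>t. sol_deriv \<nu> (y(j := t)) q) has_real_derivative d q) (at (y j) within ?S)) \<and>
      (\<forall>p\<in>P. (\<Sum>q\<in>Q. M ((\<lambda>_. 0)(j := Suc 0)) y p q * sol_deriv \<nu> y q + M (\<lambda>_. 0) y p q * d q) = R' p)"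
    by (rule exE[OF linear_system_has_derivative[where A = "\<lambda>t p q. M (\<lambda>_. 0) (y(j := t)) p q" and A' = "M ((\<lambda>_. 0)(j := Suc 0)) y"
          and x = "\<lambda>t. sol_deriv \<nu> (y(j := t))" and r = "\<lambda>t. R (y(j := t))" and P = P and Q = Q and s = "y j" and S = ?S and r' = R',
          unfolded fun_upd_triv, OF finite_rows finite_cols yS limpt[OF y, of j] M_deriv[OF finsupp_zero y, of _ _ j] Rd ns eq]])
  note d = conjunct1[OF d0, rule_format] conjunct2[OF d0, rule_format]
  show ?thesis
  proof (intro exI[of _ d] conjI ballI d(1))
    fix p assume p: "p \<in> P"
    define z :: "nat \<Rightarrow> nat" where "z = (\<lambda>_. 0)"
    \<comment> \<open>Putting \<open>d\<close> into the term at \<open>z\<close> gives all terms a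
      common form, so \<open>sum_multi_binomial_Suc\<close> applies. The shifted indices m + e_j are
      never \<open>z\<close>, so \<open>H\<close> takes its regular value there.\<close>
    define H where "H m = (if m = z then (\<Sum>q\<in>Q. M z y p q * d q) else row_sum m (\<lambda>i. ?\<nu>' i - m i) y p)" for m
    have H1: "H (m(j := Suc (m j))) = row_sum (m(j := Suc (m j))) (\<lambda>i. \<nu> i - m i) y p" for m
    proof -
      have "m(j := Suc (m j)) \<noteq> z" by (auto simp: z_def fun_eq_iff)
      moreover have "(\<lambda>i. ?\<nu>' i - (m(j := Suc (m j))) i) = (\<lambda>i. \<nu> i - m i)" by auto
      ultimately show ?thesis by (simp add: H_def)
    qed
    have "(\<Sum>m | m \<le> ?\<nu>'. real (multi_binomial ?\<nu>' m) * H m) =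
      (\<Sum>m | m \<le> \<nu>. real (multi_binomial \<nu> m) * (H (m(j := Suc (m j))) + H m))"
      by (rule sum_multi_binomial_Suc[OF f, symmetric])
    also have "\<dots> = (H (z(j := Suc 0)) + H z) +
       (\<Sum>m | m \<noteq> z \<and> m \<le> \<nu>. real (multi_binomial \<nu> m) * (H (m(j := Suc (m j))) + H m))"
      unfolding z_def by (subst leibniz_split[OF f]) simp
    also have "(\<Sum>m | m \<noteq> z \<and> m \<le> \<nu>. real (multi_binomial \<nu> m) * (H (m(j := Suc (m j))) + H m)) = - R' p"
      unfolding R'_def minus_minus z_def
      by (rule sum.cong[OF refl]) (unfold H1, simp add: H_def z_def)
    also have "H (z(j := Suc 0)) + H z = R' p"
    proof -
      have "H (z(j := Suc 0)) = (\<Sum>q\<in>Q. M (z(j := Suc 0)) y p q * sol_deriv \<nu> y q)"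
        using H1[of z] by (simp add: row_sum_def z_def)
      then show ?thesis using d(2)[OF p] unfolding sum.distrib z_def[symmetric] by (simp add: H_def)
    qed
    finally have "(\<Sum>m | m \<le> ?\<nu>'. real (multi_binomial ?\<nu>' m) * H m) = 0" by (simp del: fun_upd_apply)
    moreover have "(\<Sum>m | m \<le> ?\<nu>'. real (multi_binomial ?\<nu>' m) * H m) =
      H z + (\<Sum>m | m \<noteq> z \<and> m \<le> ?\<nu>'. real (multi_binomial ?\<nu>' m) * H m)"
      unfolding z_def by (rule leibniz_split[OF finsupp_upd[OF f]])
    moreover have "(\<Sum>m | m \<noteq> z \<and> m \<le> ?\<nu>'. real (multi_binomial ?\<nu>' m) * H m) =
      (\<Sum>m | m \<noteq> z \<and> m \<le> ?\<nu>'. real (multi_binomial ?\<nu>' m) * row_sum m (\<lambda>i. ?\<nu>' i - m i) y p)"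
      by (rule sum.cong) (auto simp: H_def)
    ultimately show "(\<Sum>q\<in>Q. M (\<lambda>_. 0) y p q * d q) +
      (\<Sum>m | m \<noteq> (\<lambda>_. 0) \<and> m \<le> ?\<nu>'. real (multi_binomial ?\<nu>' m) * row_sum m (\<lambda>i. ?\<nu>' i - m i) y p) = 0"
      by (simp add: H_def z_def)
  qed
qed

text \<open>Both claims are proved together by induction on the order, differentiability one order
  behind the identity. An index of the next order is reached through its top coordinate, where the
  mixed partial is the derivative by definition; this gives the identity. For any other direction
  the derivative and the mixed partial then solve the same nonsingular system.\<close>

theorem smooth_and_leibniz:
  assumes "finsupp \<nu>"
  shows "leibniz \<nu>" "sol_differentiable \<nu> j"
proof -
  have "(\<forall>\<nu>. finsupp \<nu> \<longrightarrow> msize \<nu> \<le> n \<longrightarrow> leibniz \<nu>) \<and>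
    (\<forall>\<nu> j. finsupp \<nu> \<longrightarrow> msize \<nu> < n \<longrightarrow> sol_differentiable \<nu> j)" for n
  proof (induction n)
    case 0
    show ?case using leibniz_zero by (auto simp: msize_eq_0)
  next
    case (Suc n)
    have D: "sol_differentiable (\<lambda>i. \<nu> i - m i) j"
      if m: "m \<le> \<nu>" "m \<noteq> (\<lambda>_. 0)" "finsupp \<nu>" "msize \<nu> \<le> n" for \<nu> m j
    proof -
      let ?S = "{i. \<nu> i \<noteq> 0}"
      have f: "finite ?S" using m by (simp add: finsupp_def)
      obtain i where i: "m i \<noteq> 0" using m(2) by auto
      have "msize (\<lambda>i. \<nu> i - m i) < msize \<nu>"
        unfolding msize_superset[OF f order_refl]
      proof (subst msize_superset[OF f])
        have "m i \<le> \<nu> i" using m(1) by (auto simp: le_fun_def)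
        then show "(\<Sum>i\<in>?S. \<nu> i - m i) < sum \<nu> ?S"
          using i by (intro sum_strict_mono_ex1[OF f]) (auto intro: exI[of _ i])
      qed auto
      then show ?thesis using Suc.IH m finsupp_diff by auto
    qed
    have lS: "leibniz \<nu>" if \<nu>: "finsupp \<nu>" "msize \<nu> \<le> Suc n" for \<nu>
    proof (cases "\<nu> = (\<lambda>_. 0)")
      case False
      then obtain \<mu> j where \<mu>: "\<nu> = \<mu>(j := Suc (\<mu> j))" "\<forall>i>j. \<mu> i = 0" "finsupp \<mu>"
        using multi_index_top_cases \<nu>(1) by blast
      have \<mu>n: "msize \<mu> \<le> n" using \<nu>(2) msize_Suc[OF \<mu>(3)] by (simp add: \<mu>(1))
      have L\<mu>: "leibniz \<mu>" using Suc.IH \<mu>(3) \<mu>n by blast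
      show ?thesis
        unfolding leibniz_def
      proof (intro ballI)
        fix y p assume y: "y \<in> U" and p: "p \<in> P"
        obtain d where d0: "(\<forall>q\<in>Q. ((\<lambda>t. sol_deriv \<mu> (y(j := t)) q) has_real_derivative d q) (at (y j) within coord_slice U y j)) \<and>
          (\<forall>p\<in>P. (\<Sum>q\<in>Q. M (\<lambda>_. 0) y p q * d q) +
            (\<Sum>m | m \<noteq> (\<lambda>_. 0) \<and> m \<le> \<nu>. real (multi_binomial \<nu> m) * row_sum m (\<lambda>i. \<nu> i - m i) y p) = 0)"
          unfolding \<mu>(1) by (rule exE[OF sol_deriv_step[where j = j, OF \<mu>(3) L\<mu> y D[OF _ _ \<mu>(3) \<mu>n]]])
        note d = conjunct1[OF d0, rule_format] conjunct2[OF d0, rule_format]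
        \<comment> \<open>j is the top coordinate of \<nu>, so the mixed partial unfolds to exactly
          this derivative.\<close>
        have "d q = sol_deriv \<nu> y q" if "q \<in> Q" for q
          unfolding sol_deriv_def \<mu>(1) mixed_partial_Suc_top[OF \<mu>(3,2)]
          by (rule partial_deriv_eqI[OF y limpt[OF y], symmetric]) (use d(1)[OF that] in \<open>auto simp: sol_deriv_def\<close>)
        then have "row_sum (\<lambda>_. 0) \<nu> y p = (\<Sum>q\<in>Q. M (\<lambda>_. 0) y p q * d q)" by (simp add: row_sum_def)
        then show "(\<Sum>m | m \<le> \<nu>. real (multi_binomial \<nu> m) * row_sum m (\<lambda>i. \<nu> i - m i) y p) = (if \<nu> = (\<lambda>_. 0) then b p else 0)"
          unfolding leibniz_split[OF \<nu>(1)] using d(2)[OF p] False by simp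
      qed
    qed (use leibniz_zero in simp)
    have dS: "sol_differentiable \<nu> j" if \<nu>: "finsupp \<nu>" "msize \<nu> < Suc n" for \<nu> j
      unfolding sol_differentiable_def
    proof (intro ballI)
      fix y q assume y: "y \<in> U" and q: "q \<in> Q"
      let ?\<nu>' = "\<nu>(j := Suc (\<nu> j))"
      have f': "finsupp ?\<nu>'" and nz: "?\<nu>' \<noteq> (\<lambda>_. 0)"
        using finsupp_upd[OF \<nu>(1)] by (auto simp: fun_eq_iff)
      have \<nu>n: "msize \<nu> \<le> n" using \<nu> by simp
      have L: "leibniz \<nu>" "leibniz ?\<nu>'" using lS[OF \<nu>(1)] lS[OF f'] msize_Suc[OF \<nu>(1)] \<nu>n by auto
      obtain d where d0: "(\<forall>q\<in>Q. ((\<lambda>t. sol_deriv \<nu> (y(j := t)) q) has_real_derivative d q) (at (y j) within coord_slice U y j)) \<and>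
          (\<forall>p\<in>P. (\<Sum>q\<in>Q. M (\<lambda>_. 0) y p q * d q) +
            (\<Sum>m | m \<noteq> (\<lambda>_. 0) \<and> m \<le> ?\<nu>'. real (multi_binomial ?\<nu>' m) * row_sum m (\<lambda>i. ?\<nu>' i - m i) y p) = 0)"
        by (rule exE[OF sol_deriv_step[where j = j, OF \<nu>(1) L(1) y D[OF _ _ \<nu>(1) \<nu>n]]])
      note d = conjunct1[OF d0, rule_format] conjunct2[OF d0, rule_format]
      \<comment> \<open>The derivative in direction j and the mixed partial of order \<nu> + e_j
        have equal images under the matrix; uniqueness replaces a theorem on the symmetry of second
        derivatives.\<close>
      have "d q - sol_deriv ?\<nu>' y q = 0"
      proof (rule nonsing[OF y _ q, where z = "\<lambda>q. d q - sol_deriv ?\<nu>' y q"])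
        fix p assume p: "p \<in> P"
        have "row_sum (\<lambda>_. 0) ?\<nu>' y p +
          (\<Sum>m | m \<noteq> (\<lambda>_. 0) \<and> m \<le> ?\<nu>'. real (multi_binomial ?\<nu>' m) * row_sum m (\<lambda>i. ?\<nu>' i - m i) y p) = 0"
          using L(2)[unfolded leibniz_def leibniz_split[OF f']] y p nz by (simp del: fun_upd_apply)
        then show "(\<Sum>q\<in>Q. M (\<lambda>_. 0) y p q * (d q - sol_deriv ?\<nu>' y q)) = 0"
          using d(2)[OF p] by (simp add: row_sum_def algebra_simps sum_subtractf del: fun_upd_apply)
      qed
      then show "((\<lambda>t. sol_deriv \<nu> (y(j := t)) q) has_real_derivative sol_deriv ?\<nu>' y q) (at (y j) within coord_slice U y j)"
        using d(1)[OF q] by simp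
    qed
    show ?case using lS dS by auto
  qed
  then show "leibniz \<nu>" "sol_differentiable \<nu> j" using assms by blast+
qed

end

section \<open>Faces and the surface measure\<close>

text \<open>The part w of m orthogonal to n, scaled into the disc, is orthogonal to m as well; hence
  w is orthogonal to itself and vanishes.\<close>

lemma parallel_of_orthogonal_disc:
  fixes n m :: "'a::real_inner"
  assumes "norm n = 1" "norm m = 1" "r > 0"
    and "\<And>v. v \<bullet> n = 0 \<Longrightarrow> norm v < r \<Longrightarrow> v \<bullet> m = 0"
  shows "m = n \<or> m = - n"
proof -
  have nn: "n \<bullet> n = 1" "m \<bullet> m = 1" using assms(1,2) by (auto simp: norm_eq_1)
  define w where "w = m - (m \<bullet> n) *\<^sub>R n"
  have wn: "w \<bullet> n = 0" by (simp add: w_def inner_diff_left nn)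
  have "w = 0"
  proof (rule ccontr)
    assume w: "w \<noteq> 0"
    have "((r / (2 * norm w)) *\<^sub>R w) \<bullet> m = 0"
      by (rule assms(4)) (use wn w assms(3) in auto)
    then have "w \<bullet> m = 0" using w assms(3) by auto
    then have "w \<bullet> w = 0" using wn by (subst (2) w_def) (simp add: inner_diff_right)
    then show False using w by simp
  qed
  then have m: "m = (m \<bullet> n) *\<^sub>R n" by (simp add: w_def)
  then have "\<bar>m \<bullet> n\<bar> = 1" using assms(1,2) by (metis mult.right_neutral norm_scaleR)
  then show ?thesis using m by (metis abs_1 abs_eq_iff scaleR_minus1_left scaleR_one)
qed

lemma inner_diff_plane:
  fixes x z n :: "'a::real_inner"
  shows "(z - x) \<bullet> n = 0 \<longleftrightarrow> n \<bullet> z = n \<bullet> x" "(z - x) \<bullet> n < 0 \<longleftrightarrow> n \<bullet> z < n \<bullet> x"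
  by (simp_all add: inner_diff_left inner_commute[of n])

lemma outward_normal_mem: "outward_normal T x n \<Longrightarrow> x \<in> T"
  unfolding outward_normal_def by (metis (no_types, lifting) Int_iff centre_in_ball diff_self inner_zero_left mem_Collect_eq order_refl)

lemma outward_normal_norm: "outward_normal T x n \<Longrightarrow> norm n = 1"
  by (simp add: outward_normal_def)

lemma outward_normalE:
  assumes "outward_normal T x n"
  obtains \<epsilon> where "\<epsilon> > 0" "\<And>z. dist x z < \<epsilon> \<Longrightarrow> z \<in> T \<longleftrightarrow> (z - x) \<bullet> n \<le> 0"
  using assms unfolding outward_normal_def set_eq_iff by auto

lemma outward_normalI:
  assumes "norm n = 1" "\<epsilon> > 0" "\<And>z. dist x z < \<epsilon> \<Longrightarrow> z \<in> T \<longleftrightarrow> (z - x) \<bullet> n \<le> 0"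
  shows "outward_normal T x n"
  using assms unfolding outward_normal_def set_eq_iff by auto

lemma outward_normal_not_interior:
  assumes "outward_normal T x n"
  shows "x \<notin> interior T"
proof
  assume "x \<in> interior T"
  then obtain d where d: "d > 0" "ball x d \<subseteq> T" by (auto simp: mem_interior)
  obtain e where e: "e > 0" "\<And>z. dist x z < e \<Longrightarrow> z \<in> T \<longleftrightarrow> (z - x) \<bullet> n \<le> 0"
    using outward_normalE[OF assms] by blast
  define z where "z = x + (min d e / 2) *\<^sub>R n"
  have n: "norm n = 1" "n \<bullet> n = 1" using outward_normal_norm[OF assms] by (auto simp: norm_eq_1)
  have "dist x z < d" "dist x z < e" using d e n by (auto simp: z_def dist_norm)
  then have "(z - x) \<bullet> n \<le> 0" using d e by (auto simp: subset_iff)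
  then show False using d e n by (auto simp: z_def)
qed

lemma outward_normal_frontier: "outward_normal T x n \<Longrightarrow> x \<in> frontier T"
  using outward_normal_mem outward_normal_not_interior closure_subset by (fastforce simp: frontier_def)

text \<open>Two half balls that agree near x have the same bounding disc, so their normals are
  parallel; the opposite sign would exchange inside and outside.\<close>

lemma outward_normal_unique:
  assumes "outward_normal T x n" "outward_normal T x m"
  shows "m = n"
proof -
  obtain d where d: "d > 0" "\<And>z. dist x z < d \<Longrightarrow> z \<in> T \<longleftrightarrow> (z - x) \<bullet> n \<le> 0"
    using outward_normalE[OF assms(1)] by blast
  obtain e where e: "e > 0" "\<And>z. dist x z < e \<Longrightarrow> z \<in> T \<longleftrightarrow> (z - x) \<bullet> m \<le> 0"
    using outward_normalE[OF assms(2)] by blast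
  define r where "r = min d e"
  have r: "r > 0" using d e by (simp add: r_def)
  have eq: "v \<bullet> n \<le> 0 \<longleftrightarrow> v \<bullet> m \<le> 0" if "norm v < r" for v
    using d(2)[of "x + v"] e(2)[of "x + v"] that by (auto simp: r_def dist_norm)
  have n: "norm n = 1" "n \<bullet> n = 1" "norm m = 1"
    using assms outward_normal_norm by (auto simp: norm_eq_1)
  have "m = n \<or> m = - n"
  proof (rule parallel_of_orthogonal_disc[OF n(1,3) r])
    fix v assume "v \<bullet> n = 0" "norm v < r"
    then show "v \<bullet> m = 0" using eq[of v] eq[of "- v"] by simp
  qed
  moreover have "m \<noteq> - n"
    using eq[of "- (r/2) *\<^sub>R n"] r n by auto
  ultimately show ?thesis by simp
qed

lemma outward_normal_nearby:
  assumes "norm n = 1" "\<And>z. dist x z < e \<Longrightarrow> z \<in> T \<longleftrightarrow> (z - x) \<bullet> n \<le> 0" "dist x z < e" "(z - x) \<bullet> n = 0"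
  shows "outward_normal T z n"
proof (rule outward_normalI[OF assms(1), of "e - dist x z"])
  fix w assume "dist z w < e - dist x z"
  then have "dist x w < e" using dist_triangle[of x w z] by linarith
  moreover have "(w - x) \<bullet> n = (w - z) \<bullet> n" using assms(4) by (simp add: algebra_simps)
  ultimately show "w \<in> T \<longleftrightarrow> (w - z) \<bullet> n \<le> 0" using assms(2)[of w] by simp
qed (use assms in auto)

text \<open>In a ball where \<open>T\<close> is a half ball, a point of \<open>T\<close> off the
  bounding plane is interior and has no outward normal. So flat points near x lie on the plane and
  share its normal.\<close>

lemma outward_normal_local:
  assumes n: "norm n = 1" and e: "\<And>z. dist x z < e \<Longrightarrow> z \<in> T \<longleftrightarrow> (z - x) \<bullet> n \<le> 0"
    and z: "dist x z < e" "outward_normal T z m"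
  shows "m = n" "(z - x) \<bullet> n = 0"
proof -
  have "z \<in> T" using outward_normal_mem z by blast
  then have le: "(z - x) \<bullet> n \<le> 0" using e z by blast
  show eq: "(z - x) \<bullet> n = 0"
  proof (rule ccontr)
    assume "(z - x) \<bullet> n \<noteq> 0"
    then have "z \<in> ball x e \<inter> {w. (w - x) \<bullet> n < 0}" using le z by auto
    moreover have "open (ball x e \<inter> {w. (w - x) \<bullet> n < 0})"
      by (intro open_Int open_Collect_less continuous_intros) auto
    moreover have "ball x e \<inter> {w. (w - x) \<bullet> n < 0} \<subseteq> T" using e by fastforce
    ultimately have "z \<in> interior T" by (meson interiorI)
    then show False using outward_normal_not_interior z by blast
  qed
  show "m = n" by (rule outward_normal_unique[OF outward_normal_nearby[OF n e z(1) eq] z(2)])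
qed

text \<open>By \<open>outward_normal_local\<close> the function \<open>n \<bullet> x\<close> is
  locally constant on the component, hence constant by connectedness.\<close>

lemma flat_component_hyperplane:
  assumes "C \<in> components {x. outward_normal T x n}"
  obtains c where "C \<subseteq> {x. n \<bullet> x = c}"
proof -
  have C: "connected C" "C \<subseteq> {x. outward_normal T x n}" "C \<noteq> {}"
    using assms in_components_connected in_components_subset in_components_nonempty by blast+
  have "(\<lambda>x. n \<bullet> x) constant_on C"
  proof (rule locally_constant_imp_constant[OF C(1)])
    fix x assume x: "x \<in> C"
    then have ox: "outward_normal T x n" using C by blast
    obtain e where e: "e > 0" "\<And>z. dist x z < e \<Longrightarrow> z \<in> T \<longleftrightarrow> (z - x) \<bullet> n \<le> 0"
      using outward_normalE[OF ox] by blast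
    show "\<exists>t. openin (top_of_set C) t \<and> x \<in> t \<and> (\<forall>z\<in>t. n \<bullet> z = n \<bullet> x)"
    proof (intro exI conjI ballI)
      show "openin (top_of_set C) (C \<inter> ball x e)" by (simp add: openin_open_Int)
      fix z assume "z \<in> C \<inter> ball x e"
      then have "(z - x) \<bullet> n = 0"
        by (intro outward_normal_local(2)[where e = e and m = n, OF outward_normal_norm[OF ox] e(2)]) (use C in auto)
      then show "n \<bullet> z = n \<bullet> x" by (simp add: inner_diff_plane)
    qed (use x e in auto)
  qed
  then show ?thesis using that unfolding constant_on_def by blast
qed

text \<open>A small disc around x in the plane is convex and consists of flat points with normal n,
  so maximality of the component swallows it.\<close>

lemma flat_component_disc:
  assumes C: "C \<in> components {x. outward_normal T x n}" and x: "x \<in> C"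
  obtains e where "e > 0" "\<And>z. dist x z < e \<Longrightarrow> (z - x) \<bullet> n = 0 \<Longrightarrow> z \<in> C"
proof -
  have ox: "outward_normal T x n" using C x in_components_subset by blast
  obtain e where e: "e > 0" "\<And>z. dist x z < e \<Longrightarrow> z \<in> T \<longleftrightarrow> (z - x) \<bullet> n \<le> 0"
    using outward_normalE[OF ox] by blast
  let ?B = "ball x e \<inter> {z. n \<bullet> z = n \<bullet> x}"
  have "?B \<subseteq> C"
  proof (rule components_maximal[OF C])
    show "connected ?B" by (intro convex_connected convex_Int convex_ball convex_hyperplane)
    show "?B \<subseteq> {x. outward_normal T x n}"
    proof
      fix z assume "z \<in> ?B"
      then have "dist x z < e" "(z - x) \<bullet> n = 0" by (auto simp: inner_diff_plane)
      then show "z \<in> {x. outward_normal T x n}"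
        using outward_normal_nearby[where e = e, OF outward_normal_norm[OF ox] e(2)] by blast
    qed
    show "C \<inter> ?B \<noteq> {}" using x e by auto
  qed
  then show ?thesis using that[OF e(1)] by (auto simp: inner_diff_plane subset_iff)
qed

text \<open>Justifies the definite description in \<open>face_normal\<close>. If another component
  had the same closure, it would have points arbitrarily near a point of \<open>C\<close>, and there
  the normal can only be n.\<close>

lemma face_normal_closure:
  assumes C: "C \<in> components {x. outward_normal T x n}"
  shows "face_normal T (closure C) = n"
  unfolding face_normal_def
proof (rule the_equality)
  fix m assume "closure C \<in> closure ` components {x. outward_normal T x m}"
  then obtain C' where C': "C' \<in> components {x. outward_normal T x m}" "closure C = closure C'" by blast
  obtain x where x: "x \<in> C" using in_components_nonempty[OF C] by blast
  then have ox: "outward_normal T x n" using C in_components_subset by blast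
  obtain e where e: "e > 0" "\<And>z. dist x z < e \<Longrightarrow> z \<in> T \<longleftrightarrow> (z - x) \<bullet> n \<le> 0"
    using outward_normalE[OF ox] by blast
  have "x \<in> closure C'" using x C'(2) closure_subset by blast
  then obtain z where z: "z \<in> C'" "dist z x < e" using e by (meson closure_approachable)
  then have "outward_normal T z m" using C' in_components_subset by blast
  then show "m = n"
    by (intro outward_normal_local(1)[where e = e and z = z, OF outward_normal_norm[OF ox] e(2)])
       (use z in \<open>auto simp: dist_commute\<close>)
qed (use C in auto)

lemma faceE:
  assumes "F \<in> faces T"
  obtains C where "F = closure C" "C \<in> components {x. outward_normal T x (face_normal T F)}"
  using assms face_normal_closure unfolding faces_def by blast

lemma norm_face_normal:
  assumes "F \<in> faces T"
  shows "norm (face_normal T F) = 1"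
proof -
  obtain C where C: "C \<in> components {x. outward_normal T x (face_normal T F)}" using faceE[OF assms] by blast
  then show ?thesis using in_components_nonempty[OF C] in_components_subset[OF C] outward_normal_norm by blast
qed

lemma face_hyperplane:
  assumes "F \<in> faces T"
  obtains c where "F \<subseteq> {x. face_normal T F \<bullet> x = c}"
proof -
  obtain C where C: "F = closure C" "C \<in> components {x. outward_normal T x (face_normal T F)}" using faceE[OF assms] by blast
  obtain c where "C \<subseteq> {x. face_normal T F \<bullet> x = c}" using flat_component_hyperplane[OF C(2)] by blast
  then have "F \<subseteq> {x. face_normal T F \<bullet> x = c}"
    unfolding C(1) by (rule closure_minimal) (rule closed_hyperplane)
  then show ?thesis by (rule that)
qed

lemma face_subset_frontier:
  assumes "F \<in> faces T"
  shows "F \<subseteq> frontier T"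
proof -
  obtain C where C: "F = closure C" "C \<in> components {x. outward_normal T x (face_normal T F)}" using faceE[OF assms] by blast
  have "C \<subseteq> frontier T" using in_components_subset[OF C(2)] outward_normal_frontier by blast
  then show ?thesis unfolding C(1) by (rule closure_minimal) (rule frontier_closed)
qed

lemma face_disc:
  assumes "F \<in> faces T"
  obtains x r where "r > 0" "x \<in> F" "\<And>z. dist x z < r \<Longrightarrow> (z - x) \<bullet> face_normal T F = 0 \<Longrightarrow> z \<in> F"
proof -
  obtain C where C: "F = closure C" "C \<in> components {x. outward_normal T x (face_normal T F)}" using faceE[OF assms] by blast
  obtain x where x: "x \<in> C" using in_components_nonempty[OF C(2)] by blast
  obtain r where "r > 0" "\<And>z. dist x z < r \<Longrightarrow> (z - x) \<bullet> face_normal T F = 0 \<Longrightarrow> z \<in> C"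
    using flat_component_disc[OF C(2) x] by blast
  then show ?thesis using that x closure_subset unfolding C(1) by blast
qed

lemma compact_face:
  assumes "compact T" "F \<in> faces T"
  shows "compact F" "F \<subseteq> T"
proof -
  have c: "closed F" using faceE[OF assms(2)] by (metis closed_closure)
  show "F \<subseteq> T" using face_subset_frontier[OF assms(2)] frontier_subset_compact[OF assms(1)] by blast
  then show "compact F" using c assms(1) by (metis compact_Int_closed inf.absorb_iff2)
qed

section \<open>The surface measure of a face is finite and positive\<close>

lemma emeasure_hyperplane_measure:
  fixes n :: "'a::euclidean_space"
  assumes "A \<in> sets borel"
  shows "emeasure (hyperplane_measure n c) A =
    emeasure lborel {x. c \<le> n \<bullet> x \<and> n \<bullet> x \<le> c + 1 \<and> x - (n \<bullet> x - c) *\<^sub>R n \<in> A}"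
proof -
  let ?S = "{x. c \<le> n \<bullet> x \<and> n \<bullet> x \<le> c + 1}"
  let ?g = "\<lambda>x. x - (n \<bullet> x - c) *\<^sub>R n"
  have S: "?S \<in> sets lborel" by simp
  have g: "?g \<in> borel_measurable (restrict_space lborel ?S)"
    by (rule measurable_restrict_space1) (simp add: borel_measurable_continuous_onI continuous_intros)
  have "emeasure (hyperplane_measure n c) A = emeasure (restrict_space lborel ?S) (?g -` A \<inter> space (restrict_space lborel ?S))"
    unfolding hyperplane_measure_def by (rule emeasure_distr[OF g assms])
  also have "\<dots> = emeasure lborel (?g -` A \<inter> space (restrict_space lborel ?S))"
    by (rule emeasure_restrict_space) (use S in \<open>auto simp: space_restrict_space\<close>)
  also have "?g -` A \<inter> space (restrict_space lborel ?S) = {x. c \<le> n \<bullet> x \<and> n \<bullet> x \<le> c + 1 \<and> x - (n \<bullet> x - c) *\<^sub>R n \<in> A}"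
    by (auto simp: space_restrict_space)
  finally show ?thesis .
qed

text \<open>The features of a face that its measure depends on: compactness gives finiteness, and
  the disc inside the plane gives positivity.\<close>

locale flat_set =
  fixes F :: "'a::euclidean_space set" and n\<^sub>0 :: 'a and c\<^sub>0 :: real and x\<^sub>0 :: 'a and r\<^sub>0 :: real
  assumes compact: "compact F" and n\<^sub>0: "norm n\<^sub>0 = 1" and plane: "F \<subseteq> {x. n\<^sub>0 \<bullet> x = c\<^sub>0}"
    and disc: "x\<^sub>0 \<in> F" "r\<^sub>0 > 0" "\<And>z. dist x\<^sub>0 z < r\<^sub>0 \<Longrightarrow> (z - x\<^sub>0) \<bullet> n\<^sub>0 = 0 \<Longrightarrow> z \<in> F"
begin

lemma borel: "F \<in> sets borel"
  using compact by (simp add: borel_compact)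

text \<open>The normal picked inside \<open>face_measure\<close> need not be
  \<open>n\<^sub>0\<close>; only its defining property is available.\<close>

lemma face_measureE:
  obtains n c where "norm n = 1" "F \<subseteq> {x. n \<bullet> x = c}" "face_measure F = restrict_space (hyperplane_measure n c) F"
proof -
  define p where "p = (SOME (n, c). norm n = 1 \<and> F \<subseteq> {x. n \<bullet> x = c})"
  have "case p of (n, c) \<Rightarrow> norm n = 1 \<and> F \<subseteq> {x. n \<bullet> x = c}"
    unfolding p_def by (rule someI[of _ "(n\<^sub>0, c\<^sub>0)"]) (use n\<^sub>0 plane in auto)
  then show ?thesis
    using that[of "fst p" "snd p"] unfolding face_measure_def p_def[symmetric] by (auto simp: case_prod_beta)
qed

lemma sets_face_measure: "sets (face_measure F) = sets (restrict_space borel F)"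
proof -
  obtain n c where *: "face_measure F = restrict_space (hyperplane_measure n c) F" using face_measureE by blast
  show ?thesis unfolding * by (rule sets_restrict_space_cong) (simp add: hyperplane_measure_def)
qed

lemma space_face_measure: "space (face_measure F) = F"
  using sets_eq_imp_space_eq[OF sets_face_measure] by (simp add: space_restrict_space)

lemma emeasure_face:
  shows "emeasure (face_measure F) F \<noteq> \<infinity>" "emeasure (face_measure F) F \<noteq> 0"
proof -
  obtain n c where n: "norm n = 1" and F: "F \<subseteq> {x. n \<bullet> x = c}"
    and fm: "face_measure F = restrict_space (hyperplane_measure n c) F" by (rule face_measureE)
  have nn: "n \<bullet> n = 1" using n by (simp add: norm_eq_1)
  let ?g = "\<lambda>x. x - (n \<bullet> x - c) *\<^sub>R n"
  let ?A = "{x. c \<le> n \<bullet> x \<and> n \<bullet> x \<le> c + 1 \<and> ?g x \<in> F}"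
  have Ab: "?A \<in> sets borel"
  proof -
    have "closed (?g -` F)"
      by (rule continuous_closed_vimage) (auto intro!: continuous_intros compact compact_imp_closed)
    moreover have "closed {x. c \<le> n \<bullet> x}" "closed {x. n \<bullet> x \<le> c + 1}"
      using closed_halfspace_ge[of c n] closed_halfspace_le[of n "c + 1"] by auto
    ultimately have "closed ({x. c \<le> n \<bullet> x} \<inter> {x. n \<bullet> x \<le> c + 1} \<inter> ?g -` F)" by blast
    also have "({x. c \<le> n \<bullet> x} \<inter> {x. n \<bullet> x \<le> c + 1} \<inter> ?g -` F) = ?A" by auto
    finally show ?thesis by simp
  qed
  have e: "emeasure (face_measure F) F = emeasure lborel ?A"
    unfolding fm
    by (subst emeasure_restrict_space) (use borel in \<open>auto simp: hyperplane_measure_def emeasure_hyperplane_measure[unfolded hyperplane_measure_def]\<close>)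
  have "bounded ?A"
  proof -
    obtain B where B: "\<And>x. x \<in> F \<Longrightarrow> norm x \<le> B" using compact_imp_bounded[OF compact] by (auto simp: bounded_iff)
    have "norm x \<le> B + 1" if "x \<in> ?A" for x
    proof -
      have "norm x \<le> norm (?g x) + norm ((n \<bullet> x - c) *\<^sub>R n)" by (metis diff_add_cancel norm_triangle_ineq)
      also have "\<dots> \<le> B + 1" using that B by (intro add_mono) (auto simp: n)
      finally show ?thesis .
    qed
    then show ?thesis by (auto simp: bounded_iff)
  qed
  then show "emeasure (face_measure F) F \<noteq> \<infinity>" unfolding e using emeasure_bounded_finite by fastforce
  \<comment> \<open>The open cylinder over the disc around \<open>x\<^sub>0\<close>. It is a
    nonempty open subset of the cylinder that computes the measure, so that cylinder is not a null
    set.\<close>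
  let ?O = "{x. c < n \<bullet> x} \<inter> {x. n \<bullet> x < c + 1} \<inter> ?g -` ball x\<^sub>0 r\<^sub>0"
  have nx: "n \<bullet> x\<^sub>0 = c" using F disc by blast
  \<comment> \<open>Both normals are orthogonal to the disc contained in \<open>F\<close>, so they
    differ at most by sign and the disc is also flat with respect to the chosen one.\<close>
  have par: "n = n\<^sub>0 \<or> n = - n\<^sub>0"
  proof (rule parallel_of_orthogonal_disc[OF n\<^sub>0 n disc(2)])
    fix v assume "v \<bullet> n\<^sub>0 = 0" "norm v < r\<^sub>0"
    then have "x\<^sub>0 + v \<in> F" by (intro disc(3)) (auto simp: dist_norm)
    then have "n \<bullet> (x\<^sub>0 + v) = c" using F by blast
    then show "v \<bullet> n = 0" using nx by (simp add: inner_add_right inner_commute)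
  qed
  have "?O \<subseteq> ?A"
  proof
    fix x assume x: "x \<in> ?O"
    have "n \<bullet> ?g x = c" by (simp add: inner_diff_right nn)
    then have "(?g x - x\<^sub>0) \<bullet> n = 0" unfolding inner_diff_plane nx .
    then have "(?g x - x\<^sub>0) \<bullet> n\<^sub>0 = 0" using par by auto
    then have "?g x \<in> F" using x by (intro disc(3)) auto
    then show "x \<in> ?A" using x by auto
  qed
  moreover have "open ?O"
    using open_halfspace_gt[of c n] open_halfspace_lt[of n "c + 1"]
    by (intro open_Int continuous_open_vimage) (auto intro!: continuous_intros)
  moreover have "x\<^sub>0 + (1/2) *\<^sub>R n \<in> ?O"
    using disc(2) by (simp add: nx nn inner_add_right)
  ultimately have "\<not> negligible ?A"
    using open_not_negligible[of ?O] negligible_subset by blast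
  then show "emeasure (face_measure F) F \<noteq> 0"
    unfolding e using Ab by (simp add: negligible_iff_null_sets null_sets_completion_iff null_sets_def)
qed

lemma finite_measure_face: "finite_measure (face_measure F)"
  using emeasure_face(1) by (intro finite_measureI) (simp add: space_face_measure)

lemma measure_face_pos: "measure (face_measure F) F > 0"
  using emeasure_face finite_measure.emeasure_eq_measure[OF finite_measure_face, of F] by (simp add: zero_less_measure_iff)

lemma face_integrable:
  fixes g :: "'a \<Rightarrow> real"
  assumes "continuous_on F g"
  shows "integrable (face_measure F) g"
proof -
  obtain B where B: "\<And>x. x \<in> F \<Longrightarrow> norm (g x) \<le> B"
    using compact_imp_bounded[OF compact_continuous_image[OF assms compact]] by (auto simp: bounded_iff)
  have "g \<in> borel_measurable (face_measure F)"
    using borel_measurable_continuous_on_restrict[OF assms] by (simp add: measurable_cong_sets[OF sets_face_measure refl])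
  then show ?thesis
    by (rule finite_measure.integrable_const_bound[OF finite_measure_face, rotated])
       (use B in \<open>auto simp: space_face_measure intro!: AE_I2\<close>)
qed

end

lemma flat_set_face:
  assumes "compact T" "F \<in> faces T"
  obtains c x r where "flat_set F (face_normal T F) c x r"
proof -
  obtain c where "F \<subseteq> {x. face_normal T F \<bullet> x = c}" using face_hyperplane[OF assms(2)] by blast
  moreover obtain x r where "r > 0" "x \<in> F" "\<And>z. dist x z < r \<Longrightarrow> (z - x) \<bullet> face_normal T F = 0 \<Longrightarrow> z \<in> F"
    using face_disc[OF assms(2)] by blast
  ultimately have "flat_set F (face_normal T F) c x r"
    using compact_face[OF assms] norm_face_normal[OF assms(2)] by unfold_locales auto
  then show ?thesis by (rule that)
qed

section \<open>Frontiers of elements: null sets, and flat at generic points\<close>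

lemma negligible_frontier_element:
  assumes "polyhedral_element T"
  shows "negligible (frontier T)"
proof -
  have "negligible F" if "F \<in> faces T" for F
  proof -
    obtain c where "F \<subseteq> {x. face_normal T F \<bullet> x = c}" using face_hyperplane[OF \<open>F \<in> faces T\<close>] by blast
    moreover have "face_normal T F \<noteq> 0" using norm_face_normal[OF that] by auto
    ultimately show ?thesis using negligible_hyperplane negligible_subset by blast
  qed
  then show ?thesis using assms unfolding polyhedral_element_def by (metis negligible_Union)
qed

lemma half_ball_closure:
  fixes T :: "'a::euclidean_space set"
  assumes "closed T" "norm n = 1" "\<And>z. dist x z < e \<Longrightarrow> (z - x) \<bullet> n < 0 \<Longrightarrow> z \<in> T"
    and z: "dist x z < e" "(z - x) \<bullet> n \<le> 0"
  shows "z \<in> T"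
proof -
  have "z \<in> closure T"
    unfolding closure_approachable
  proof (intro allI impI)
    fix d :: real assume d: "d > 0"
    define t where "t = min d (e - dist x z) / 2"
    have t: "t > 0" "t < d" "t < e - dist x z" using d z(1) by (auto simp: t_def)
    let ?w = "z - t *\<^sub>R n"
    have zw: "dist z ?w = t" using t assms(2) by (simp add: dist_norm)
    then have "dist x ?w < e" using dist_triangle[of x ?w z] t by linarith
    moreover have "(?w - x) \<bullet> n < 0"
    proof -
      have "n \<bullet> n = 1" using assms(2) by (simp add: norm_eq_1)
      then have "(?w - x) \<bullet> n = (z - x) \<bullet> n - t" by (simp add: inner_diff_left)
      then show ?thesis using z(2) t(1) by linarith
    qed
    ultimately have "?w \<in> T" by (rule assms(3))
    then show "\<exists>y\<in>T. dist y z < d" using zw t(2) by (metis dist_commute)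
  qed
  then show ?thesis using assms(1) by simp
qed

text \<open>Near x the frontier lies in one hyperplane, so each of the two open half balls is
  connected, misses the frontier, and is entirely inside or entirely outside \<open>T\<close>. Both
  inside would make x interior; both outside would make \<open>T\<close> flat near x. Exactly one
  inside is the claim.\<close>

lemma outward_normal_at_generic:
  fixes T :: "'a::euclidean_space set"
  assumes T: "polyhedral_element T" and x: "x \<in> frontier T" and n: "norm n = 1"
    and plane: "\<And>F. F \<in> faces T \<Longrightarrow> x \<in> F \<Longrightarrow> F \<subseteq> {z. n \<bullet> z = c}"
  shows "outward_normal T x n \<or> outward_normal T x (- n)"
proof -
  have T': "compact T" "closed T" "closure (interior T) = T" "finite (faces T)" "frontier T = \<Union>(faces T)"
    using T compact_imp_closed unfolding polyhedral_element_def by metis+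
  \<comment> \<open>The union of the faces that avoid x is closed, so a ball around x meets only
    faces through x.\<close>
  let ?K = "\<Union>{F \<in> faces T. x \<notin> F}"
  have "closed ?K"
  proof (rule closed_Union)
    show "finite {F \<in> faces T. x \<notin> F}" using T'(4) by simp
    show "\<forall>F\<in>{F \<in> faces T. x \<notin> F}. closed F" using compact_face(1)[OF T'(1)] compact_imp_closed by blast
  qed
  then have "\<exists>e>0. ball x e \<subseteq> - ?K"
    using open_contains_ball[of "- ?K"] open_Compl[of ?K] by blast
  then obtain e where e: "e > 0" "ball x e \<inter> ?K = {}" by blast
  have xc: "n \<bullet> x = c" using x plane unfolding T'(5) by blast
  have fr: "(z - x) \<bullet> n = 0" if "z \<in> frontier T" "dist x z < e" for z
  proof -
    obtain F where F: "F \<in> faces T" "z \<in> F" using \<open>z \<in> frontier T\<close> T'(5) by blast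
    then have "x \<in> F" using e that(2) by fastforce
    then have "n \<bullet> z = c" using plane F by blast
    then show ?thesis using xc by (simp add: inner_diff_plane)
  qed
  have cases: "(\<forall>z. dist x z < e \<and> (z - x) \<bullet> m < 0 \<longrightarrow> z \<in> T) \<or> (\<forall>z. dist x z < e \<and> (z - x) \<bullet> m < 0 \<longrightarrow> z \<notin> T)"
    if m: "m = n \<or> m = - n" for m
  proof -
    let ?B = "ball x e \<inter> {z. m \<bullet> z < m \<bullet> x}"
    have "connected ?B" by (intro convex_connected convex_Int convex_ball convex_halfspace_lt)
    moreover have "?B \<inter> frontier T = {}" using fr m by (fastforce simp: inner_diff_plane)
    ultimately have "?B \<inter> T = {} \<or> ?B - T = {}" using connected_Int_frontier by blast
    moreover have "(z - x) \<bullet> m < 0 \<longleftrightarrow> m \<bullet> z < m \<bullet> x" for z by (simp add: inner_diff_plane)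
    ultimately show ?thesis by auto
  qed
  have one: "outward_normal T x m"
    if m: "m = n \<or> m = - n" and i: "\<And>z. dist x z < e \<Longrightarrow> (z - x) \<bullet> m < 0 \<Longrightarrow> z \<in> T"
      and o: "\<And>z. dist x z < e \<Longrightarrow> (z - x) \<bullet> m > 0 \<Longrightarrow> z \<notin> T" for m
  proof (rule outward_normalI[OF _ e(1)])
    show nm: "norm m = 1" using m n by auto
    fix z assume "dist x z < e"
    then show "z \<in> T \<longleftrightarrow> (z - x) \<bullet> m \<le> 0"
      using o half_ball_closure[OF T'(2) nm i, where e = e] by (metis not_le)
  qed
  consider "\<forall>z. dist x z < e \<and> (z - x) \<bullet> n < 0 \<longrightarrow> z \<in> T" "\<forall>z. dist x z < e \<and> (z - x) \<bullet> (- n) < 0 \<longrightarrow> z \<in> T"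
    | "\<forall>z. dist x z < e \<and> (z - x) \<bullet> n < 0 \<longrightarrow> z \<in> T" "\<forall>z. dist x z < e \<and> (z - x) \<bullet> (- n) < 0 \<longrightarrow> z \<notin> T"
    | "\<forall>z. dist x z < e \<and> (z - x) \<bullet> n < 0 \<longrightarrow> z \<notin> T" "\<forall>z. dist x z < e \<and> (z - x) \<bullet> (- n) < 0 \<longrightarrow> z \<in> T"
    | "\<forall>z. dist x z < e \<and> (z - x) \<bullet> n < 0 \<longrightarrow> z \<notin> T" "\<forall>z. dist x z < e \<and> (z - x) \<bullet> (- n) < 0 \<longrightarrow> z \<notin> T"
    using cases[of n] cases[of "- n"] by blast
  then show ?thesis
  proof cases
    case 1
    have "z \<in> T" if z: "dist x z < e" for z
    proof (cases "(z - x) \<bullet> n \<le> 0")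
      case True
      then show ?thesis using half_ball_closure[OF T'(2) n, of x e z] 1(1) z by blast
    qed (use 1(2) z in auto)
    then have "ball x e \<subseteq> T" by auto
    then have "x \<in> interior T" using e by (meson centre_in_ball interiorI open_ball)
    then show ?thesis using x by (simp add: frontier_def)
  next
    case 2
    then show ?thesis using one[of n] by auto
  next
    case 3
    then show ?thesis using one[of "- n"] by auto
  next
    case 4
    \<comment> \<open>Here \<open>T\<close> lies in the hyperplane near x. Since \<open>T\<close> is
      the closure of its interior, a nonempty open set would be contained in a hyperplane.\<close>
    have "x \<in> closure (interior T)" using x T' frontier_subset_closed by blast
    then obtain z where z: "z \<in> interior T" "dist z x < e" using e by (meson closure_approachable)
    let ?W = "interior T \<inter> ball x e"
    have "?W \<subseteq> {w. n \<bullet> w = c}"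
    proof
      fix w assume w: "w \<in> ?W"
      then have "w \<in> T" using interior_subset by blast
      then have "(w - x) \<bullet> n = 0" using 4 w by (metis IntD2 inner_minus_right linorder_neqE_linordered_idom mem_ball neg_less_0_iff_less)
      then show "w \<in> {w. n \<bullet> w = c}" using xc by (simp add: inner_diff_plane)
    qed
    moreover have "n \<noteq> 0" using n by auto
    ultimately have "negligible ?W" using negligible_hyperplane negligible_subset by blast
    moreover have "open ?W" "?W \<noteq> {}" using z by (auto simp: dist_commute)
    ultimately show ?thesis using open_not_negligible by blast
  qed
qed

section \<open>Piecewise polynomials and their traces\<close>

definition multi_degrees :: "nat \<Rightarrow> ('a::euclidean_space \<Rightarrow> nat) set" where
  "multi_degrees k = {\<alpha>. (\<forall>b. b \<notin> Basis \<longrightarrow> \<alpha> b = 0) \<and> (\<Sum>b\<in>Basis. \<alpha> b) \<le> k}"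

definition monomial_fun :: "('a::euclidean_space \<Rightarrow> nat) \<Rightarrow> 'a \<Rightarrow> real" where
  "monomial_fun \<alpha> x = (\<Prod>b\<in>Basis. (x \<bullet> b) ^ \<alpha> b)"

lemma polynomials_eq: "polynomials k = {p. \<exists>c. p = (\<lambda>x. \<Sum>\<alpha>\<in>multi_degrees k. c \<alpha> * monomial_fun \<alpha> x)}"
  unfolding polynomials_def multi_degrees_def monomial_fun_def ..

lemma finite_multi_degrees [simp]: "finite (multi_degrees k :: ('a::euclidean_space \<Rightarrow> nat) set)"
proof (rule finite_subset)
  show "finite {\<alpha> :: 'a \<Rightarrow> nat. \<forall>x. (x \<in> Basis \<longrightarrow> \<alpha> x \<in> {..k}) \<and> (x \<notin> Basis \<longrightarrow> \<alpha> x = 0)}"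
    by (rule finite_set_of_finite_funs) auto
  have "\<alpha> b \<le> k" if "b \<in> Basis" "(\<Sum>b\<in>Basis. \<alpha> b) \<le> k" for \<alpha> :: "'a \<Rightarrow> nat" and b
    using member_le_sum[of b Basis \<alpha>] that by simp
  then show "multi_degrees k \<subseteq> {\<alpha> :: 'a \<Rightarrow> nat. \<forall>x. (x \<in> Basis \<longrightarrow> \<alpha> x \<in> {..k}) \<and> (x \<notin> Basis \<longrightarrow> \<alpha> x = 0)}"
    by (auto simp: multi_degrees_def)
qed

lemma monomial_in_polynomials: "\<alpha> \<in> multi_degrees k \<Longrightarrow> (\<lambda>x. c * monomial_fun \<alpha> x) \<in> polynomials k"
  unfolding polynomials_eq
  by (auto intro!: exI[of _ "\<lambda>\<beta>. if \<beta> = \<alpha> then c else 0"] simp: if_distrib[of "\<lambda>z. z * _"] sum.delta cong: if_cong)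

lemma polynomials_zero: "(\<lambda>x. 0) \<in> polynomials k"
  unfolding polynomials_eq by (auto intro!: exI[of _ "\<lambda>_. 0"])

lemma polynomials_add_scaled:
  assumes "p \<in> polynomials k" "q \<in> polynomials k"
  shows "(\<lambda>x. p x + c * q x) \<in> polynomials k"
proof -
  obtain d e where "p = (\<lambda>x. \<Sum>\<alpha>\<in>multi_degrees k. d \<alpha> * monomial_fun \<alpha> x)"
    "q = (\<lambda>x. \<Sum>\<alpha>\<in>multi_degrees k. e \<alpha> * monomial_fun \<alpha> x)"
    using assms unfolding polynomials_eq by blast
  then have "(\<lambda>x. p x + c * q x) = (\<lambda>x. \<Sum>\<alpha>\<in>multi_degrees k. (d \<alpha> + c * e \<alpha>) * monomial_fun \<alpha> x)"
    by (simp add: sum.distrib sum_distrib_left algebra_simps)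
  then show ?thesis unfolding polynomials_eq by (intro CollectI exI)
qed

lemma polynomials_sum:
  assumes "finite Q" "\<And>q. q \<in> Q \<Longrightarrow> p q \<in> polynomials k"
  shows "(\<lambda>x. \<Sum>q\<in>Q. c q * p q x) \<in> polynomials k"
  using assms
proof (induction Q rule: finite_induct)
  case (insert r Q)
  then have "(\<lambda>x. (\<Sum>q\<in>Q. c q * p q x) + c r * p r x) \<in> polynomials k"
    by (intro polynomials_add_scaled) auto
  then show ?case using insert.hyps by (simp add: add.commute)
qed (simp add: polynomials_zero)

text \<open>When \<open>\<alpha> b = 0\<close> the truncated exponent \<open>\<alpha> b - 1\<close>
  is harmless, because the factor \<open>real (\<alpha> b)\<close> removes the term.\<close>

lemma monomial_has_derivative:
  fixes x :: "'a::euclidean_space"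
  shows "(monomial_fun \<alpha> has_derivative
    (\<lambda>h. (\<Sum>b\<in>Basis. (real (\<alpha> b) * monomial_fun (\<alpha>(b := \<alpha> b - 1)) x) *\<^sub>R b) \<bullet> h)) (at x)"
proof -
  have "((\<lambda>x. \<Prod>b\<in>Basis. (x \<bullet> b) ^ \<alpha> b) has_derivative
    (\<lambda>h. \<Sum>b\<in>Basis. (of_nat (\<alpha> b) * (h \<bullet> b) * (x \<bullet> b) ^ (\<alpha> b - 1)) * (\<Prod>b'\<in>Basis - {b}. (x \<bullet> b') ^ \<alpha> b'))) (at x)"
    by (rule has_derivative_prod has_derivative_power)+ (auto intro!: derivative_eq_intros)
  moreover have "(\<Sum>b\<in>Basis. (of_nat (\<alpha> b) * (h \<bullet> b) * (x \<bullet> b) ^ (\<alpha> b - 1)) * (\<Prod>b'\<in>Basis - {b}. (x \<bullet> b') ^ \<alpha> b'))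
    = (\<Sum>b\<in>Basis. (real (\<alpha> b) * monomial_fun (\<alpha>(b := \<alpha> b - 1)) x) *\<^sub>R b) \<bullet> h" for h
    unfolding inner_sum_left
  proof (rule sum.cong[OF refl])
    fix b :: 'a assume b: "b \<in> Basis"
    have "monomial_fun (\<alpha>(b := \<alpha> b - 1)) x = (x \<bullet> b) ^ (\<alpha> b - 1) * (\<Prod>b'\<in>Basis - {b}. (x \<bullet> b') ^ \<alpha> b')"
      unfolding monomial_fun_def prod.remove[OF finite_Basis b] by simp
    then show "(of_nat (\<alpha> b) * (h \<bullet> b) * (x \<bullet> b) ^ (\<alpha> b - 1)) * (\<Prod>b'\<in>Basis - {b}. (x \<bullet> b') ^ \<alpha> b')
       = ((real (\<alpha> b) * monomial_fun (\<alpha>(b := \<alpha> b - 1)) x) *\<^sub>R b) \<bullet> h"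
      by (simp add: inner_commute)
  qed
  moreover have "monomial_fun \<alpha> = (\<lambda>x. \<Prod>b\<in>Basis. (x \<bullet> b) ^ \<alpha> b)" by (auto simp: monomial_fun_def)
  ultimately show ?thesis by (simp only:)
qed

text \<open>The components are kept in degree k, so that partial derivatives of discrete functions
  are discrete functions again and the scalar trace inequality applies to them.\<close>

lemma polynomial_gradient:
  fixes p :: "'a::euclidean_space \<Rightarrow> real"
  assumes "p \<in> polynomials k"
  obtains G where "\<And>b. b \<in> Basis \<Longrightarrow> (\<lambda>x. G x \<bullet> b) \<in> polynomials k"
    "\<And>x. (p has_derivative (\<lambda>h. G x \<bullet> h)) (at x)"
proof -
  obtain c where p: "p = (\<lambda>x. \<Sum>\<alpha>\<in>multi_degrees k. c \<alpha> * monomial_fun \<alpha> x)"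
    using assms unfolding polynomials_eq by blast
  define G where "G x = (\<Sum>\<alpha>\<in>multi_degrees k. c \<alpha> *\<^sub>R
      (\<Sum>b\<in>Basis. (real (\<alpha> b) * monomial_fun (\<alpha>(b := \<alpha> b - 1)) x) *\<^sub>R b))" for x
  have "(\<lambda>x. G x \<bullet> b) \<in> polynomials k" if b: "b \<in> Basis" for b
  proof -
    have eq: "(\<lambda>x. G x \<bullet> b) = (\<lambda>x. \<Sum>\<alpha>\<in>multi_degrees k. c \<alpha> * (real (\<alpha> b) * monomial_fun (\<alpha>(b := \<alpha> b - 1)) x))"
      using b by (simp add: G_def inner_sum_left inner_Basis if_distrib cong: if_cong)
    have "(\<lambda>x. real (\<alpha> b) * monomial_fun (\<alpha>(b := \<alpha> b - 1)) x) \<in> polynomials k"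
      if \<alpha>: "\<alpha> \<in> multi_degrees k" for \<alpha>
    proof (rule monomial_in_polynomials)
      have "sum (\<alpha>(b := \<alpha> b - 1)) Basis \<le> sum \<alpha> Basis" by (rule sum_mono) auto
      then show "\<alpha>(b := \<alpha> b - 1) \<in> multi_degrees k" using \<alpha> b by (auto simp: multi_degrees_def)
    qed
    then show ?thesis unfolding eq by (rule polynomials_sum[OF finite_multi_degrees])
  qed
  moreover have "(p has_derivative (\<lambda>h. G x \<bullet> h)) (at x)" for x
    unfolding p G_def inner_sum_left inner_scaleR_left[of "c _"]
    by (rule has_derivative_sum, rule has_derivative_mult_right, unfold inner_sum_left[symmetric], rule monomial_has_derivative)
  ultimately show ?thesis by (rule that)
qed

lemma polynomial_continuous:
  assumes "p \<in> polynomials k"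
  shows "continuous_on S p"
proof -
  obtain G where "\<And>x. (p has_derivative (\<lambda>h. G x \<bullet> h)) (at x)" using polynomial_gradient[OF assms] by blast
  then show ?thesis
    by (meson continuous_at_imp_continuous_on has_derivative_continuous)
qed

lemma grad_eqI:
  assumes "(v has_derivative (\<lambda>h. g \<bullet> h)) (at x)"
  shows "grad v x = g"
  unfolding grad_def frechet_derivative_at[OF assms, symmetric] by (rule euclidean_representation)

text \<open>\<open>Lim\<close> is a choice; it is determined since every point of \<open>T\<close>
  is a limit of interior points. Traces are thereby values of the continuous extension
  \<open>P\<close>.\<close>

lemma interior_trace_eq:
  fixes T :: "'a::euclidean_space set"
  assumes T: "closure (interior T) = T" and x: "x \<in> T"
    and P: "continuous_on T P" and g: "\<And>z. z \<in> interior T \<Longrightarrow> g z = P z"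
  shows "interior_trace T g x = P x"
  unfolding interior_trace_def
proof (rule tendsto_Lim)
  have "x \<in> closure (interior T)" using T x by simp
  then have "x islimpt interior T"
    by (metis closure_def UnE islimpt_UNIV interior_limit_point interior_interior mem_Collect_eq)
  then show "\<not> trivial_limit (at x within interior T)" by (simp add: trivial_limit_within)
  have "(P \<longlongrightarrow> P x) (at x within T)" using P x by (auto simp: continuous_on_def)
  then have "(P \<longlongrightarrow> P x) (at x within interior T)" by (rule tendsto_within_subset) (rule interior_subset)
  then show "(g \<longlongrightarrow> P x) (at x within interior T)"
    by (rule Lim_transform_eventually) (use g in \<open>auto simp: eventually_at intro!: exI[of _ 1]\<close>)
qed

text \<open>Discrete functions are arbitrary on the mesh skeleton; this allows them to be replaced
  by better representatives under the integral.\<close>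

lemma integrable_lebesgue_on_spike:
  fixes f g :: "'a::euclidean_space \<Rightarrow> real"
  assumes S: "S \<in> sets lebesgue" and N: "negligible N" and f: "integrable (lebesgue_on S) f"
    and eq: "\<And>x. x \<in> S - N \<Longrightarrow> g x = f x"
  shows "integrable (lebesgue_on S) g" "integral\<^sup>L (lebesgue_on S) g = integral\<^sup>L (lebesgue_on S) f"
proof -
  have iff: "integrable (lebesgue_on S) h \<longleftrightarrow> h absolutely_integrable_on S" for h :: "'a \<Rightarrow> real"
    using S by (simp add: integrable_restrict_space set_integrable_def)
  have "g absolutely_integrable_on S"
    by (rule absolutely_integrable_spike[OF _ N eq]) (use f iff in auto)
  then show g: "integrable (lebesgue_on S) g" using iff by blast
  have "integral S f = integral S g" by (rule integral_spike[OF N eq]) auto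
  then show "integral\<^sup>L (lebesgue_on S) g = integral\<^sup>L (lebesgue_on S) f"
    using lebesgue_integral_eq_integral[OF g S] lebesgue_integral_eq_integral[OF f S] by simp
qed

lemma compact_integrable:
  fixes P :: "'a::euclidean_space \<Rightarrow> real"
  assumes "compact T" "continuous_on T P"
  shows "integrable (lebesgue_on T) P"
proof -
  obtain B where B: "\<And>x. x \<in> T \<Longrightarrow> norm (P x) \<le> B"
    using compact_imp_bounded[OF compact_continuous_image[OF assms(2,1)]] by (auto simp: bounded_iff)
  have "T \<in> lmeasurable" using assms(1) by (rule lmeasurable_compact)
  then have "finite_measure (lebesgue_on T)" by (rule finite_measure_lebesgue_on)
  moreover have "P \<in> borel_measurable (lebesgue_on T)"
    using assms(2) fmeasurableD[OF \<open>T \<in> lmeasurable\<close>] by (rule continuous_imp_measurable_on_sets_lebesgue)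
  ultimately show ?thesis
    by (intro finite_measure.integrable_const_bound[where B = B]) (use B in \<open>auto intro!: AE_I2\<close>)
qed

section \<open>Discrete functions, their traces and a basis on one fixed mesh\<close>

locale dg_mesh =
  fixes D :: "'a::euclidean_space set" and \<T> :: "'a set set" and k :: nat
  assumes mesh: "polyhedral_mesh D \<T>" and D_open: "open D" and D_compact: "compact (closure D)"
begin

abbreviation V where "V \<equiv> DG_space D \<T> k"

lemma finite_mesh: "finite \<T>"
  using mesh by (simp add: polyhedral_mesh_def)

lemma element:
  assumes "T \<in> \<T>"
  shows "polyhedral_element T" "compact T" "closure (interior T) = T" "connected (interior T)" "interior T \<noteq> {}"
    "finite (faces T)" "frontier T = \<Union>(faces T)" "T \<subseteq> closure D" "T \<in> sets lebesgue" "T \<noteq> {}"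
proof -
  show pe: "polyhedral_element T" using mesh assms by (simp add: polyhedral_mesh_def)
  note p = pe[unfolded polyhedral_element_def]
  show "T \<noteq> {}" "connected (interior T)" "finite (faces T)" using p by blast+
  show "frontier T = \<Union>(faces T)" using p by (elim conjE)
  show *: "compact T" using p by blast
  show cl: "closure (interior T) = T" by (rule sym) (use p in blast)
  show "interior T \<noteq> {}"
  proof
    assume "interior T = {}"
    then show False using cl \<open>T \<noteq> {}\<close> by simp
  qed
  have "\<Union>\<T> = closure D" using mesh by (simp add: polyhedral_mesh_def)
  then show "T \<subseteq> closure D" using assms by blast
  show "T \<in> sets lebesgue" using * by (simp add: lmeasurable_compact fmeasurableD)
qed

lemma disjoint_interiors: "T \<in> \<T> \<Longrightarrow> T' \<in> \<T> \<Longrightarrow> x \<in> interior T \<Longrightarrow> x \<in> interior T' \<Longrightarrow> T = T'"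
proof -
  have "\<forall>T\<in>\<T>. \<forall>T'\<in>\<T>. T \<noteq> T' \<longrightarrow> interior T \<inter> interior T' = {}" using mesh by (simp add: polyhedral_mesh_def)
  then show "T \<in> \<T> \<Longrightarrow> T' \<in> \<T> \<Longrightarrow> x \<in> interior T \<Longrightarrow> x \<in> interior T' \<Longrightarrow> T = T'" by blast
qed

lemma negligible_skeleton: "negligible (\<Union>T\<in>\<T>. frontier T)"
  using finite_mesh negligible_frontier_element element(1) by (intro negligible_Union) auto

lemma in_interior:
  assumes "x \<in> closure D" "x \<notin> (\<Union>T\<in>\<T>. frontier T)"
  obtains T where "T \<in> \<T>" "x \<in> interior T"
proof -
  have "x \<in> \<Union>\<T>" using assms mesh by (simp add: polyhedral_mesh_def)
  then obtain T where T: "T \<in> \<T>" "x \<in> T" by blast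
  then have "x \<in> interior T" using assms(2) closure_subset by (fastforce simp: frontier_def)
  with T show ?thesis using that by blast
qed

text \<open>Square integrability is automatic: off the null skeleton v equals a Borel function that
  is bounded on the bounded set \<open>D\<close>. Membership can therefore be checked element by
  element.\<close>

lemma DG_space_iff: "v \<in> V \<longleftrightarrow> (\<forall>T\<in>\<T>. \<exists>p\<in>polynomials k. \<forall>x\<in>interior T. v x = p x)"
proof
  assume "\<forall>T\<in>\<T>. \<exists>p\<in>polynomials k. \<forall>x\<in>interior T. v x = p x"
  then have "\<exists>p. \<forall>T\<in>\<T>. p T \<in> polynomials k \<and> (\<forall>x\<in>interior T. v x = p T x)"
    unfolding Bex_def by (rule bchoice)
  then obtain p where "\<forall>T\<in>\<T>. p T \<in> polynomials k \<and> (\<forall>x\<in>interior T. v x = p T x)" by (rule exE)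
  then have p: "\<And>T. T \<in> \<T> \<Longrightarrow> p T \<in> polynomials k" "\<And>T x. T \<in> \<T> \<Longrightarrow> x \<in> interior T \<Longrightarrow> v x = p T x"
    by simp_all
  define g where "g x = (\<Sum>T\<in>\<T>. indicat_real (interior T) x * p T x)" for x
  have pm: "p T \<in> borel_measurable borel" if "T \<in> \<T>" for T
    using polynomial_continuous[OF p(1)[OF that]] by (rule borel_measurable_continuous_onI)
  have gm: "g \<in> borel_measurable borel" unfolding g_def
    by (intro borel_measurable_sum borel_measurable_times pm borel_measurable_indicator) auto
  have gv: "v x = g x" if x: "x \<in> D - (\<Union>T\<in>\<T>. frontier T)" for x
  proof -
    have "x \<in> closure D" using x closure_subset by blast
    then obtain T where T: "T \<in> \<T>" "x \<in> interior T" by (rule in_interior) (use x in auto)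
    have "g x = (\<Sum>T'\<in>\<T>. if T' = T then p T x else 0)"
      unfolding g_def by (rule sum.cong) (use T disjoint_interiors in \<open>auto simp: indicator_def\<close>)
    also have "\<dots> = v x" using T finite_mesh p(2) by simp
    finally show ?thesis by simp
  qed
  have "\<exists>B. \<forall>x\<in>D. \<bar>g x\<bar> \<le> B"
  proof -
    have "\<exists>B. \<forall>x\<in>D. \<bar>p T x\<bar> \<le> B" if "T \<in> \<T>" for T
    proof -
      have "bounded (p T ` closure D)"
        by (rule compact_imp_bounded[OF compact_continuous_image[OF polynomial_continuous[OF p(1)[OF that]] D_compact]])
      then obtain B where B: "\<forall>x\<in>closure D. \<bar>p T x\<bar> \<le> B" by (auto simp: bounded_iff)
      then show ?thesis using closure_subset by blast
    qed
    then have "\<forall>T\<in>\<T>. \<exists>B. \<forall>x\<in>D. \<bar>p T x\<bar> \<le> B" by blast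
    from bchoice[OF this] obtain B where B: "\<And>T x. T \<in> \<T> \<Longrightarrow> x \<in> D \<Longrightarrow> \<bar>p T x\<bar> \<le> B T" by blast
    have "\<bar>g x\<bar> \<le> sum B \<T>" if "x \<in> D" for x
      unfolding g_def
    proof (rule order_trans[OF sum_abs sum_mono])
      fix T assume T: "T \<in> \<T>"
      have "\<bar>p T x\<bar> \<le> B T" using B T that by blast
      then show "\<bar>indicat_real (interior T) x * p T x\<bar> \<le> B T" by (auto simp: indicator_def abs_mult)
    qed
    then show ?thesis by blast
  qed
  then obtain B where B: "\<And>x. x \<in> D \<Longrightarrow> \<bar>g x\<bar> \<le> B" by blast
  have Dm: "D \<in> lmeasurable"
    using D_open D_compact by (intro lmeasurable_open) (auto intro: bounded_subset[OF compact_imp_bounded closure_subset])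
  then have fin: "finite_measure (lebesgue_on D)" by (rule finite_measure_lebesgue_on)
  have DL: "D \<in> sets lebesgue" using Dm by (rule fmeasurableD)
  have gmD: "g \<in> borel_measurable (lebesgue_on D)"
    using gm by (intro measurable_restrict_space1 measurable_completion) simp
  have gi: "integrable (lebesgue_on D) g"
    by (rule finite_measure.integrable_const_bound[OF fin, where B = B]) (use B gmD in \<open>auto intro!: AE_I2\<close>)
  have "(g x)\<^sup>2 \<le> B\<^sup>2" if "x \<in> D" for x
    using B[OF that] by (metis abs_ge_zero power2_abs power_mono)
  then have g2i: "integrable (lebesgue_on D) (\<lambda>x. (g x)\<^sup>2)"
    by (intro finite_measure.integrable_const_bound[OF fin, where B = "B\<^sup>2"]) (use gmD in \<open>auto intro!: AE_I2\<close>)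
  have "v \<in> borel_measurable (lebesgue_on D)"
    using integrable_lebesgue_on_spike(1)[OF DL negligible_skeleton gi gv] by (rule borel_measurable_integrable)
  moreover have "integrable (lebesgue_on D) (\<lambda>x. (v x)\<^sup>2)"
    using integrable_lebesgue_on_spike(1)[OF DL negligible_skeleton g2i, of "\<lambda>x. (v x)\<^sup>2"] gv by auto
  ultimately show "v \<in> V" using p by (auto simp: DG_space_def L2_def)
qed (simp add: DG_space_def)

lemma DG_elementE:
  assumes "v \<in> V" "T \<in> \<T>"
  obtains p G where "p \<in> polynomials k" "\<And>b. b \<in> Basis \<Longrightarrow> (\<lambda>x. G x \<bullet> b) \<in> polynomials k"
    "\<And>x. x \<in> interior T \<Longrightarrow> v x = p x" "\<And>x. x \<in> interior T \<Longrightarrow> (v has_derivative (\<lambda>h. G x \<bullet> h)) (at x)"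
    "continuous_on UNIV p" "continuous_on UNIV G"
proof -
  obtain p where p: "p \<in> polynomials k" "\<And>x. x \<in> interior T \<Longrightarrow> v x = p x"
    using assms DG_space_iff by blast
  obtain G where G: "\<And>b. b \<in> Basis \<Longrightarrow> (\<lambda>x. G x \<bullet> b) \<in> polynomials k" "\<And>x. (p has_derivative (\<lambda>h. G x \<bullet> h)) (at x)"
    using polynomial_gradient[OF p(1)] by blast
  have "(v has_derivative (\<lambda>h. G x \<bullet> h)) (at x)" if "x \<in> interior T" for x
    by (rule has_derivative_transform_within_open[OF G(2) open_interior that]) (use p in auto)
  moreover have "continuous_on UNIV G"
    by (subst continuous_on_componentwise) (use G(1) polynomial_continuous in blast)
  ultimately show ?thesis using that[OF p(1) G(1) p(2)] polynomial_continuous[OF p(1)] by blast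
qed

text \<open>On every closed element a discrete function is handled through these traces: they extend
  it and its gradient continuously to the boundary, so all integrands below are continuous on
  compact sets.\<close>

lemma traceE:
  assumes "v \<in> V" "T \<in> \<T>"
  shows "continuous_on T (interior_trace T v)" "continuous_on T (interior_trace T (grad v))"
    "\<And>x. x \<in> interior T \<Longrightarrow> interior_trace T v x = v x"
    "\<And>x. x \<in> interior T \<Longrightarrow> interior_trace T (grad v) x = grad v x"
    "\<And>x. x \<in> interior T \<Longrightarrow> (v has_derivative (\<lambda>h. interior_trace T (grad v) x \<bullet> h)) (at x)"
    "\<And>a x. continuous_on (closure D) a \<Longrightarrow> x \<in> T \<Longrightarrow>
      interior_trace T (\<lambda>z. a z *\<^sub>R grad v z) x = a x *\<^sub>R interior_trace T (grad v) x"
    "\<And>b x. x \<in> T \<Longrightarrow> interior_trace T (\<lambda>z. grad v z \<bullet> b) x = interior_trace T (grad v) x \<bullet> b"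
proof -
  obtain p G where p: "p \<in> polynomials k" "\<And>b. b \<in> Basis \<Longrightarrow> (\<lambda>x. G x \<bullet> b) \<in> polynomials k"
    "\<And>x. x \<in> interior T \<Longrightarrow> v x = p x" "\<And>x. x \<in> interior T \<Longrightarrow> (v has_derivative (\<lambda>h. G x \<bullet> h)) (at x)"
    "continuous_on UNIV p" "continuous_on UNIV G" by (rule DG_elementE[OF assms]) blast
  note T = element[OF assms(2)]
  have cont: "continuous_on T p" "continuous_on T G" using p(5,6) continuous_on_subset by blast+
  have gr: "grad v x = G x" if "x \<in> interior T" for x by (rule grad_eqI[OF p(4)[OF that]])
  have 1: "interior_trace T v x = p x" if "x \<in> T" for x
    by (rule interior_trace_eq[OF T(3) that cont(1) p(3)])
  have 2: "interior_trace T (grad v) x = G x" if "x \<in> T" for x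
    by (rule interior_trace_eq[OF T(3) that cont(2) gr])
  have sub: "x \<in> T" if "x \<in> interior T" for x using that interior_subset by blast
  show "continuous_on T (interior_trace T v)" using cont(1) 1 by (simp cong: continuous_on_cong)
  show "continuous_on T (interior_trace T (grad v))" using cont(2) 2 by (simp cong: continuous_on_cong)
  show "interior_trace T v x = v x" if "x \<in> interior T" for x using 1 p(3) sub that by simp
  show "interior_trace T (grad v) x = grad v x" if "x \<in> interior T" for x using 2 gr sub that by simp
  show "(v has_derivative (\<lambda>h. interior_trace T (grad v) x \<bullet> h)) (at x)" if "x \<in> interior T" for x
    using 2 p(4) sub that by simp
  show "interior_trace T (\<lambda>z. a z *\<^sub>R grad v z) x = a x *\<^sub>R interior_trace T (grad v) x"
    if "continuous_on (closure D) a" "x \<in> T" for a x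
  proof -
    have "continuous_on T a" using that(1) T(8) continuous_on_subset by blast
    then have "interior_trace T (\<lambda>z. a z *\<^sub>R grad v z) x = a x *\<^sub>R G x"
      by (intro interior_trace_eq[OF T(3) that(2)] continuous_intros cont) (auto simp: gr)
    then show ?thesis using 2 that by simp
  qed
  show "interior_trace T (\<lambda>z. grad v z \<bullet> b) x = interior_trace T (grad v) x \<bullet> b" if "x \<in> T" for b x
  proof -
    have "interior_trace T (\<lambda>z. grad v z \<bullet> b) x = G x \<bullet> b"
      by (rule interior_trace_eq[OF T(3) that]) (auto intro!: continuous_intros cont simp: gr)
    then show ?thesis using 2 that by simp
  qed
qed

lemma grad_component_in_V:
  assumes "v \<in> V" "b \<in> Basis"
  shows "(\<lambda>x. grad v x \<bullet> b) \<in> V"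
  unfolding DG_space_iff
proof
  fix T assume T: "T \<in> \<T>"
  obtain p G where p: "p \<in> polynomials k" "\<And>b. b \<in> Basis \<Longrightarrow> (\<lambda>x. G x \<bullet> b) \<in> polynomials k"
    "\<And>x. x \<in> interior T \<Longrightarrow> v x = p x" "\<And>x. x \<in> interior T \<Longrightarrow> (v has_derivative (\<lambda>h. G x \<bullet> h)) (at x)"
    "continuous_on UNIV p" "continuous_on UNIV G" by (rule DG_elementE[OF assms(1) T]) blast
  show "\<exists>p\<in>polynomials k. \<forall>x\<in>interior T. grad v x \<bullet> b = p x"
    using grad_eqI[OF p(4)] assms(2) by (intro bexI[OF _ p(2)]) auto
qed

lemma DG_space_combination:
  assumes Q: "finite Q" and \<phi>: "\<And>q. q \<in> Q \<Longrightarrow> \<phi> q \<in> V"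
    and w: "\<And>T x. T \<in> \<T> \<Longrightarrow> x \<in> interior T \<Longrightarrow> w x = (\<Sum>q\<in>Q. c q * \<phi> q x)"
  shows "w \<in> V"
    "\<And>T x. T \<in> \<T> \<Longrightarrow> x \<in> T \<Longrightarrow> interior_trace T w x = (\<Sum>q\<in>Q. c q * interior_trace T (\<phi> q) x)"
    "\<And>T x. T \<in> \<T> \<Longrightarrow> x \<in> T \<Longrightarrow> interior_trace T (grad w) x = (\<Sum>q\<in>Q. c q *\<^sub>R interior_trace T (grad (\<phi> q)) x)"
proof -
  show "w \<in> V"
    unfolding DG_space_iff
  proof
    fix T assume T: "T \<in> \<T>"
    have "\<forall>q\<in>Q. \<exists>p. p \<in> polynomials k \<and> (\<forall>x\<in>interior T. \<phi> q x = p x)" using \<phi> T DG_space_iff by blast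
    from bchoice[OF this] obtain p where p: "\<forall>q\<in>Q. p q \<in> polynomials k \<and> (\<forall>x\<in>interior T. \<phi> q x = p q x)" by blast
    have "(\<lambda>x. \<Sum>q\<in>Q. c q * p q x) \<in> polynomials k" by (rule polynomials_sum[OF Q]) (use p in blast)
    moreover have "\<forall>x\<in>interior T. w x = (\<Sum>q\<in>Q. c q * p q x)" using w[OF T] p by auto
    ultimately show "\<exists>p\<in>polynomials k. \<forall>x\<in>interior T. w x = p x"
      by (intro bexI[of _ "\<lambda>x. \<Sum>q\<in>Q. c q * p q x"])
  qed
  fix T x assume T: "T \<in> \<T>" and x: "x \<in> T"
  show "interior_trace T w x = (\<Sum>q\<in>Q. c q * interior_trace T (\<phi> q) x)"
    by (rule interior_trace_eq[OF element(3)[OF T] x])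
       (auto intro!: continuous_intros traceE(1) \<phi> T sum.cong simp: w[OF T] traceE(3)[OF \<phi> T])
  have gw: "grad w z = (\<Sum>q\<in>Q. c q *\<^sub>R interior_trace T (grad (\<phi> q)) z)" if z: "z \<in> interior T" for z
  proof (rule grad_eqI)
    have "((\<lambda>x. \<Sum>q\<in>Q. c q * \<phi> q x) has_derivative (\<lambda>h. \<Sum>q\<in>Q. c q * (interior_trace T (grad (\<phi> q)) z \<bullet> h))) (at z)"
      by (rule has_derivative_sum, rule has_derivative_mult_right, rule traceE(5)[OF \<phi> T z])
    then have "((\<lambda>x. \<Sum>q\<in>Q. c q * \<phi> q x) has_derivative (\<lambda>h. (\<Sum>q\<in>Q. c q *\<^sub>R interior_trace T (grad (\<phi> q)) z) \<bullet> h)) (at z)"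
      by (simp add: inner_sum_left)
    then show "(w has_derivative (\<lambda>h. (\<Sum>q\<in>Q. c q *\<^sub>R interior_trace T (grad (\<phi> q)) z) \<bullet> h)) (at z)"
      by (rule has_derivative_transform_within_open[OF _ open_interior z]) (use w[OF T] in auto)
  qed
  show "interior_trace T (grad w) x = (\<Sum>q\<in>Q. c q *\<^sub>R interior_trace T (grad (\<phi> q)) x)"
    by (rule interior_trace_eq[OF element(3)[OF T] x])
       (auto intro!: continuous_intros traceE(2) \<phi> T simp: gw)
qed

text \<open>Functions in \<open>V\<close> are arbitrary off the element interiors, so only there can
  they be expected to be combinations of finitely many others.\<close>

definition spans :: "('a \<Rightarrow> real) set \<Rightarrow> bool" where
  "spans \<Phi> \<longleftrightarrow> finite \<Phi> \<and> \<Phi> \<subseteq> V \<and> (\<forall>v\<in>V. \<exists>c. \<forall>T\<in>\<T>. \<forall>x\<in>interior T. v x = (\<Sum>\<phi>\<in>\<Phi>. c \<phi> * \<phi> x))"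

lemma spans_exists: "\<exists>\<Phi>. spans \<Phi>"
proof -
  let ?J = "\<T> \<times> multi_degrees k"
  \<comment> \<open>Monomials cut off to a single element interior; by disjointness they vanish in
    all the others.\<close>
  define \<psi> where "\<psi> j = (\<lambda>x. if x \<in> interior (fst j) then monomial_fun (snd j) x else 0)" for j :: "'a set \<times> ('a \<Rightarrow> nat)"
  have J: "finite ?J" using finite_mesh by simp
  have "\<psi> j \<in> V" if j: "j \<in> ?J" for j
    unfolding DG_space_iff
  proof
    fix T assume T: "T \<in> \<T>"
    obtain T' \<alpha> where j': "j = (T', \<alpha>)" "T' \<in> \<T>" "\<alpha> \<in> multi_degrees k" using j by auto
    show "\<exists>p\<in>polynomials k. \<forall>x\<in>interior T. \<psi> j x = p x"
    proof (cases "T = T'")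
      case True
      then show ?thesis using monomial_in_polynomials[OF j'(3), of 1] by (auto simp: \<psi>_def j' intro!: bexI)
    next
      case False
      then have "\<forall>x\<in>interior T. \<psi> j x = 0" using disjoint_interiors T j' by (auto simp: \<psi>_def)
      then show ?thesis using polynomials_zero by (intro bexI)
    qed
  qed
  moreover have "\<exists>c. \<forall>T\<in>\<T>. \<forall>x\<in>interior T. v x = (\<Sum>\<phi>\<in>\<psi> ` ?J. c \<phi> * \<phi> x)" if v: "v \<in> V" for v
  proof -
    have "\<forall>T\<in>\<T>. \<exists>d. \<forall>x\<in>interior T. v x = (\<Sum>\<alpha>\<in>multi_degrees k. d \<alpha> * monomial_fun \<alpha> x)"
      using v unfolding DG_space_iff polynomials_eq by blast
    from bchoice[OF this]
    obtain d where d: "\<And>T x. T \<in> \<T> \<Longrightarrow> x \<in> interior T \<Longrightarrow> v x = (\<Sum>\<alpha>\<in>multi_degrees k. d T \<alpha> * monomial_fun \<alpha> x)"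
      by blast
    \<comment> \<open>Summing over the fibre of \<open>\<psi>\<close> gives the right coefficient
      even if several indices were to yield the same function.\<close>
    define c where "c \<phi> = (\<Sum>j\<in>{j\<in>?J. \<psi> j = \<phi>}. d (fst j) (snd j))" for \<phi>
    have "v x = (\<Sum>\<phi>\<in>\<psi> ` ?J. c \<phi> * \<phi> x)" if T: "T \<in> \<T>" and x: "x \<in> interior T" for T x
    proof -
      have "(\<Sum>j\<in>?J. d (fst j) (snd j) * \<psi> j x) = (\<Sum>T'\<in>\<T>. \<Sum>\<alpha>\<in>multi_degrees k. d T' \<alpha> * \<psi> (T', \<alpha>) x)"
        by (subst sum.cartesian_product) (simp add: case_prod_beta)
      also have "\<dots> = (\<Sum>T'\<in>\<T>. if T' = T then v x else 0)"
      proof (rule sum.cong[OF refl])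
        fix T' assume T': "T' \<in> \<T>"
        show "(\<Sum>\<alpha>\<in>multi_degrees k. d T' \<alpha> * \<psi> (T', \<alpha>) x) = (if T' = T then v x else 0)"
        proof (cases "T' = T")
          case True
          then show ?thesis using d[OF T x] x by (simp add: \<psi>_def)
        next
          case False
          then have "x \<notin> interior T'" using disjoint_interiors[OF T T' x] by blast
          then show ?thesis using False by (simp add: \<psi>_def)
        qed
      qed
      also have "\<dots> = v x" using T finite_mesh by simp
      finally have "v x = (\<Sum>j\<in>?J. d (fst j) (snd j) * \<psi> j x)" by simp
      also have "\<dots> = (\<Sum>\<phi>\<in>\<psi> ` ?J. \<Sum>j\<in>{j\<in>?J. \<psi> j = \<phi>}. d (fst j) (snd j) * \<psi> j x)"
        by (rule sum.image_gen[OF J])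
      also have "\<dots> = (\<Sum>\<phi>\<in>\<psi> ` ?J. c \<phi> * \<phi> x)"
        unfolding c_def sum_distrib_right by (intro sum.cong) auto
      finally show ?thesis .
    qed
    then show ?thesis by blast
  qed
  ultimately have "spans (\<psi> ` ?J)" using J unfolding spans_def by blast
  then show ?thesis by blast
qed

text \<open>A spanning set of least cardinality works: a nontrivial relation would allow one of its
  members to be eliminated.\<close>

lemma basis_exists:
  obtains \<Phi> where "spans \<Phi>"
    "\<And>c \<phi>. (\<And>T x. T \<in> \<T> \<Longrightarrow> x \<in> interior T \<Longrightarrow> (\<Sum>\<phi>\<in>\<Phi>. c \<phi> * \<phi> x) = 0) \<Longrightarrow> \<phi> \<in> \<Phi> \<Longrightarrow> c \<phi> = 0"
proof -
  obtain \<Phi>0 where "spans \<Phi>0" using spans_exists by blast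
  then obtain \<Phi> where \<Phi>: "spans \<Phi>" and min: "\<And>\<Psi>. spans \<Psi> \<Longrightarrow> card \<Phi> \<le> card \<Psi>"
    using ex_has_least_nat[of spans \<Phi>0 card] by blast
  have fin: "finite \<Phi>" using \<Phi> by (simp add: spans_def)
  have "c \<phi> = 0" if c: "\<And>T x. T \<in> \<T> \<Longrightarrow> x \<in> interior T \<Longrightarrow> (\<Sum>\<phi>\<in>\<Phi>. c \<phi> * \<phi> x) = 0" and \<phi>: "\<phi> \<in> \<Phi>" for c \<phi>
  proof (rule ccontr)
    assume nz: "c \<phi> \<noteq> 0"
    have "\<exists>e. \<forall>T\<in>\<T>. \<forall>x\<in>interior T. v x = (\<Sum>\<phi>'\<in>\<Phi> - {\<phi>}. e \<phi>' * \<phi>' x)" if v: "v \<in> V" for v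
    proof -
      obtain d where d: "\<forall>T\<in>\<T>. \<forall>x\<in>interior T. v x = (\<Sum>\<phi>\<in>\<Phi>. d \<phi> * \<phi> x)"
        using \<Phi> v unfolding spans_def by blast
      \<comment> \<open>The relation is subtracted with the factor that cancels the coefficient of
        \<open>\<phi>\<close>.\<close>
      have "v x = (\<Sum>\<phi>'\<in>\<Phi> - {\<phi>}. (d \<phi>' - d \<phi> / c \<phi> * c \<phi>') * \<phi>' x)" if T: "T \<in> \<T>" "x \<in> interior T" for T x
      proof -
        have "v x = (\<Sum>\<phi>'\<in>\<Phi>. d \<phi>' * \<phi>' x) - d \<phi> / c \<phi> * (\<Sum>\<phi>'\<in>\<Phi>. c \<phi>' * \<phi>' x)"
          using d T c[OF T] by simp
        also have "\<dots> = (\<Sum>\<phi>'\<in>\<Phi>. (d \<phi>' - d \<phi> / c \<phi> * c \<phi>') * \<phi>' x)"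
          by (simp add: sum_distrib_left sum_subtractf algebra_simps)
        also have "\<dots> = (\<Sum>\<phi>'\<in>\<Phi> - {\<phi>}. (d \<phi>' - d \<phi> / c \<phi> * c \<phi>') * \<phi>' x)"
          using nz by (subst sum.remove[OF fin \<phi>]) simp
        finally show ?thesis .
      qed
      then show ?thesis by (intro exI[of _ "\<lambda>\<phi>'. d \<phi>' - d \<phi> / c \<phi> * c \<phi>'"]) blast
    qed
    then have "spans (\<Phi> - {\<phi>})" using \<Phi> unfolding spans_def by blast
    then have "card \<Phi> \<le> card (\<Phi> - {\<phi>})" by (rule min)
    then show False using card_Diff1_less[OF fin \<phi>] by simp
  qed
  then show ?thesis using that \<Phi> by blast
qed

end

section \<open>The discontinuous Galerkin form\<close>

lemma young_inner:
  fixes x y :: "'a::real_inner"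
  assumes "t > 0"
  shows "\<bar>x \<bullet> y\<bar> \<le> (t * (x \<bullet> x) + (y \<bullet> y) / t) / 2"
proof -
  \<comment> \<open>Expanding the square with c = 1 and c = -1 controls both signs of the inner
    product.\<close>
  have "0 \<le> (t *\<^sub>R x - c *\<^sub>R y) \<bullet> (t *\<^sub>R x - c *\<^sub>R y)" for c by simp
  then have *: "2 * t * c * (x \<bullet> y) \<le> t\<^sup>2 * (x \<bullet> x) + c\<^sup>2 * (y \<bullet> y)" for c
    by (simp add: inner_diff_left inner_diff_right inner_commute power2_eq_square algebra_simps)
  have "2 * t * \<bar>x \<bullet> y\<bar> \<le> t\<^sup>2 * (x \<bullet> x) + y \<bullet> y"
    using *[of 1] *[of "-1"] by (auto simp: abs_if)
  then show ?thesis using assms by (simp add: field_simps power2_eq_square)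
qed

text \<open>For positive A and B the weight s = B/A is optimal. If one of them vanishes, s tends to
  infinity or to 0 and forces x to be at most 0. Optimising after summation spares a Cauchy-Schwarz
  inequality for sums of volume and face integrals.\<close>

lemma le_geometric_mean_of_scaled_sums:
  fixes x K A B :: real
  assumes "\<And>s. s > 0 \<Longrightarrow> x \<le> K * (s * A\<^sup>2 + B\<^sup>2 / s) / 2" "K \<ge> 0" "A \<ge> 0" "B \<ge> 0"
  shows "x \<le> K * A * B"
proof (cases "A > 0 \<and> B > 0")
  case True
  then have "(B / A) * A\<^sup>2 + B\<^sup>2 / (B / A) = 2 * (A * B)" by (simp add: power2_eq_square)
  then show ?thesis using assms(1)[of "B / A"] True by simp
next
  case False
  have "x \<le> 0"
  proof (rule field_le_epsilon)
    fix e :: real assume e: "e > 0"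
    show "x \<le> 0 + e"
    proof (cases "A = 0")
      case True
      \<comment> \<open>Large enough that \<open>K * B\<^sup>2 / ?s\<close> is at most e; the added
        1 keeps it positive when the product vanishes.\<close>
      let ?s = "(K * B\<^sup>2 + 1) / e"
      have pos: "K * B\<^sup>2 + 1 > 0" using assms by (simp add: add_nonneg_pos)
      have "x \<le> K * (B\<^sup>2 / ?s) / 2" using assms(1)[of ?s] True e pos by simp
      also have "\<dots> = (K * B\<^sup>2 / (K * B\<^sup>2 + 1)) * e / 2" by simp
      also have "\<dots> \<le> 1 * e / 2" using pos e assms by (intro divide_right_mono mult_right_mono) auto
      finally show ?thesis using e by simp
    next
      case nz: False
      then have B: "B = 0" using False assms by auto
      let ?s = "e / (K * A\<^sup>2 + 1)"
      have pos: "K * A\<^sup>2 + 1 > 0" using assms by (simp add: add_nonneg_pos)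
      have "x \<le> K * (?s * A\<^sup>2) / 2" using assms(1)[of ?s] B e pos by simp
      also have "\<dots> = (K * A\<^sup>2 / (K * A\<^sup>2 + 1)) * e / 2" by simp
      also have "\<dots> \<le> 1 * e / 2" using pos e assms by (intro divide_right_mono mult_right_mono) auto
      finally show ?thesis using e by simp
    qed
  qed
  then show ?thesis using assms by (meson mult_nonneg_nonneg order_trans)
qed

lemma L2norm_square: "(L2norm M g)\<^sup>2 = (\<integral>x. (norm (g x))\<^sup>2 \<partial>M)"
  unfolding L2norm_def by (simp add: integral_nonneg_AE)

lemma diameter_pos:
  fixes S :: "'a::metric_space set"
  assumes "bounded S" "x \<in> S" "y \<in> S" "x \<noteq> y"
  shows "0 < diameter S"
  using diameter_bounded_bound[OF assms(1-3)] assms(4) by (metis less_le_trans zero_less_dist_iff)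

context dg_mesh
begin

abbreviation "\<F> \<equiv> mesh_faces \<T>"
abbreviation "hF \<equiv> face_size \<T>"
abbreviation gtr where "gtr T v \<equiv> interior_trace T (grad v)"
abbreviation J where "J F v \<equiv> jump \<T> F v"
abbreviation S where "S F v \<equiv> average \<T> F (grad v)"

lemma finite_faces: "finite \<F>"
  unfolding mesh_faces_def using finite_mesh element(6) by auto

lemma face_elements:
  assumes "F \<in> \<F>"
  shows "finite (face_elements \<T> F)" "face_elements \<T> F \<noteq> {}"
    "\<And>T. T \<in> face_elements \<T> F \<Longrightarrow> T \<in> \<T>" "\<And>T. T \<in> face_elements \<T> F \<Longrightarrow> F \<in> faces T"
    "\<And>T x. T \<in> face_elements \<T> F \<Longrightarrow> x \<in> F \<Longrightarrow> x \<in> T"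
proof -
  show "finite (face_elements \<T> F)" "face_elements \<T> F \<noteq> {}"
    "\<And>T. T \<in> face_elements \<T> F \<Longrightarrow> T \<in> \<T>" "\<And>T. T \<in> face_elements \<T> F \<Longrightarrow> F \<in> faces T"
    using assms finite_mesh by (auto simp: face_elements_def mesh_faces_def)
  show "x \<in> T" if "T \<in> face_elements \<T> F" "x \<in> F" for T x
    using compact_face(2)[of T F] element(2) that by (auto simp: face_elements_def)
qed

lemma flat_set_mesh_face:
  assumes "F \<in> \<F>"
  obtains n c x r where "flat_set F n c x r"
proof -
  obtain T where "T \<in> \<T>" "F \<in> faces T" using assms by (auto simp: mesh_faces_def)
  then show ?thesis using flat_set_face[OF element(2)] that by metis
qed

lemma face_integrable_mesh: "F \<in> \<F> \<Longrightarrow> continuous_on F g \<Longrightarrow> integrable (face_measure F) (g :: 'a \<Rightarrow> real)"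
  using flat_set_mesh_face flat_set.face_integrable by metis

lemma space_face: "F \<in> \<F> \<Longrightarrow> space (face_measure F) = F"
  using flat_set_mesh_face flat_set.space_face_measure by metis

lemma face_compact: "F \<in> \<F> \<Longrightarrow> compact F"
  using flat_set_mesh_face flat_set.compact by metis

lemma element_integrable: "T \<in> \<T> \<Longrightarrow> continuous_on T g \<Longrightarrow> integrable (lebesgue_on T) (g :: 'a \<Rightarrow> real)"
  using compact_integrable element(2) by blast

lemma element_integral_cong:
  assumes "T \<in> \<T>" "continuous_on T P" "\<And>x. x \<in> interior T \<Longrightarrow> g x = P x"
  shows "integral\<^sup>L (lebesgue_on T) g = integral\<^sup>L (lebesgue_on T) (P :: 'a \<Rightarrow> real)"
proof (rule integrable_lebesgue_on_spike(2)[OF element(9)[OF assms(1)] negligible_frontier_element element_integrable])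
  show "polyhedral_element T" using element(1) assms(1) .
  fix x assume "x \<in> T - frontier T"
  then have "x \<in> interior T" using closure_subset by (fastforce simp: frontier_def)
  then show "g x = P x" by (rule assms(3))
qed (use assms in auto)

lemma element_diameter_pos:
  assumes "T \<in> \<T>"
  shows "0 < diameter T"
proof -
  obtain x where "x \<in> interior T" using element(5)[OF assms] by blast
  then obtain r where r: "r > 0" "ball x r \<subseteq> T" by (auto simp: mem_interior)
  define b where "b = (SOME b :: 'a. b \<in> Basis)"
  have b: "b \<in> Basis" unfolding b_def by (rule someI_ex) (use nonempty_Basis in blast)
  have "x + (r/2) *\<^sub>R b \<in> T" "x \<in> T" using r b by (auto simp: subset_iff dist_norm)
  moreover have "x \<noteq> x + (r/2) *\<^sub>R b" using r b by auto
  ultimately show ?thesis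
    using diameter_pos[OF compact_imp_bounded[OF element(2)[OF assms]], of x "x + (r/2) *\<^sub>R b"] by blast
qed

text \<open>In dimension one the size is a minimum of element diameters; otherwise the disc inside
  the face provides two distinct points.\<close>

lemma face_size_pos:
  assumes "F \<in> \<F>"
  shows "0 < hF F"
proof (cases "DIM('a) = 1")
  case True
  then show ?thesis
    using face_elements[OF assms] element_diameter_pos by (auto simp: face_size_def)
next
  case False
  then have "2 \<le> DIM('a)" using DIM_positive[where 'a = 'a] by linarith
  obtain T where T: "T \<in> \<T>" "F \<in> faces T" using assms by (auto simp: mesh_faces_def)
  obtain x r where x: "r > 0" "x \<in> F" "\<And>z. dist x z < r \<Longrightarrow> (z - x) \<bullet> face_normal T F = 0 \<Longrightarrow> z \<in> F"
    using face_disc[OF T(2)] by blast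
  obtain v where v: "v \<noteq> 0" "orthogonal (face_normal T F) v"
    using orthogonal_to_vector_exists[OF \<open>2 \<le> DIM('a)\<close>] by metis
  let ?z = "x + (r / (2 * norm v)) *\<^sub>R v"
  have "?z \<in> F" by (rule x(3)) (use v x(1) in \<open>auto simp: dist_norm orthogonal_def inner_commute\<close>)
  moreover have "x \<noteq> ?z" using v x(1) by auto
  ultimately show ?thesis
    using False diameter_pos[OF compact_imp_bounded[OF face_compact[OF assms]] x(2), of ?z] by (simp add: face_size_def)
qed

text \<open>Exchanges the face size in the norms for the element diameter in the trace
  inequality.\<close>

lemma face_size_le_diameter:
  assumes "F \<in> \<F>" "T \<in> face_elements \<T> F"
  shows "hF F \<le> diameter T"
proof -
  have "F \<subseteq> T" using face_elements(5)[OF assms] by blast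
  moreover have "bounded T" using element(2) face_elements(3)[OF assms] compact_imp_bounded by blast
  ultimately have "diameter F \<le> diameter T" by (rule diameter_subset)
  then show ?thesis using face_elements(1)[OF assms(1)] assms(2) by (auto simp: face_size_def intro: Min_le)
qed

text \<open>Form and norms are all values of this one functional at a volume density and a face
  density, which turns their estimates into pointwise inequalities.\<close>

definition Phi :: "('a set \<Rightarrow> 'a \<Rightarrow> real) \<Rightarrow> ('a set \<Rightarrow> 'a \<Rightarrow> real) \<Rightarrow> real" where
  "Phi g G = (\<Sum>T\<in>\<T>. \<integral>x. g T x \<partial>lebesgue_on T) + (\<Sum>F\<in>\<F>. \<integral>x. G F x \<partial>face_measure F)"

definition mesh_continuous :: "('a set \<Rightarrow> 'a \<Rightarrow> real) \<Rightarrow> ('a set \<Rightarrow> 'a \<Rightarrow> real) \<Rightarrow> bool" where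
  "mesh_continuous g G \<longleftrightarrow> (\<forall>T\<in>\<T>. continuous_on T (g T)) \<and> (\<forall>F\<in>\<F>. continuous_on F (G F))"

lemma Phi_cong:
  assumes "\<And>T x. T \<in> \<T> \<Longrightarrow> x \<in> T \<Longrightarrow> g T x = g' T x" "\<And>F x. F \<in> \<F> \<Longrightarrow> x \<in> F \<Longrightarrow> G F x = G' F x"
  shows "Phi g G = Phi g' G'"
  unfolding Phi_def
  by (intro arg_cong2[of _ _ _ _ "(+)"] sum.cong Bochner_Integration.integral_cong refl assms) (auto simp: space_face)

lemma Phi_mono:
  assumes "mesh_continuous g G" "mesh_continuous g' G'"
    and "\<And>T x. T \<in> \<T> \<Longrightarrow> x \<in> T \<Longrightarrow> g T x \<le> g' T x" "\<And>F x. F \<in> \<F> \<Longrightarrow> x \<in> F \<Longrightarrow> G F x \<le> G' F x"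
  shows "Phi g G \<le> Phi g' G'"
  unfolding Phi_def
  by (intro add_mono sum_mono integral_mono face_integrable_mesh element_integrable)
     (use assms in \<open>auto simp: mesh_continuous_def space_face\<close>)

lemma Phi_sum:
  assumes I: "finite I" and "\<And>i. i \<in> I \<Longrightarrow> mesh_continuous (g i) (G i)"
  shows "Phi (\<lambda>T x. \<Sum>i\<in>I. c i * g i T x) (\<lambda>F x. \<Sum>i\<in>I. c i * G i F x) = (\<Sum>i\<in>I. c i * Phi (g i) (G i))"
proof -
  have 1: "(\<integral>x. (\<Sum>i\<in>I. c i * g i T x) \<partial>lebesgue_on T) = (\<Sum>i\<in>I. c i * (\<integral>x. g i T x \<partial>lebesgue_on T))" if "T \<in> \<T>" for T
    by (subst Bochner_Integration.integral_sum)
       (use that assms in \<open>auto simp: mesh_continuous_def intro!: element_integrable integrable_mult_right\<close>)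
  have 2: "(\<integral>x. (\<Sum>i\<in>I. c i * G i F x) \<partial>face_measure F) = (\<Sum>i\<in>I. c i * (\<integral>x. G i F x \<partial>face_measure F))" if "F \<in> \<F>" for F
    by (subst Bochner_Integration.integral_sum)
       (use that assms in \<open>auto simp: mesh_continuous_def intro!: face_integrable_mesh integrable_mult_right\<close>)
  have "(\<Sum>T\<in>\<T>. \<Sum>i\<in>I. c i * (\<integral>x. g i T x \<partial>lebesgue_on T)) = (\<Sum>i\<in>I. \<Sum>T\<in>\<T>. c i * (\<integral>x. g i T x \<partial>lebesgue_on T))"
    "(\<Sum>F\<in>\<F>. \<Sum>i\<in>I. c i * (\<integral>x. G i F x \<partial>face_measure F)) = (\<Sum>i\<in>I. \<Sum>F\<in>\<F>. c i * (\<integral>x. G i F x \<partial>face_measure F))"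
    by (rule sum.swap)+
  then show ?thesis
    unfolding Phi_def by (simp add: 1 2 distrib_left sum.distrib sum_distrib_left)
qed

lemma Phi_add_scaled:
  assumes "mesh_continuous g G" "mesh_continuous g' G'"
  shows "Phi (\<lambda>T x. g T x + c * g' T x) (\<lambda>F x. G F x + c * G' F x) = Phi g G + c * Phi g' G'"
  using Phi_sum[of "{True, False}" "\<lambda>i. if i then g else g'" "\<lambda>i. if i then G else G'" "\<lambda>i. if i then 1 else c"] assms
  by simp

lemma Phi_scale:
  assumes "mesh_continuous g G"
  shows "Phi (\<lambda>T x. c * g T x) (\<lambda>F x. c * G F x) = c * Phi g G"
  using Phi_sum[of "{()}" "\<lambda>_. g" "\<lambda>_. G" "\<lambda>_. c"] assms by simp

lemma Phi_abs_le:
  assumes "mesh_continuous g G" "mesh_continuous P Q"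
    and "\<And>T x. T \<in> \<T> \<Longrightarrow> x \<in> T \<Longrightarrow> \<bar>g T x\<bar> \<le> P T x" "\<And>F x. F \<in> \<F> \<Longrightarrow> x \<in> F \<Longrightarrow> \<bar>G F x\<bar> \<le> Q F x"
  shows "\<bar>Phi g G\<bar> \<le> Phi P Q"
proof -
  have le: "Phi g G \<le> Phi P Q" by (rule Phi_mono[OF assms(1,2)]) (use assms(3,4) abs_le_D1 in blast)+
  have m: "mesh_continuous (\<lambda>T x. (-1) * g T x) (\<lambda>F x. (-1) * G F x)"
    using assms(1) by (auto simp: mesh_continuous_def intro!: continuous_intros)
  have "Phi (\<lambda>T x. (-1) * g T x) (\<lambda>F x. (-1) * G F x) \<le> Phi P Q"
    by (rule Phi_mono[OF m assms(2)]) (use assms(3,4) in \<open>force simp: abs_le_iff\<close>)+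
  then show ?thesis using le unfolding Phi_scale[OF assms(1)] by linarith
qed

lemma jump_continuous: "v \<in> V \<Longrightarrow> F \<in> \<F> \<Longrightarrow> continuous_on F (J F v)"
  unfolding jump_def[abs_def]
  by (intro continuous_intros continuous_on_subset[OF traceE(1)]) (auto dest: face_elements)

lemma average_continuous: "v \<in> V \<Longrightarrow> F \<in> \<F> \<Longrightarrow> continuous_on F (S F v)"
  unfolding average_def[abs_def]
  by (intro continuous_intros continuous_on_subset[OF traceE(2)]) (auto dest: face_elements)

text \<open>The coefficient is continuous across the face, so its one-sided traces equal
  \<open>b x\<close> and it leaves the average. This makes the face density linear in the values of
  \<open>b\<close>.\<close>

lemma average_coefficient:
  assumes "v \<in> V" "F \<in> \<F>" "x \<in> F" "continuous_on (closure D) b"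
  shows "average \<T> F (\<lambda>z. b z *\<^sub>R grad v z) x = b x *\<^sub>R S F v x"
proof -
  have "(\<Sum>T\<in>face_elements \<T> F. interior_trace T (\<lambda>z. b z *\<^sub>R grad v z) x) = (\<Sum>T\<in>face_elements \<T> F. b x *\<^sub>R gtr T v x)"
    by (rule sum.cong) (use assms face_elements[OF assms(2)] in \<open>auto intro!: traceE(6)\<close>)
  then show ?thesis unfolding average_def by (simp add: scaleR_right.sum[symmetric] mult.commute)
qed

lemma face_subset_closure: "F \<in> \<F> \<Longrightarrow> F \<subseteq> closure D"
  using face_elements element(8) by (metis all_not_in_conv subset_iff)

definition vol_dens :: "('a \<Rightarrow> real) \<Rightarrow> ('a \<Rightarrow> real) \<Rightarrow> ('a \<Rightarrow> real) \<Rightarrow> 'a set \<Rightarrow> 'a \<Rightarrow> real" where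
  "vol_dens b w v T x = b x * (gtr T w x \<bullet> gtr T v x)"

definition face_dens :: "real \<Rightarrow> ('a \<Rightarrow> real) \<Rightarrow> real \<Rightarrow> ('a \<Rightarrow> real) \<Rightarrow> ('a \<Rightarrow> real) \<Rightarrow> 'a set \<Rightarrow> 'a \<Rightarrow> real" where
  "face_dens \<theta> b e w v F x = \<theta> * (b x * (S F v x \<bullet> J F w x)) - b x * (S F w x \<bullet> J F v x) + e / hF F * (J F w x \<bullet> J F v x)"

definition star_dens :: "('a \<Rightarrow> real) \<Rightarrow> real \<Rightarrow> ('a \<Rightarrow> real) \<Rightarrow> 'a set \<Rightarrow> 'a \<Rightarrow> real" where
  "star_dens a \<eta> v F x = \<eta> / hF F * (J F v x \<bullet> J F v x) + hF F / \<eta> * ((a x)\<^sup>2 * (S F v x \<bullet> S F v x))"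

lemma element_continuous:
  assumes "T \<in> \<T>" "continuous_on (closure D) b"
  shows "continuous_on T b"
  using assms element(8) continuous_on_subset by blast

lemma face_continuous:
  assumes "F \<in> \<F>" "continuous_on (closure D) b"
  shows "continuous_on F b"
  using assms face_subset_closure continuous_on_subset by blast

lemma dens_continuous:
  assumes "w \<in> V" "v \<in> V" "continuous_on (closure D) b"
  shows "mesh_continuous (vol_dens b w v) (face_dens \<theta> b e w v)"
    "mesh_continuous (vol_dens b w v) (star_dens b e v)"
  unfolding mesh_continuous_def vol_dens_def face_dens_def star_dens_def
  by (intro conjI ballI continuous_on_const continuous_on_add continuous_on_diff continuous_on_mult continuous_on_power
      continuous_on_inner traceE(2) jump_continuous average_continuous
      element_continuous[OF _ assms(3)] face_continuous[OF _ assms(3)] assms(1,2); assumption)+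

lemma DG_form_Phi:
  assumes w: "w \<in> V" and v: "v \<in> V" and b: "continuous_on (closure D) b"
  shows "DG_form \<theta> \<T> b e w v = Phi (vol_dens b w v) (face_dens \<theta> b e w v)"
  unfolding DG_form_def Phi_def
proof (intro arg_cong2[of _ _ _ _ "(+)"] sum.cong refl)
  fix T assume T: "T \<in> \<T>"
  have "continuous_on T (vol_dens b w v T)" using dens_continuous(1)[OF w v b] T by (auto simp: mesh_continuous_def)
  then show "(\<integral>x. b x * (grad w x \<bullet> grad v x) \<partial>lebesgue_on T) = integral\<^sup>L (lebesgue_on T) (vol_dens b w v T)"
    by (rule element_integral_cong[OF T]) (simp add: vol_dens_def traceE(4)[OF w T] traceE(4)[OF v T])
next
  fix F assume F: "F \<in> \<F>"
  show "(\<integral>x. \<theta> * (average \<T> F (\<lambda>z. b z *\<^sub>R grad v z) x \<bullet> jump \<T> F w x) - average \<T> F (\<lambda>z. b z *\<^sub>R grad w z) x \<bullet> jump \<T> F v x +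
       e / face_size \<T> F * (jump \<T> F w x \<bullet> jump \<T> F v x) \<partial>face_measure F) = integral\<^sup>L (face_measure F) (face_dens \<theta> b e w v F)"
    by (rule Bochner_Integration.integral_cong[OF refl])
       (simp add: space_face[OF F] face_dens_def average_coefficient[OF _ F _ b] w v)
qed

lemma DG_norm_Phi:
  assumes v: "v \<in> V" and a: "continuous_on (closure D) a" "\<And>x. x \<in> closure D \<Longrightarrow> 0 \<le> a x" and \<eta>: "\<eta> > 0"
  shows "(DG_norm \<T> a \<eta> v)\<^sup>2 = Phi (vol_dens a v v) (\<lambda>F x. \<eta> / hF F * (J F v x \<bullet> J F v x))"
    "(DG_norm_star \<T> a \<eta> v)\<^sup>2 = Phi (vol_dens a v v) (star_dens a \<eta> v)"
proof -
  have 1: "(L2norm (lebesgue_on T) (\<lambda>x. sqrt (a x) *\<^sub>R grad v x))\<^sup>2 = integral\<^sup>L (lebesgue_on T) (vol_dens a v v T)" if T: "T \<in> \<T>" for T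
    unfolding L2norm_square
  proof (rule element_integral_cong[OF T])
    show "continuous_on T (vol_dens a v v T)" using dens_continuous(1)[OF v v a(1)] T by (auto simp: mesh_continuous_def)
    fix x assume x: "x \<in> interior T"
    then have "x \<in> closure D" using interior_subset element(8)[OF T] by blast
    then show "(norm (sqrt (a x) *\<^sub>R grad v x))\<^sup>2 = vol_dens a v v T x"
      using a(2) by (simp add: vol_dens_def power_mult_distrib traceE(4)[OF v T x]) (simp add: power2_norm_eq_inner)
  qed
  have 2: "\<eta> / hF F * (L2norm (face_measure F) (jump \<T> F v))\<^sup>2 = (\<integral>x. \<eta> / hF F * (J F v x \<bullet> J F v x) \<partial>face_measure F)"
    for F unfolding L2norm_square by (simp add: power2_norm_eq_inner)
  have nn1: "0 \<le> (\<Sum>T\<in>\<T>. (L2norm (lebesgue_on T) (\<lambda>x. sqrt (a x) *\<^sub>R grad v x))\<^sup>2)" by (simp add: sum_nonneg)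
  have nn2: "0 \<le> (\<Sum>F\<in>\<F>. \<eta> / hF F * (L2norm (face_measure F) (jump \<T> F v))\<^sup>2)"
    using \<eta> face_size_pos by (intro sum_nonneg mult_nonneg_nonneg) (auto simp: less_imp_le)
  show *: "(DG_norm \<T> a \<eta> v)\<^sup>2 = Phi (vol_dens a v v) (\<lambda>F x. \<eta> / hF F * (J F v x \<bullet> J F v x))"
    unfolding DG_norm_def Phi_def real_sqrt_pow2[OF add_nonneg_nonneg[OF nn1 nn2]]
    by (intro arg_cong2[of _ _ _ _ "(+)"] sum.cong refl 1 2)
  have 3: "hF F / \<eta> * (L2norm (face_measure F) (average \<T> F (\<lambda>z. a z *\<^sub>R grad v z)))\<^sup>2 =
     (\<integral>x. hF F / \<eta> * ((a x)\<^sup>2 * (S F v x \<bullet> S F v x)) \<partial>face_measure F)" if F: "F \<in> \<F>" for F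
    unfolding L2norm_square integral_mult_right_zero[symmetric]
    by (rule Bochner_Integration.integral_cong[OF refl])
       (simp add: space_face[OF F] average_coefficient[OF v F _ a(1)] power_mult_distrib, simp add: power2_norm_eq_inner)
  have nn3: "0 \<le> (\<Sum>F\<in>\<F>. hF F / \<eta> * (L2norm (face_measure F) (average \<T> F (\<lambda>z. a z *\<^sub>R grad v z)))\<^sup>2)"
    using \<eta> face_size_pos by (intro sum_nonneg mult_nonneg_nonneg) (auto simp: less_imp_le)
  have split: "(\<integral>x. star_dens a \<eta> v F x \<partial>face_measure F) = (\<integral>x. \<eta> / hF F * (J F v x \<bullet> J F v x) \<partial>face_measure F)
      + (\<integral>x. hF F / \<eta> * ((a x)\<^sup>2 * (S F v x \<bullet> S F v x)) \<partial>face_measure F)" if F: "F \<in> \<F>" for F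
    unfolding star_dens_def
    by (rule Bochner_Integration.integral_add; rule face_integrable_mesh[OF F];
        intro continuous_on_const continuous_on_mult continuous_on_power continuous_on_inner
          jump_continuous average_continuous v F face_continuous[OF F a(1)])
  have star: "(DG_norm_star \<T> a \<eta> v)\<^sup>2 = (DG_norm \<T> a \<eta> v)\<^sup>2 +
      (\<Sum>F\<in>\<F>. hF F / \<eta> * (L2norm (face_measure F) (average \<T> F (\<lambda>z. a z *\<^sub>R grad v z)))\<^sup>2)"
    unfolding DG_norm_star_def by (rule real_sqrt_pow2[OF add_nonneg_nonneg[OF _ nn3]]) simp
  have "(\<Sum>F\<in>\<F>. \<integral>x. star_dens a \<eta> v F x \<partial>face_measure F) = (\<Sum>F\<in>\<F>. \<integral>x. \<eta> / hF F * (J F v x \<bullet> J F v x) \<partial>face_measure F)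
      + (\<Sum>F\<in>\<F>. hF F / \<eta> * (L2norm (face_measure F) (average \<T> F (\<lambda>z. a z *\<^sub>R grad v z)))\<^sup>2)"
    unfolding sum.distrib[symmetric] by (rule sum.cong[OF refl]) (simp only: 3 split)
  then show "(DG_norm_star \<T> a \<eta> v)\<^sup>2 = Phi (vol_dens a v v) (star_dens a \<eta> v)"
    unfolding star * Phi_def by (simp only: add.assoc)
qed

section \<open>Bilinearity of the form and linearity in coefficient and penalty\<close>

definition is_combination :: "'i set \<Rightarrow> ('i \<Rightarrow> real) \<Rightarrow> ('i \<Rightarrow> 'a \<Rightarrow> real) \<Rightarrow> ('a \<Rightarrow> real) \<Rightarrow> bool" where
  "is_combination Q c \<phi> w \<longleftrightarrow> finite Q \<and> (\<forall>q\<in>Q. \<phi> q \<in> V) \<and>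
     (\<forall>T\<in>\<T>. \<forall>x\<in>interior T. w x = (\<Sum>q\<in>Q. c q * \<phi> q x))"

lemma combination:
  assumes "is_combination Q c \<phi> w"
  shows "finite Q" "\<And>q. q \<in> Q \<Longrightarrow> \<phi> q \<in> V" "w \<in> V"
    "\<And>T x. T \<in> \<T> \<Longrightarrow> x \<in> T \<Longrightarrow> interior_trace T w x = (\<Sum>q\<in>Q. c q * interior_trace T (\<phi> q) x)"
    "\<And>T x. T \<in> \<T> \<Longrightarrow> x \<in> T \<Longrightarrow> gtr T w x = (\<Sum>q\<in>Q. c q *\<^sub>R gtr T (\<phi> q) x)"
proof -
  show v: "\<phi> q \<in> V" if "q \<in> Q" for q using assms that by (auto simp: is_combination_def)
  have w: "w x = (\<Sum>q\<in>Q. c q * \<phi> q x)" if "T \<in> \<T>" "x \<in> interior T" for T x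
    using assms that by (auto simp: is_combination_def)
  have f: "finite Q" using assms by (simp add: is_combination_def)
  show "finite Q" by fact
  show "w \<in> V" by (rule DG_space_combination(1)[of Q \<phi>]) (use f v w in auto)
  fix T x assume "T \<in> \<T>" "x \<in> T"
  then show "interior_trace T w x = (\<Sum>q\<in>Q. c q * interior_trace T (\<phi> q) x)"
    "gtr T w x = (\<Sum>q\<in>Q. c q *\<^sub>R gtr T (\<phi> q) x)"
    using DG_space_combination(2,3)[of Q \<phi> w c T x] f v w by blast+
qed

lemma jump_combination:
  assumes comb: "is_combination Q c \<phi> w"
    and F: "F \<in> \<F>" "x \<in> F"
  shows "J F w x = (\<Sum>q\<in>Q. c q *\<^sub>R J F (\<phi> q) x)" "S F w x = (\<Sum>q\<in>Q. c q *\<^sub>R S F (\<phi> q) x)"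
proof -
  have "J F w x = (\<Sum>T\<in>face_elements \<T> F. \<Sum>q\<in>Q. c q *\<^sub>R (interior_trace T (\<phi> q) x *\<^sub>R face_normal T F))"
    unfolding jump_def
    using combination(4)[OF comb] face_elements[OF F(1)] F(2)
    by (intro sum.cong refl) (simp add: scaleR_sum_left)
  then show "J F w x = (\<Sum>q\<in>Q. c q *\<^sub>R J F (\<phi> q) x)"
    unfolding jump_def scaleR_sum_right by (subst sum.swap)
  have "(\<Sum>T\<in>face_elements \<T> F. gtr T w x) = (\<Sum>T\<in>face_elements \<T> F. \<Sum>q\<in>Q. c q *\<^sub>R gtr T (\<phi> q) x)"
    using combination(5)[OF comb] face_elements[OF F(1)] F(2)
    by (intro sum.cong refl) simp
  also have "\<dots> = (\<Sum>q\<in>Q. c q *\<^sub>R (\<Sum>T\<in>face_elements \<T> F. gtr T (\<phi> q) x))"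
    unfolding scaleR_sum_right by (rule sum.swap)
  finally show "S F w x = (\<Sum>q\<in>Q. c q *\<^sub>R S F (\<phi> q) x)"
    unfolding average_def by (simp add: scaleR_sum_right mult.commute)
qed

lemma DG_form_left_combination:
  assumes comb: "is_combination Q c \<phi> w"
    and v: "v \<in> V" and b: "continuous_on (closure D) b"
  shows "DG_form \<theta> \<T> b e w v = (\<Sum>q\<in>Q. c q * DG_form \<theta> \<T> b e (\<phi> q) v)"
proof -
  have "DG_form \<theta> \<T> b e w v = Phi (\<lambda>T x. \<Sum>q\<in>Q. c q * vol_dens b (\<phi> q) v T x) (\<lambda>F x. \<Sum>q\<in>Q. c q * face_dens \<theta> b e (\<phi> q) v F x)"
  proof (subst DG_form_Phi[OF _ v b], rule combination(3)[OF comb], rule Phi_cong)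
    fix T x assume "T \<in> \<T>" "x \<in> T"
    then show "vol_dens b w v T x = (\<Sum>q\<in>Q. c q * vol_dens b (\<phi> q) v T x)"
      by (simp add: vol_dens_def combination(5)[OF comb] inner_sum_left sum_distrib_left mult_ac)
  next
    fix F x assume "F \<in> \<F>" "x \<in> F"
    then show "face_dens \<theta> b e w v F x = (\<Sum>q\<in>Q. c q * face_dens \<theta> b e (\<phi> q) v F x)"
      by (simp add: face_dens_def jump_combination[OF comb] inner_sum_left inner_sum_right sum_distrib_left
          algebra_simps sum.distrib sum_subtractf)
  qed
  also have "\<dots> = (\<Sum>q\<in>Q. c q * Phi (vol_dens b (\<phi> q) v) (face_dens \<theta> b e (\<phi> q) v))"
    by (rule Phi_sum[OF combination(1)[OF comb] dens_continuous(1)[OF combination(2)[OF comb] v b]])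
  finally show ?thesis using DG_form_Phi[OF combination(2)[OF comb] v b] by simp
qed

lemma DG_form_right_combination:
  assumes comb: "is_combination Q c \<phi> w"
    and v: "v \<in> V" and b: "continuous_on (closure D) b"
  shows "DG_form \<theta> \<T> b e v w = (\<Sum>q\<in>Q. c q * DG_form \<theta> \<T> b e v (\<phi> q))"
proof -
  have "DG_form \<theta> \<T> b e v w = Phi (\<lambda>T x. \<Sum>q\<in>Q. c q * vol_dens b v (\<phi> q) T x) (\<lambda>F x. \<Sum>q\<in>Q. c q * face_dens \<theta> b e v (\<phi> q) F x)"
  proof (subst DG_form_Phi[OF v _ b], rule combination(3)[OF comb], rule Phi_cong)
    fix T x assume "T \<in> \<T>" "x \<in> T"
    then show "vol_dens b v w T x = (\<Sum>q\<in>Q. c q * vol_dens b v (\<phi> q) T x)"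
      by (simp add: vol_dens_def combination(5)[OF comb] inner_sum_right sum_distrib_left mult_ac)
  next
    fix F x assume "F \<in> \<F>" "x \<in> F"
    then show "face_dens \<theta> b e v w F x = (\<Sum>q\<in>Q. c q * face_dens \<theta> b e v (\<phi> q) F x)"
      by (simp add: face_dens_def jump_combination[OF comb] inner_sum_left inner_sum_right sum_distrib_left
          algebra_simps sum.distrib sum_subtractf)
  qed
  also have "\<dots> = (\<Sum>q\<in>Q. c q * Phi (vol_dens b v (\<phi> q)) (face_dens \<theta> b e v (\<phi> q)))"
    by (rule Phi_sum[OF combination(1)[OF comb] dens_continuous(1)[OF v combination(2)[OF comb] b]])
  finally show ?thesis using DG_form_Phi[OF v combination(2)[OF comb] b] by simp
qed

text \<open>Used with s = t - y_j to turn difference quotients of coefficient and penalty into those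
  of the form, and with s = -1 to compare two forms.\<close>

lemma DG_form_coeff_add_scaled:
  assumes w: "w \<in> V" and v: "v \<in> V" and b: "continuous_on (closure D) b" "continuous_on (closure D) b'"
    and b'': "\<And>x. x \<in> closure D \<Longrightarrow> b'' x = b x + s * b' x"
  shows "DG_form \<theta> \<T> b'' (e + s * e') w v = DG_form \<theta> \<T> b e w v + s * DG_form \<theta> \<T> b' e' w v"
proof -
  have "continuous_on (closure D) (\<lambda>x. b x + s * b' x)" by (intro continuous_intros b)
  then have c: "continuous_on (closure D) b''" using b'' by (simp cong: continuous_on_cong)
  have "DG_form \<theta> \<T> b'' (e + s * e') w v =
      Phi (\<lambda>T x. vol_dens b w v T x + s * vol_dens b' w v T x) (\<lambda>F x. face_dens \<theta> b e w v F x + s * face_dens \<theta> b' e' w v F x)"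
    unfolding DG_form_Phi[OF w v c]
  proof (rule Phi_cong)
    fix T x assume "T \<in> \<T>" "x \<in> T"
    then have "x \<in> closure D" using element(8) by blast
    then show "vol_dens b'' w v T x = vol_dens b w v T x + s * vol_dens b' w v T x"
      by (simp add: vol_dens_def b'' algebra_simps)
  next
    fix F x assume "F \<in> \<F>" "x \<in> F"
    then have "x \<in> closure D" using face_subset_closure by blast
    then show "face_dens \<theta> b'' (e + s * e') w v F x = face_dens \<theta> b e w v F x + s * face_dens \<theta> b' e' w v F x"
      by (simp add: face_dens_def b'' algebra_simps add_divide_distrib)
  qed
  also have "\<dots> = DG_form \<theta> \<T> b e w v + s * DG_form \<theta> \<T> b' e' w v"
    unfolding DG_form_Phi[OF w v b(1)] DG_form_Phi[OF w v b(2)]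
    by (rule Phi_add_scaled[OF dens_continuous(1)[OF w v b(1)] dens_continuous(1)[OF w v b(2)]])
  finally show ?thesis .
qed

end

section \<open>Continuity and coercivity\<close>

context dg_mesh
begin

text \<open>Each consistency term pairs the jump of one argument with the averaged flux of the
  other, which is why the star norm appears. Young's inequality with a common weight s bounds every
  density by the star densities, and s is optimised only after integration.\<close>

lemma DG_form_bound:
  assumes w: "w \<in> V" and v: "v \<in> V" and b: "continuous_on (closure D) b" and a: "continuous_on (closure D) a"
    and pos: "\<And>x. x \<in> closure D \<Longrightarrow> 0 < a x" "0 < \<eta>"
    and M: "\<And>x. x \<in> closure D \<Longrightarrow> \<bar>b x\<bar> \<le> M * a x" "0 \<le> M" and M': "\<bar>e\<bar> \<le> M' * \<eta>" "0 \<le> M'"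
    and \<theta>: "\<bar>\<theta>\<bar> \<le> 1"
  shows "\<bar>DG_form \<theta> \<T> b e w v\<bar> \<le> (M + M') * DG_norm_star \<T> a \<eta> w * DG_norm_star \<T> a \<eta> v"
proof (rule le_geometric_mean_of_scaled_sums)
  show "0 \<le> M + M'" using M M' by simp
  have nn: "DG_norm_star \<T> a \<eta> u \<ge> 0" for u
    unfolding DG_norm_star_def using pos(2) face_size_pos
    by (intro real_sqrt_ge_zero add_nonneg_nonneg sum_nonneg mult_nonneg_nonneg) (auto simp: less_imp_le)
  show "0 \<le> DG_norm_star \<T> a \<eta> w" "0 \<le> DG_norm_star \<T> a \<eta> v" by (rule nn)+
  have a0: "\<And>x. x \<in> closure D \<Longrightarrow> 0 \<le> a x" using pos(1) less_imp_le by blast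
  fix s :: real assume s: "s > 0"
  \<comment> \<open>Half of M + M': the half comes from Young's inequality.\<close>
  define K where "K = (M + M') / 2"
  have K: "K \<ge> 0" using M M' by (simp add: K_def)
  have c: "mesh_continuous (vol_dens a w w) (star_dens a \<eta> w)" "mesh_continuous (vol_dens a v v) (star_dens a \<eta> v)"
    using dens_continuous(2) w v a by blast+
  have cs: "mesh_continuous (\<lambda>T x. (K * s) * vol_dens a w w T x) (\<lambda>F x. (K * s) * star_dens a \<eta> w F x)"
    using c(1) unfolding mesh_continuous_def by (auto intro!: continuous_on_mult continuous_on_const)
  have cc: "mesh_continuous (\<lambda>T x. (K * s) * vol_dens a w w T x + K / s * vol_dens a v v T x)
      (\<lambda>F x. (K * s) * star_dens a \<eta> w F x + K / s * star_dens a \<eta> v F x)"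
    using c unfolding mesh_continuous_def
    by (intro conjI ballI continuous_on_add continuous_on_mult continuous_on_const) auto
  have "\<bar>DG_form \<theta> \<T> b e w v\<bar> \<le> Phi (\<lambda>T x. (K * s) * vol_dens a w w T x + K / s * vol_dens a v v T x)
      (\<lambda>F x. (K * s) * star_dens a \<eta> w F x + K / s * star_dens a \<eta> v F x)"
    unfolding DG_form_Phi[OF w v b]
  proof (rule Phi_abs_le[OF dens_continuous(1)[OF w v b] cc])
    fix T x assume T: "T \<in> \<T>" "x \<in> T"
    then have x: "x \<in> closure D" using element(8) by blast
    let ?g = "gtr T w x" and ?h = "gtr T v x"
    have "\<bar>b x * (?g \<bullet> ?h)\<bar> \<le> ((M + M') * a x) * ((s * (?g \<bullet> ?g) + (?h \<bullet> ?h) / s) / 2)"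
      unfolding abs_mult
    proof (rule mult_mono[OF _ young_inner[OF s]])
      show "\<bar>b x\<bar> \<le> (M + M') * a x"
        using M(1)[OF x] mult_nonneg_nonneg[OF M'(2) a0[OF x]] by (simp add: distrib_right)
    qed (use M M' a0[OF x] in auto)
    also have "\<dots> = (K * s) * (a x * (?g \<bullet> ?g)) + K / s * (a x * (?h \<bullet> ?h))"
      using s by (simp add: K_def field_simps)
    finally show "\<bar>vol_dens b w v T x\<bar> \<le> (K * s) * vol_dens a w w T x + K / s * vol_dens a v v T x"
      by (simp only: vol_dens_def)
  next
    fix F x assume F: "F \<in> \<F>" "x \<in> F"
    then have x: "x \<in> closure D" using face_subset_closure by blast
    have h: "hF F > 0" using face_size_pos F by blast
    define r where "r = \<eta> / hF F"
    have r: "r > 0" "hF F / \<eta> = 1 / r" using h pos by (auto simp: r_def)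
    let ?Jw = "J F w x" and ?Jv = "J F v x" and ?Sw = "S F w x" and ?Sv = "S F v x"
    define A B A' B' where "A = r * (?Jw \<bullet> ?Jw)" and "B = 1 / r * ((a x)\<^sup>2 * (?Sw \<bullet> ?Sw))"
      and "A' = r * (?Jv \<bullet> ?Jv)" and "B' = 1 / r * ((a x)\<^sup>2 * (?Sv \<bullet> ?Sv))"
    have nnA: "A \<ge> 0" "B \<ge> 0" "A' \<ge> 0" "B' \<ge> 0" using r by (auto simp: A_def B_def A'_def B'_def)
    have ax: "a x > 0" using pos(1)[OF x] .
    \<comment> \<open>The weight \<open>s * r\<close> turns the jump into \<open>A\<close> and the
      flux into \<open>B'\<close>; for the mirrored term below, \<open>s / r\<close> does the same
      with the roles exchanged.\<close>
    have "a x * \<bar>?Sv \<bullet> ?Jw\<bar> = \<bar>?Jw \<bullet> (a x *\<^sub>R ?Sv)\<bar>" using ax by (simp add: abs_mult inner_commute)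
    also have "\<dots> \<le> (s * A + B' / s) / 2"
      using young_inner[of "s * r" ?Jw "a x *\<^sub>R ?Sv"] s r by (simp add: A_def B'_def power2_eq_square mult_ac)
    finally have t1: "a x * \<bar>?Sv \<bullet> ?Jw\<bar> \<le> (s * A + B' / s) / 2" .
    have "a x * \<bar>?Sw \<bullet> ?Jv\<bar> = \<bar>(a x *\<^sub>R ?Sw) \<bullet> ?Jv\<bar>" using ax by (simp add: abs_mult)
    also have "\<dots> \<le> (s * B + A' / s) / 2"
      using young_inner[of "s / r" "a x *\<^sub>R ?Sw" ?Jv] s r by (simp add: B_def A'_def power2_eq_square mult_ac)
    finally have t2: "a x * \<bar>?Sw \<bullet> ?Jv\<bar> \<le> (s * B + A' / s) / 2" .
    have t3: "r * \<bar>?Jw \<bullet> ?Jv\<bar> \<le> (s * A + A' / s) / 2"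
    proof -
      have "r * \<bar>?Jw \<bullet> ?Jv\<bar> \<le> r * ((s * (?Jw \<bullet> ?Jw) + (?Jv \<bullet> ?Jv) / s) / 2)"
        by (rule mult_left_mono[OF young_inner[OF s]]) (use r in simp)
      also have "\<dots> = (s * A + A' / s) / 2" by (simp add: A_def A'_def algebra_simps)
      finally show ?thesis .
    qed
    have "\<bar>p - q + r\<bar> \<le> \<bar>p\<bar> + \<bar>q\<bar> + \<bar>r\<bar>" for p q r :: real by linarith
    then have "\<bar>face_dens \<theta> b e w v F x\<bar> \<le> \<bar>\<theta> * (b x * (?Sv \<bullet> ?Jw))\<bar> + \<bar>b x * (?Sw \<bullet> ?Jv)\<bar> + \<bar>e / hF F * (?Jw \<bullet> ?Jv)\<bar>"
      unfolding face_dens_def .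
    also have "\<bar>\<theta> * (b x * (?Sv \<bullet> ?Jw))\<bar> \<le> M * (a x * \<bar>?Sv \<bullet> ?Jw\<bar>)"
    proof -
      have "\<bar>\<theta>\<bar> * (\<bar>b x\<bar> * \<bar>?Sv \<bullet> ?Jw\<bar>) \<le> 1 * ((M * a x) * \<bar>?Sv \<bullet> ?Jw\<bar>)"
        by (intro mult_mono \<theta> mult_right_mono M x) auto
      then show ?thesis by (simp add: abs_mult mult.assoc)
    qed
    also have "\<bar>b x * (?Sw \<bullet> ?Jv)\<bar> \<le> M * (a x * \<bar>?Sw \<bullet> ?Jv\<bar>)"
      using mult_right_mono[OF M(1)[OF x], of "\<bar>?Sw \<bullet> ?Jv\<bar>"] by (simp add: abs_mult mult.assoc)
    also have "\<bar>e / hF F * (?Jw \<bullet> ?Jv)\<bar> \<le> M' * (r * \<bar>?Jw \<bullet> ?Jv\<bar>)"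
    proof -
      have "\<bar>e\<bar> / hF F \<le> M' * r" using M'(1) h by (simp add: r_def divide_right_mono)
      from mult_right_mono[OF this, of "\<bar>?Jw \<bullet> ?Jv\<bar>"] show ?thesis using h by (simp add: abs_mult mult.assoc)
    qed
    also have "M * (a x * \<bar>?Sv \<bullet> ?Jw\<bar>) \<le> M * ((s * A + B' / s) / 2)" by (rule mult_left_mono[OF t1 M(2)])
    also have "M * (a x * \<bar>?Sw \<bullet> ?Jv\<bar>) \<le> M * ((s * B + A' / s) / 2)" by (rule mult_left_mono[OF t2 M(2)])
    \<comment> \<open>The penalty term involves jumps alone. It is enlarged by the flux terms so
      that M and M' multiply the same star densities.\<close>
    also have "M' * (r * \<bar>?Jw \<bullet> ?Jv\<bar>) \<le> M' * ((s * (A + B) + (A' + B') / s) / 2)"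
    proof (rule mult_left_mono[OF _ M'(2)])
      have "s * A \<le> s * (A + B)" "A' / s \<le> (A' + B') / s" using s nnA by (auto simp: divide_right_mono)
      from add_mono[OF this] show "r * \<bar>?Jw \<bullet> ?Jv\<bar> \<le> (s * (A + B) + (A' + B') / s) / 2"
        by (intro order_trans[OF t3] divide_right_mono) auto
    qed
    also have "M * ((s * A + B' / s) / 2) + M * ((s * B + A' / s) / 2) + M' * ((s * (A + B) + (A' + B') / s) / 2)
       = (K * s) * (A + B) + K / s * (A' + B')"
    proof -
      have gen: "M * ((x + y) / 2) + M * ((z + u) / 2) + M' * ((x + z + (u + y)) / 2) = K * (x + z) + K * (u + y)"
        for x y z u :: real by (simp add: K_def field_simps)
      have k: "K / s * (A' + B') = K * (A' / s + B' / s)" by (simp add: add_divide_distrib[symmetric])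
      show ?thesis
        unfolding k distrib_left[of s] add_divide_distrib[of _ _ s] mult.assoc by (simp only: gen)
    qed
    finally have "\<bar>face_dens \<theta> b e w v F x\<bar> \<le> (K * s) * (A + B) + K / s * (A' + B')" by simp
    then show "\<bar>face_dens \<theta> b e w v F x\<bar> \<le> (K * s) * star_dens a \<eta> w F x + K / s * star_dens a \<eta> v F x"
      unfolding star_dens_def r(2) r_def[symmetric] A_def B_def A'_def B'_def .
  qed
  also have "\<dots> = (K * s) * (DG_norm_star \<T> a \<eta> w)\<^sup>2 + K / s * (DG_norm_star \<T> a \<eta> v)\<^sup>2"
  proof -
    have n: "(DG_norm_star \<T> a \<eta> u)\<^sup>2 = Phi (vol_dens a u u) (star_dens a \<eta> u)" if "u \<in> V" for u
      by (rule DG_norm_Phi(2)[OF that a _ pos(2)]) (rule a0)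
    show ?thesis unfolding n[OF w] n[OF v] Phi_scale[OF c(1), symmetric] by (rule Phi_add_scaled[OF cs c(2)])
  qed
  also have "\<dots> = (M + M') * (s * (DG_norm_star \<T> a \<eta> w)\<^sup>2 + (DG_norm_star \<T> a \<eta> v)\<^sup>2 / s) / 2"
    using s by (simp add: K_def field_simps)
  finally show "\<bar>DG_form \<theta> \<T> b e w v\<bar> \<le> (M + M') * (s * (DG_norm_star \<T> a \<eta> w)\<^sup>2 + (DG_norm_star \<T> a \<eta> v)\<^sup>2 / s) / 2" .
qed

text \<open>Cauchy-Schwarz would even give the factor 1 / \<open>card A\<close>; bounding it by 1
  treats interior and boundary faces alike.\<close>

lemma average_square_le:
  fixes f :: "'b \<Rightarrow> 'a"
  assumes "finite A" "A \<noteq> {}"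
  shows "((\<Sum>i\<in>A. f i) /\<^sub>R real (card A)) \<bullet> ((\<Sum>i\<in>A. f i) /\<^sub>R real (card A)) \<le> (\<Sum>i\<in>A. f i \<bullet> f i)"
proof -
  define m where "m = real (card A)"
  have m: "m \<ge> 1" using assms by (simp add: m_def Suc_le_eq card_gt_0_iff)
  have "(norm (\<Sum>i\<in>A. f i))\<^sup>2 \<le> (\<Sum>i\<in>A. norm (f i))\<^sup>2" by (intro power_mono norm_sum) simp
  also have "\<dots> \<le> (\<Sum>i\<in>A. (norm (f i))\<^sup>2) * m"
    unfolding m_def by (rule sum_squared_le_sum_of_squares)
  also have "\<dots> \<le> (\<Sum>i\<in>A. (norm (f i))\<^sup>2) * m\<^sup>2"
    using m by (intro mult_left_mono sum_nonneg) (auto simp: power2_eq_square)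
  finally have "(norm (\<Sum>i\<in>A. f i))\<^sup>2 / m\<^sup>2 \<le> (\<Sum>i\<in>A. (norm (f i))\<^sup>2)" using m by (simp add: divide_le_eq)
  then have "(\<Sum>i\<in>A. f i) \<bullet> (\<Sum>i\<in>A. f i) / m\<^sup>2 \<le> (\<Sum>i\<in>A. f i \<bullet> f i)" unfolding power2_norm_eq_inner .
  moreover have "((\<Sum>i\<in>A. f i) /\<^sub>R m) \<bullet> ((\<Sum>i\<in>A. f i) /\<^sub>R m) = (\<Sum>i\<in>A. f i) \<bullet> (\<Sum>i\<in>A. f i) / m\<^sup>2"
    by (simp add: power2_eq_square divide_inverse mult_ac)
  ultimately show ?thesis unfolding m_def[symmetric] by simp
qed

text \<open>The trace inequality is scalar. It is applied to each component of the gradient, again a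
  member of \<open>V\<close>, and summed over the basis.\<close>

lemma trace_gradient:
  assumes v: "v \<in> V" and T: "T \<in> \<T>" and F: "F \<in> faces T" "F \<in> \<F>"
    and trace: "\<And>w. w \<in> V \<Longrightarrow> sqrt (diameter T) * L2norm (face_measure F) (interior_trace T w) \<le> C * L2norm (lebesgue_on T) w"
  shows "diameter T * (\<integral>x. gtr T v x \<bullet> gtr T v x \<partial>face_measure F) \<le> C\<^sup>2 * (\<integral>x. gtr T v x \<bullet> gtr T v x \<partial>lebesgue_on T)"
proof -
  have FT: "F \<subseteq> T" using compact_face(2)[OF element(2)[OF T] F(1)] .
  have c: "continuous_on T (\<lambda>x. (gtr T v x \<bullet> b)\<^sup>2)" for b
    by (intro continuous_on_power continuous_on_inner traceE(2)[OF v T] continuous_on_const)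
  have cF: "continuous_on F (\<lambda>x. (gtr T v x \<bullet> b)\<^sup>2)" for b using c FT by (rule continuous_on_subset)
  have d: "diameter T \<ge> 0" using element_diameter_pos[OF T] by simp
  have "diameter T * (\<integral>x. (gtr T v x \<bullet> b)\<^sup>2 \<partial>face_measure F) \<le> C\<^sup>2 * (\<integral>x. (gtr T v x \<bullet> b)\<^sup>2 \<partial>lebesgue_on T)"
    if b: "b \<in> Basis" for b
  proof -
    let ?w = "\<lambda>x. grad v x \<bullet> b"
    have "(sqrt (diameter T) * L2norm (face_measure F) (interior_trace T ?w))\<^sup>2 \<le> (C * L2norm (lebesgue_on T) ?w)\<^sup>2"
      by (rule power_mono[OF trace[OF grad_component_in_V[OF v b]]]) (simp add: L2norm_def d integral_nonneg_AE)
    then have "diameter T * (\<integral>x. (interior_trace T ?w x)\<^sup>2 \<partial>face_measure F) \<le> C\<^sup>2 * (\<integral>x. (?w x)\<^sup>2 \<partial>lebesgue_on T)"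
      by (simp add: power_mult_distrib L2norm_square d)
    also have "(\<integral>x. (interior_trace T ?w x)\<^sup>2 \<partial>face_measure F) = (\<integral>x. (gtr T v x \<bullet> b)\<^sup>2 \<partial>face_measure F)"
      by (rule Bochner_Integration.integral_cong[OF refl]) (use FT in \<open>auto simp: space_face[OF F(2)] traceE(7)[OF v T]\<close>)
    also have "(\<integral>x. (?w x)\<^sup>2 \<partial>lebesgue_on T) = (\<integral>x. (gtr T v x \<bullet> b)\<^sup>2 \<partial>lebesgue_on T)"
      by (rule element_integral_cong[OF T c]) (simp add: traceE(4)[OF v T])
    finally show ?thesis .
  qed
  then have "(\<Sum>b\<in>Basis. diameter T * (\<integral>x. (gtr T v x \<bullet> b)\<^sup>2 \<partial>face_measure F)) \<le>
     (\<Sum>b\<in>Basis. C\<^sup>2 * (\<integral>x. (gtr T v x \<bullet> b)\<^sup>2 \<partial>lebesgue_on T))"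
    by (rule sum_mono)
  moreover have "(\<Sum>b\<in>Basis. diameter T * (\<integral>x. (gtr T v x \<bullet> b)\<^sup>2 \<partial>face_measure F)) =
      diameter T * (\<integral>x. gtr T v x \<bullet> gtr T v x \<partial>face_measure F)"
    unfolding sum_distrib_left[symmetric] euclidean_inner[of "gtr T v _" "gtr T v _"] power2_eq_square[symmetric]
    by (subst Bochner_Integration.integral_sum) (use face_integrable_mesh[OF F(2) cF] in auto)
  moreover have "(\<Sum>b\<in>Basis. C\<^sup>2 * (\<integral>x. (gtr T v x \<bullet> b)\<^sup>2 \<partial>lebesgue_on T)) =
      C\<^sup>2 * (\<integral>x. gtr T v x \<bullet> gtr T v x \<partial>lebesgue_on T)"
    unfolding sum_distrib_left[symmetric] euclidean_inner[of "gtr T v _" "gtr T v _"] power2_eq_square[symmetric]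
    by (subst Bochner_Integration.integral_sum) (use element_integrable[OF T c] in auto)
  ultimately show ?thesis by simp
qed

text \<open>After exchanging the sums over faces and elements, each element is counted once per
  face; this is how the maximal number of faces enters the penalty condition.\<close>

lemma average_gradient_bound:
  assumes v: "v \<in> V"
    and trace: "\<And>w T F. w \<in> V \<Longrightarrow> T \<in> \<T> \<Longrightarrow> F \<in> faces T \<Longrightarrow>
      sqrt (diameter T) * L2norm (face_measure F) (interior_trace T w) \<le> C * L2norm (lebesgue_on T) w"
  shows "(\<Sum>F\<in>\<F>. hF F * (\<integral>x. S F v x \<bullet> S F v x \<partial>face_measure F)) \<le>
    C\<^sup>2 * real (max_faces \<T>) * (\<Sum>T\<in>\<T>. \<integral>x. gtr T v x \<bullet> gtr T v x \<partial>lebesgue_on T)"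
proof -
  define I where "I T = (\<integral>x. gtr T v x \<bullet> gtr T v x \<partial>lebesgue_on T)" for T
  have I: "I T \<ge> 0" for T unfolding I_def by (simp add: integral_nonneg_AE)
  have "hF F * (\<integral>x. S F v x \<bullet> S F v x \<partial>face_measure F) \<le> (\<Sum>T\<in>face_elements \<T> F. C\<^sup>2 * I T)"
    if F: "F \<in> \<F>" for F
  proof -
    note fe = face_elements[OF F]
    have cg: "continuous_on F (\<lambda>x. gtr T v x \<bullet> gtr T v x)" if "T \<in> face_elements \<T> F" for T
      by (rule continuous_on_subset[of T], intro continuous_on_inner traceE(2)[OF v]) (use fe that in auto)
    have "(\<integral>x. S F v x \<bullet> S F v x \<partial>face_measure F) \<le> (\<integral>x. (\<Sum>T\<in>face_elements \<T> F. gtr T v x \<bullet> gtr T v x) \<partial>face_measure F)"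
    proof (rule integral_mono)
      show "integrable (face_measure F) (\<lambda>x. S F v x \<bullet> S F v x)"
        by (intro face_integrable_mesh[OF F] continuous_on_inner average_continuous v F)
      show "integrable (face_measure F) (\<lambda>x. \<Sum>T\<in>face_elements \<T> F. gtr T v x \<bullet> gtr T v x)"
        by (intro face_integrable_mesh[OF F] continuous_on_sum cg)
      show "S F v x \<bullet> S F v x \<le> (\<Sum>T\<in>face_elements \<T> F. gtr T v x \<bullet> gtr T v x)" for x
        unfolding average_def by (rule average_square_le[OF fe(1,2)])
    qed
    also have "\<dots> = (\<Sum>T\<in>face_elements \<T> F. \<integral>x. gtr T v x \<bullet> gtr T v x \<partial>face_measure F)"
      by (rule Bochner_Integration.integral_sum) (intro face_integrable_mesh[OF F] cg)
    finally have "hF F * (\<integral>x. S F v x \<bullet> S F v x \<partial>face_measure F) \<le>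
      hF F * (\<Sum>T\<in>face_elements \<T> F. \<integral>x. gtr T v x \<bullet> gtr T v x \<partial>face_measure F)"
      by (rule mult_left_mono) (use face_size_pos[OF F] in simp)
    also have "\<dots> \<le> (\<Sum>T\<in>face_elements \<T> F. C\<^sup>2 * I T)"
      unfolding sum_distrib_left
    proof (rule sum_mono)
      fix T assume T: "T \<in> face_elements \<T> F"
      have "hF F * (\<integral>x. gtr T v x \<bullet> gtr T v x \<partial>face_measure F) \<le> diameter T * (\<integral>x. gtr T v x \<bullet> gtr T v x \<partial>face_measure F)"
        by (rule mult_right_mono[OF face_size_le_diameter[OF F T]]) (simp add: integral_nonneg_AE)
      also have "\<dots> \<le> C\<^sup>2 * I T"
        unfolding I_def by (rule trace_gradient[OF v fe(3)[OF T] fe(4)[OF T] F]) (use trace fe T in blast)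
      finally show "hF F * (\<integral>x. gtr T v x \<bullet> gtr T v x \<partial>face_measure F) \<le> C\<^sup>2 * I T" .
    qed
    finally show ?thesis .
  qed
  then have "(\<Sum>F\<in>\<F>. hF F * (\<integral>x. S F v x \<bullet> S F v x \<partial>face_measure F)) \<le> (\<Sum>F\<in>\<F>. \<Sum>T\<in>{T\<in>\<T>. F \<in> faces T}. C\<^sup>2 * I T)"
    unfolding face_elements_def by (rule sum_mono)
  also have "\<dots> = (\<Sum>T\<in>\<T>. \<Sum>F\<in>{F\<in>\<F>. F \<in> faces T}. C\<^sup>2 * I T)"
    by (rule sum.swap_restrict[OF finite_faces finite_mesh])
  also have "\<dots> \<le> (\<Sum>T\<in>\<T>. real (max_faces \<T>) * (C\<^sup>2 * I T))"
  proof (rule sum_mono)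
    fix T assume T: "T \<in> \<T>"
    have "{F\<in>\<F>. F \<in> faces T} = faces T" using T by (auto simp: mesh_faces_def)
    moreover have "card (faces T) \<le> max_faces \<T>"
      unfolding max_faces_def using finite_mesh T by (intro Max_ge) auto
    ultimately show "(\<Sum>F\<in>{F\<in>\<F>. F \<in> faces T}. C\<^sup>2 * I T) \<le> real (max_faces \<T>) * (C\<^sup>2 * I T)"
      using I[of T] by (auto intro!: mult_right_mono)
  qed
  also have "\<dots> = C\<^sup>2 * real (max_faces \<T>) * (\<Sum>T\<in>\<T>. I T)"
    unfolding sum_distrib_left by (simp add: mult_ac)
  finally show ?thesis unfolding I_def .
qed

text \<open>For \<theta> = 1 the two consistency terms cancel on the diagonal. This is the origin of
  the constant 1 for NIPDG.\<close>

lemma DG_form_symmetric_part: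
  assumes v: "v \<in> V" and a: "continuous_on (closure D) a" "\<And>x. x \<in> closure D \<Longrightarrow> 0 < a x" and \<eta>: "\<eta> > 0"
  shows "DG_form 1 \<T> a \<eta> v v = (DG_norm \<T> a \<eta> v)\<^sup>2"
proof -
  have norm: "(DG_norm \<T> a \<eta> v)\<^sup>2 = Phi (vol_dens a v v) (\<lambda>F x. \<eta> / hF F * (J F v x \<bullet> J F v x))"
    by (rule DG_norm_Phi(1)[OF v a(1) _ \<eta>]) (use a(2) less_imp_le in blast)
  show ?thesis
    unfolding DG_form_Phi[OF v v a(1)] norm by (rule Phi_cong) (simp_all add: face_dens_def)
qed

lemma DG_form_coercive:
  assumes v: "v \<in> V" and a: "continuous_on (closure D) a"
    and bounds: "\<And>x. x \<in> closure D \<Longrightarrow> a\<^sub>0 \<le> a x" "\<And>x. x \<in> closure D \<Longrightarrow> a x \<le> a\<^sub>1" "0 < a\<^sub>0"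
    and \<eta>: "\<eta> > 0" and \<tau>: "\<tau> > 1"
    and trace: "\<And>w T F. w \<in> V \<Longrightarrow> T \<in> \<T> \<Longrightarrow> F \<in> faces T \<Longrightarrow>
      sqrt (diameter T) * L2norm (face_measure F) (interior_trace T w) \<le> C * L2norm (lebesgue_on T) w"
    and penalty: "\<eta> \<ge> \<tau> * (a\<^sub>1\<^sup>2 * C\<^sup>2 * real (max_faces \<T>) * (\<theta> - 1)\<^sup>2 / (4 * a\<^sub>0))"
  shows "(1 - 1 / sqrt \<tau>) * (DG_norm \<T> a \<eta> v)\<^sup>2 \<le> DG_form \<theta> \<T> a \<eta> v v"
proof -
  \<comment> \<open>The fraction of the energy given away. With sigma^2 tau = 1 the loss in the jump
    part and the loss in the volume part coincide.\<close>
  define \<sigma> where "\<sigma> = 1 / sqrt \<tau>"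
  have \<sigma>: "\<sigma> > 0" "\<sigma> * \<sigma> * \<tau> = 1" using \<tau> by (auto simp: \<sigma>_def)
  \<comment> \<open>The factor that Young's inequality leaves in front of the averaged gradients,
    with \<open>a x\<close> replaced by its upper bound.\<close>
  define c where "c = (\<theta> - 1)\<^sup>2 * a\<^sub>1\<^sup>2 / (4 * \<sigma> * \<eta>)"
  have c: "c \<ge> 0" using \<sigma> \<eta> by (simp add: c_def)
  have apos: "\<And>x. x \<in> closure D \<Longrightarrow> 0 < a x" using bounds by (meson less_le_trans)
  define W where "W = (\<Sum>T\<in>\<T>. integral\<^sup>L (lebesgue_on T) (vol_dens a v v T))"
  define Jt where "Jt = (\<Sum>F\<in>\<F>. \<integral>x. \<eta> / hF F * (J F v x \<bullet> J F v x) \<partial>face_measure F)"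
  have norm: "(DG_norm \<T> a \<eta> v)\<^sup>2 = W + Jt"
    using DG_norm_Phi(1)[OF v a _ \<eta>] less_imp_le[OF apos] unfolding Phi_def W_def Jt_def by blast
  have face: "(1 - \<sigma>) * (\<integral>x. \<eta> / hF F * (J F v x \<bullet> J F v x) \<partial>face_measure F) - c * (hF F * (\<integral>x. S F v x \<bullet> S F v x \<partial>face_measure F))
      \<le> integral\<^sup>L (face_measure F) (face_dens \<theta> a \<eta> v v F)" if F: "F \<in> \<F>" for F
  proof -
    have h: "hF F > 0" by (rule face_size_pos[OF F])
    have iJ: "integrable (face_measure F) (\<lambda>x. \<eta> / hF F * (J F v x \<bullet> J F v x))"
      by (intro face_integrable_mesh[OF F] continuous_on_mult continuous_on_const continuous_on_inner jump_continuous v F)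
    have iS: "integrable (face_measure F) (\<lambda>x. S F v x \<bullet> S F v x)"
      by (intro face_integrable_mesh[OF F] continuous_on_inner average_continuous v F)
    have "(1 - \<sigma>) * (\<integral>x. \<eta> / hF F * (J F v x \<bullet> J F v x) \<partial>face_measure F) - c * (hF F * (\<integral>x. S F v x \<bullet> S F v x \<partial>face_measure F))
      = (\<integral>x. (1 - \<sigma>) * (\<eta> / hF F * (J F v x \<bullet> J F v x)) - (c * hF F) * (S F v x \<bullet> S F v x) \<partial>face_measure F)"
      by (subst Bochner_Integration.integral_diff)
         (use iJ iS in \<open>auto simp del: times_divide_eq_left intro!: integrable_mult_right\<close>)
    also have "\<dots> \<le> integral\<^sup>L (face_measure F) (face_dens \<theta> a \<eta> v v F)"
    proof (rule integral_mono)
      show "integrable (face_measure F) (\<lambda>x. (1 - \<sigma>) * (\<eta> / hF F * (J F v x \<bullet> J F v x)) - (c * hF F) * (S F v x \<bullet> S F v x))"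
        by (intro Bochner_Integration.integrable_diff integrable_mult_right iJ iS)
      show "integrable (face_measure F) (face_dens \<theta> a \<eta> v v F)"
        using dens_continuous(1)[OF v v a] F by (intro face_integrable_mesh) (auto simp: mesh_continuous_def)
      fix x assume "x \<in> space (face_measure F)"
      then have x: "x \<in> closure D" using space_face[OF F] face_subset_closure[OF F] by blast
      let ?J = "J F v x" and ?S = "S F v x"
      \<comment> \<open>Chosen so that Young's inequality costs exactly the fraction
        \<open>\<sigma>\<close> of the penalty density.\<close>
      let ?t = "2 * \<sigma> * (\<eta> / hF F)"
      have t: "?t > 0" using \<sigma> \<eta> h by simp
      have "(a x)\<^sup>2 \<le> a\<^sub>1\<^sup>2" using bounds(2)[OF x] apos[OF x] by (intro power_mono) auto
      then have le: "((\<theta> - 1)\<^sup>2 * (a x)\<^sup>2 / (4 * \<sigma> * \<eta>)) * (hF F * (?S \<bullet> ?S)) \<le> c * (hF F * (?S \<bullet> ?S))"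
        unfolding c_def using h \<sigma> \<eta> by (intro mult_right_mono divide_right_mono mult_left_mono) auto
      have "\<bar>?J \<bullet> (q *\<^sub>R ?S)\<bar> \<le> \<sigma> * (\<eta> / hF F * (?J \<bullet> ?J)) + (q\<^sup>2 / (4 * \<sigma> * \<eta>)) * (hF F * (?S \<bullet> ?S))" for q
        using young_inner[OF t, of ?J "q *\<^sub>R ?S"] h \<eta> \<sigma>(1) by (simp add: field_simps power2_eq_square)
      from this[of "(\<theta> - 1) * a x"]
      have "\<bar>?J \<bullet> (((\<theta> - 1) * a x) *\<^sub>R ?S)\<bar> \<le> \<sigma> * (\<eta> / hF F * (?J \<bullet> ?J)) + ((\<theta> - 1)\<^sup>2 * (a x)\<^sup>2 / (4 * \<sigma> * \<eta>)) * (hF F * (?S \<bullet> ?S))"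
        by (simp only: power_mult_distrib)
      moreover have "?J \<bullet> (((\<theta> - 1) * a x) *\<^sub>R ?S) = \<theta> * (a x * (?S \<bullet> ?J)) - a x * (?S \<bullet> ?J)"
        by (simp add: inner_commute algebra_simps)
      ultimately have "- (\<sigma> * (\<eta> / hF F * (?J \<bullet> ?J)) + c * (hF F * (?S \<bullet> ?S))) \<le> \<theta> * (a x * (?S \<bullet> ?J)) - a x * (?S \<bullet> ?J)"
        using le by linarith
      then show "(1 - \<sigma>) * (\<eta> / hF F * (?J \<bullet> ?J)) - (c * hF F) * (?S \<bullet> ?S) \<le> face_dens \<theta> a \<eta> v v F x"
        unfolding face_dens_def left_diff_distrib[of 1 \<sigma>] mult_1 mult.assoc[of c] by linarith
    qed
    finally show ?thesis .
  qed
  have "(1 - \<sigma>) * Jt - c * (\<Sum>F\<in>\<F>. hF F * (\<integral>x. S F v x \<bullet> S F v x \<partial>face_measure F))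
     \<le> (\<Sum>F\<in>\<F>. integral\<^sup>L (face_measure F) (face_dens \<theta> a \<eta> v v F))"
    unfolding Jt_def sum_distrib_left sum_subtractf[symmetric] by (rule sum_mono[OF face])
  then have form: "W + (1 - \<sigma>) * Jt - c * (\<Sum>F\<in>\<F>. hF F * (\<integral>x. S F v x \<bullet> S F v x \<partial>face_measure F)) \<le> DG_form \<theta> \<T> a \<eta> v v"
    unfolding DG_form_Phi[OF v v a] Phi_def W_def by linarith
  define G where "G = (\<Sum>T\<in>\<T>. \<integral>x. gtr T v x \<bullet> gtr T v x \<partial>lebesgue_on T)"
  have GW: "a\<^sub>0 * G \<le> W"
    unfolding G_def W_def sum_distrib_left
  proof (rule sum_mono)
    fix T assume T: "T \<in> \<T>"
    have cg: "continuous_on T (\<lambda>x. gtr T v x \<bullet> gtr T v x)" by (intro continuous_on_inner traceE(2)[OF v T])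
    have "a\<^sub>0 * (\<integral>x. gtr T v x \<bullet> gtr T v x \<partial>lebesgue_on T) = (\<integral>x. a\<^sub>0 * (gtr T v x \<bullet> gtr T v x) \<partial>lebesgue_on T)" by simp
    also have "\<dots> \<le> integral\<^sup>L (lebesgue_on T) (vol_dens a v v T)"
    proof (rule integral_mono)
      show "integrable (lebesgue_on T) (\<lambda>x. a\<^sub>0 * (gtr T v x \<bullet> gtr T v x))"
        by (intro integrable_mult_right element_integrable[OF T cg])
      show "integrable (lebesgue_on T) (vol_dens a v v T)"
        using dens_continuous(1)[OF v v a] T by (intro element_integrable) (auto simp: mesh_continuous_def)
      fix x assume "x \<in> space (lebesgue_on T)"
      then have "x \<in> closure D" using element(8)[OF T] by auto
      then show "a\<^sub>0 * (gtr T v x \<bullet> gtr T v x) \<le> vol_dens a v v T x"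
        unfolding vol_dens_def using bounds(1) by (intro mult_right_mono) auto
    qed
    finally show "a\<^sub>0 * (\<integral>x. gtr T v x \<bullet> gtr T v x \<partial>lebesgue_on T) \<le> integral\<^sup>L (lebesgue_on T) (vol_dens a v v T)" .
  qed
  have G0: "G \<ge> 0" unfolding G_def by (intro sum_nonneg) (simp add: integral_nonneg_AE)
  have "c * (\<Sum>F\<in>\<F>. hF F * (\<integral>x. S F v x \<bullet> S F v x \<partial>face_measure F)) \<le> c * (C\<^sup>2 * real (max_faces \<T>) * G)"
    unfolding G_def by (intro mult_left_mono c average_gradient_bound v trace)
  also have "\<dots> \<le> \<sigma> * (a\<^sub>0 * G)"
  proof -
    \<comment> \<open>The penalty threshold without tau: it is at most
      \<open>\<eta> / \<tau>\<close>, that is \<open>\<sigma> * \<sigma> * \<eta>\<close>, which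
      leaves the fraction \<open>\<sigma>\<close> of the volume part.\<close>
    define X where "X = a\<^sub>1\<^sup>2 * C\<^sup>2 * real (max_faces \<T>) * (\<theta> - 1)\<^sup>2 / (4 * a\<^sub>0)"
    have "\<tau> * X \<le> \<eta>" using penalty by (simp add: X_def)
    then have "X \<le> \<sigma> * \<sigma> * \<eta>"
    proof -
      have "\<sigma> * \<sigma> * (\<tau> * X) \<le> \<sigma> * \<sigma> * \<eta>" using \<open>\<tau> * X \<le> \<eta>\<close> \<sigma>(1) by (intro mult_left_mono) auto
      moreover have "\<sigma> * \<sigma> * (\<tau> * X) = X" using \<sigma>(2) by (metis mult.assoc mult_1)
      ultimately show ?thesis by simp
    qed
    then have "X / (\<sigma> * \<eta>) \<le> \<sigma>" using \<sigma>(1) \<eta> by (simp add: divide_le_eq mult.assoc)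
    then have "X / (\<sigma> * \<eta>) * (a\<^sub>0 * G) \<le> \<sigma> * (a\<^sub>0 * G)" using G0 bounds(3) by (intro mult_right_mono) auto
    moreover have "c * (C\<^sup>2 * real (max_faces \<T>) * G) = X / (\<sigma> * \<eta>) * (a\<^sub>0 * G)"
      using bounds(3) by (simp add: c_def X_def field_simps)
    ultimately show ?thesis by simp
  qed
  also have "\<dots> \<le> \<sigma> * W" using GW \<sigma>(1) by (intro mult_left_mono) auto
  finally have "(1 - \<sigma>) * (W + Jt) \<le> DG_form \<theta> \<T> a \<eta> v v" using form by (simp add: algebra_simps)
  then show ?thesis unfolding norm \<sigma>_def .
qed

end

section \<open>The kernel of the energy norm\<close>

text \<open>The integrand vanishes almost everywhere, and the set of interior points where it does
  not is open; an open null set is empty.\<close>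

lemma continuous_nonneg_integral_zero:
  fixes g :: "'a::euclidean_space \<Rightarrow> real"
  assumes T: "compact T" and g: "continuous_on T g" "\<And>x. x \<in> T \<Longrightarrow> 0 \<le> g x"
    and zero: "integral\<^sup>L (lebesgue_on T) g = 0" and x: "x \<in> interior T"
  shows "g x = 0"
proof (rule ccontr)
  assume nz: "g x \<noteq> 0"
  have TL: "T \<in> sets lebesgue" using T by (simp add: lmeasurable_compact fmeasurableD)
  have "AE x in lebesgue_on T. 0 \<le> g x" by (rule AE_I2) (use g(2) in simp)
  then have "AE x in lebesgue_on T. g x = 0"
    using integral_nonneg_eq_0_iff_AE[OF compact_integrable[OF T g(1)]] zero by blast
  then have "AE x in lebesgue. x \<in> T \<longrightarrow> g x = 0"
    using TL by (simp add: AE_restrict_space_iff)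
  then have "{x \<in> space lebesgue. \<not> (x \<in> T \<longrightarrow> g x = 0)} \<in> null_sets lebesgue"
    by (rule completion.AE_iff_null_sets[THEN iffD1])
  then have N: "negligible {x. x \<in> T \<and> g x \<noteq> 0}" by (simp add: negligible_iff_null_sets)
  let ?O = "{y \<in> interior T. g y \<in> - {0}}"
  have "continuous_on (interior T) g" using g(1) interior_subset by (rule continuous_on_subset)
  then have "open ?O" using continuous_open_preimage[of "interior T" g "- {0}"] by (auto simp: vimage_def Int_def)
  moreover have "x \<in> ?O" using x nz by simp
  moreover have "negligible ?O"
    by (rule negligible_subset[OF N]) (use interior_subset in auto)
  ultimately show False using open_not_negligible by blast
qed

context dg_mesh
begin

text \<open>Both elements contain a common open half ball at z, so their interiors meet. Hence at
  most one element lies on each side of a face.\<close>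

lemma same_normal_same_element:
  assumes T: "T \<in> \<T>" "T' \<in> \<T>" and o: "outward_normal T z m" "outward_normal T' z m"
  shows "T = T'"
proof -
  obtain d where d: "d > 0" "\<And>w. dist z w < d \<Longrightarrow> w \<in> T \<longleftrightarrow> (w - z) \<bullet> m \<le> 0" using outward_normalE[OF o(1)] by blast
  obtain e where e: "e > 0" "\<And>w. dist z w < e \<Longrightarrow> w \<in> T' \<longleftrightarrow> (w - z) \<bullet> m \<le> 0" using outward_normalE[OF o(2)] by blast
  define r where "r = min d e"
  have r: "r > 0" "r \<le> d" "r \<le> e" using d e by (auto simp: r_def)
  have m: "norm m = 1" "m \<bullet> m = 1" using outward_normal_norm[OF o(1)] by (auto simp: norm_eq_1)
  let ?O = "ball z r \<inter> {w. m \<bullet> w < m \<bullet> z}"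
  have op: "open ?O" by (intro open_Int open_ball open_halfspace_lt)
  have "w \<in> T \<inter> T'" if "w \<in> ?O" for w
  proof -
    have "(w - z) \<bullet> m \<le> 0" using that inner_diff_plane(2)[of w z m] by simp
    then show ?thesis using d(2)[of w] e(2)[of w] that r by simp
  qed
  then have "?O \<subseteq> T" "?O \<subseteq> T'" by blast+
  then have "?O \<subseteq> interior T" "?O \<subseteq> interior T'" using op interior_maximal by blast+
  moreover have "z - (r / 2) *\<^sub>R m \<in> ?O" using r(1) m by (auto simp: dist_norm inner_diff_right)
  ultimately show ?thesis using disjoint_interiors[OF T] by blast
qed

text \<open>If the segment meets two mesh hyperplanes at the same parameter t, eliminating t places
  \<open>x\<^sub>1\<close> on a fixed hyperplane through \<open>x\<^sub>0\<close>, unless the two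
  are equal. Finitely many such hyperplanes cannot cover the open set \<open>B\<close>.\<close>

lemma generic_segment:
  fixes n :: "'a set \<Rightarrow> 'a" and c :: "'a set \<Rightarrow> real" and x\<^sub>0 :: 'a
  assumes H: "\<And>F. F \<in> \<F> \<Longrightarrow> norm (n F) = 1" and x\<^sub>0: "\<And>F. F \<in> \<F> \<Longrightarrow> n F \<bullet> x\<^sub>0 \<noteq> c F" and B: "open B" "B \<noteq> {}"
  obtains x\<^sub>1 where "x\<^sub>1 \<in> B" "\<And>F F' z. \<lbrakk>F \<in> \<F>; F' \<in> \<F>; z \<in> closed_segment x\<^sub>0 x\<^sub>1; n F \<bullet> z = c F; n F' \<bullet> z = c F'\<rbrakk> \<Longrightarrow>
     {x. n F \<bullet> x = c F} = {x. n F' \<bullet> x = c F'}"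
proof -
  define \<alpha> where "\<alpha> F = n F \<bullet> x\<^sub>0 - c F" for F
  have \<alpha>: "\<alpha> F \<noteq> 0" if "F \<in> \<F>" for F using x\<^sub>0[OF that] by (simp add: \<alpha>_def)
  \<comment> \<open>The normal left after eliminating t from
    \<open>\<alpha> F + t * (n F \<bullet> (x\<^sub>1 - x\<^sub>0)) = 0\<close> and its analogue for
    \<open>F'\<close>. When it vanishes, the two planes are parallel and share z.\<close>
  define m where "m F F' = \<alpha> F' *\<^sub>R n F - \<alpha> F *\<^sub>R n F'" for F F'
  define bad where "bad = (\<Union>F\<in>\<F>. \<Union>F'\<in>\<F>. if m F F' = 0 then {} else {x. m F F' \<bullet> x = m F F' \<bullet> x\<^sub>0})"
  have "negligible bad"
    unfolding bad_def using finite_faces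
    by (intro negligible_Union) (auto intro!: negligible_Union negligible_hyperplane)
  then have "\<not> B \<subseteq> bad" using open_not_negligible[OF B] negligible_subset by blast
  then obtain x\<^sub>1 where x\<^sub>1: "x\<^sub>1 \<in> B" "x\<^sub>1 \<notin> bad" by blast
  have "{x. n F \<bullet> x = c F} = {x. n F' \<bullet> x = c F'}"
    if F: "F \<in> \<F>" "F' \<in> \<F>" and z: "z \<in> closed_segment x\<^sub>0 x\<^sub>1" "n F \<bullet> z = c F" "n F' \<bullet> z = c F'" for F F' z
  proof -
    obtain t where t: "z = x\<^sub>0 + t *\<^sub>R (x\<^sub>1 - x\<^sub>0)"
      using z(1) by (auto simp: closed_segment_def algebra_simps)
    have 1: "\<alpha> F + t * (n F \<bullet> (x\<^sub>1 - x\<^sub>0)) = 0" "\<alpha> F' + t * (n F' \<bullet> (x\<^sub>1 - x\<^sub>0)) = 0"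
      using z(2,3) unfolding t \<alpha>_def by (auto simp: inner_add_right)
    have "t \<noteq> 0" using 1(1) \<alpha>[OF F(1)] by auto
    have "t * (m F F' \<bullet> (x\<^sub>1 - x\<^sub>0)) = \<alpha> F' * (t * (n F \<bullet> (x\<^sub>1 - x\<^sub>0))) - \<alpha> F * (t * (n F' \<bullet> (x\<^sub>1 - x\<^sub>0)))"
      by (simp add: m_def inner_diff_left algebra_simps)
    also have "\<dots> = 0" using 1 by (simp add: add_eq_0_iff)
    finally have "m F F' \<bullet> (x\<^sub>1 - x\<^sub>0) = 0" using \<open>t \<noteq> 0\<close> by simp
    then have "m F F' \<bullet> x\<^sub>1 = m F F' \<bullet> x\<^sub>0" by (simp add: inner_diff_right)
    then have "m F F' = 0" using x\<^sub>1(2) F unfolding bad_def by (auto split: if_splits)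
    then have eq: "\<alpha> F' *\<^sub>R n F = \<alpha> F *\<^sub>R n F'" by (simp add: m_def)
    have "n F \<bullet> x = c F \<longleftrightarrow> n F' \<bullet> x = c F'" for x
    proof -
      have "\<alpha> F' * (n F \<bullet> (x - z)) = \<alpha> F * (n F' \<bullet> (x - z))"
        using arg_cong[OF eq, of "\<lambda>y. y \<bullet> (x - z)"] by simp
      then have "n F \<bullet> (x - z) = 0 \<longleftrightarrow> n F' \<bullet> (x - z) = 0" using \<alpha> F by (metis mult_eq_0_iff)
      then show ?thesis using z(2,3) by (simp add: inner_diff_right)
    qed
    then show ?thesis by blast
  qed
  then show ?thesis using that x\<^sub>1(1) by blast
qed

text \<open>Walk along a generic segment from an element where \<open>\<kappa>\<close> is not zero to the exterior. Where the segment
  leaves the union of the elements with the same value, it crosses a single mesh hyperplane; the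
  vanishing jump there forces the element behind that hyperplane, if any, to carry the same value.\<close>

lemma piecewise_constant_without_jumps:
  fixes \<kappa> :: "'a set \<Rightarrow> real"
  assumes jump0: "\<And>F. F \<in> \<F> \<Longrightarrow> (\<Sum>T\<in>face_elements \<T> F. \<kappa> T *\<^sub>R face_normal T F) = 0" and T0: "T0 \<in> \<T>"
  shows "\<kappa> T0 = 0"
proof (rule ccontr)
  assume nz: "\<kappa> T0 \<noteq> 0"
  define \<A> where "\<A> = {T \<in> \<T>. \<kappa> T = \<kappa> T0}"
  define A where "A = \<Union>\<A>"
  have compA: "compact A" unfolding A_def \<A>_def by (rule compact_Union) (use finite_mesh element(2) in auto)
  have "\<forall>F\<in>\<F>. \<exists>p. norm (fst p) = 1 \<and> F \<subseteq> {x. fst p \<bullet> x = snd p}"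
  proof
    fix F assume "F \<in> \<F>"
    then obtain T where T: "F \<in> faces T" by (auto simp: mesh_faces_def)
    obtain c where "F \<subseteq> {x. face_normal T F \<bullet> x = c}" using face_hyperplane[OF T] by blast
    then show "\<exists>p. norm (fst p) = 1 \<and> F \<subseteq> {x. fst p \<bullet> x = snd p}"
      using norm_face_normal[OF T] by (intro exI[of _ "(face_normal T F, c)"]) simp
  qed
  from bchoice[OF this] obtain p where p: "\<And>F. F \<in> \<F> \<Longrightarrow> norm (fst (p F)) = 1" "\<And>F. F \<in> \<F> \<Longrightarrow> F \<subseteq> {x. fst (p F) \<bullet> x = snd (p F)}"
    by blast
  define n where "n F = fst (p F)" for F
  define c where "c F = snd (p F)" for F
  have n: "norm (n F) = 1" and plane: "F \<subseteq> {x. n F \<bullet> x = c F}" if "F \<in> \<F>" for F using p that by (auto simp: n_def c_def)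
  have "n F \<noteq> 0" if "F \<in> \<F>" for F using n[OF that] by auto
  then have "negligible (\<Union>F\<in>\<F>. {x. n F \<bullet> x = c F})"
    using finite_faces by (intro negligible_Union) (auto intro!: negligible_hyperplane)
  then have "\<not> interior T0 \<subseteq> (\<Union>F\<in>\<F>. {x. n F \<bullet> x = c F})"
    using open_not_negligible[OF open_interior element(5)[OF T0]] negligible_subset by blast
  then obtain x\<^sub>0 where x\<^sub>0: "x\<^sub>0 \<in> interior T0" "\<And>F. F \<in> \<F> \<Longrightarrow> n F \<bullet> x\<^sub>0 \<noteq> c F" by blast
  have opA: "open (- A)" using compA compact_imp_closed by blast
  have "- A \<noteq> {}"
  proof
    assume "- A = {}"
    then have "A = UNIV" by blast
    then show False using compact_imp_bounded[OF compA] not_bounded_UNIV by simp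
  qed
  obtain x\<^sub>1 where x\<^sub>1: "x\<^sub>1 \<in> - A" and gen: "\<And>F F' z. \<lbrakk>F \<in> \<F>; F' \<in> \<F>; z \<in> closed_segment x\<^sub>0 x\<^sub>1; n F \<bullet> z = c F; n F' \<bullet> z = c F'\<rbrakk> \<Longrightarrow>
     {x. n F \<bullet> x = c F} = {x. n F' \<bullet> x = c F'}"
    using generic_segment[where n = n and c = c, OF n x\<^sub>0(2) opA \<open>- A \<noteq> {}\<close>] by blast
  have "T0 \<in> \<A>" using T0 by (simp add: \<A>_def)
  then have "x\<^sub>0 \<in> A" using x\<^sub>0(1) interior_subset unfolding A_def by blast
  then have "closed_segment x\<^sub>0 x\<^sub>1 \<inter> A \<noteq> {}" by auto
  moreover have "closed_segment x\<^sub>0 x\<^sub>1 - A \<noteq> {}" using x\<^sub>1 by auto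
  ultimately have "closed_segment x\<^sub>0 x\<^sub>1 \<inter> frontier A \<noteq> {}"
    by (rule connected_Int_frontier[OF connected_segment(1)])
  then obtain z where z: "z \<in> closed_segment x\<^sub>0 x\<^sub>1" "z \<in> frontier A" by blast
  have "z \<in> A" using z(2) frontier_subset_compact[OF compA] by blast
  then obtain T where T: "T \<in> \<A>" "z \<in> T" unfolding A_def by blast
  have T\<T>: "T \<in> \<T>" "\<kappa> T = \<kappa> T0" using T(1) by (auto simp: \<A>_def)
  have notint: "z \<notin> interior A" using z(2) by (simp add: frontier_def)
  have "z \<in> frontier T"
  proof -
    have "T \<subseteq> A" using T(1) unfolding A_def by blast
    then have "z \<notin> interior T" using notint interior_mono by blast
    then show ?thesis using T(2) closure_subset by (fastforce simp: frontier_def)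
  qed
  then obtain F\<^sub>1 where F\<^sub>1: "F\<^sub>1 \<in> faces T" "z \<in> F\<^sub>1" using element(7)[OF T\<T>(1)] by blast
  have F\<^sub>1F: "F\<^sub>1 \<in> \<F>" using F\<^sub>1 T\<T> by (auto simp: mesh_faces_def)
  define N where "N = n F\<^sub>1"
  have N: "norm N = 1" unfolding N_def by (rule n[OF F\<^sub>1F])
  \<comment> \<open>By the choice of the segment every mesh face through z lies in the hyperplane of
    \<open>F\<^sub>1\<close>, so each element with z on its frontier is a half ball there.\<close>
  have generic: "outward_normal T' z N \<or> outward_normal T' z (- N)" if T': "T' \<in> \<T>" "z \<in> frontier T'" for T'
  proof (rule outward_normal_at_generic[OF element(1)[OF T'(1)] T'(2) N, of "c F\<^sub>1"])
    fix F assume F: "F \<in> faces T'" "z \<in> F"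
    then have FF: "F \<in> \<F>" using T'(1) by (auto simp: mesh_faces_def)
    have "n F \<bullet> z = c F" "n F\<^sub>1 \<bullet> z = c F\<^sub>1" using plane[OF FF] plane[OF F\<^sub>1F] F(2) F\<^sub>1(2) by auto
    then have "{x. n F \<bullet> x = c F} = {x. n F\<^sub>1 \<bullet> x = c F\<^sub>1}" using gen[OF FF F\<^sub>1F z(1)] by blast
    then show "F \<subseteq> {x. N \<bullet> x = c F\<^sub>1}" using plane[OF FF] unfolding N_def by blast
  qed
  obtain m where m: "outward_normal T z m" "m = N \<or> m = - N" using generic[OF T\<T>(1) \<open>z \<in> frontier T\<close>] by blast
  \<comment> \<open>\<open>F\<^sub>1\<close> may contain z only through its closure. The flat
    component of z itself yields a face whose normal at z is known.\<close>
  define C where "C = connected_component_set {x. outward_normal T x m} z"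
  have C: "C \<in> components {x. outward_normal T x m}" unfolding C_def by (rule componentsI) (use m in simp)
  have zC: "z \<in> C" unfolding C_def by (simp add: m(1))
  define F where "F = closure C"
  have FT: "F \<in> faces T" unfolding F_def faces_def using C by blast
  have zF: "z \<in> F" unfolding F_def using zC closure_subset by blast
  have FF: "F \<in> \<F>" using FT T\<T> by (auto simp: mesh_faces_def)
  have nT: "face_normal T F = m" unfolding F_def by (rule face_normal_closure[OF C])
  note fe = face_elements[OF FF]
  \<comment> \<open>For another element, z is known to lie only in the closure of its flat
    component; being a half ball at z, the element has the same normal there as at nearby flat
    points.\<close>
  have normal: "outward_normal T' z (face_normal T' F)" if T': "T' \<in> face_elements \<T> F" for T'
  proof -
    have T'\<T>: "T' \<in> \<T>" "F \<in> faces T'" using fe(3,4)[OF T'] .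
    have "z \<in> frontier T'" using face_subset_frontier[OF T'\<T>(2)] zF by blast
    then obtain m' where m': "outward_normal T' z m'" using generic[OF T'\<T>(1)] by blast
    obtain e where e: "e > 0" "\<And>w. dist z w < e \<Longrightarrow> w \<in> T' \<longleftrightarrow> (w - z) \<bullet> m' \<le> 0"
      using outward_normalE[OF m'] by blast
    obtain C' where C': "F = closure C'" "C' \<in> components {x. outward_normal T' x (face_normal T' F)}"
      using faceE[OF T'\<T>(2)] by blast
    obtain y where y: "y \<in> C'" "dist y z < e" using zF e(1) unfolding C'(1) by (meson closure_approachable)
    have "outward_normal T' y (face_normal T' F)" using y(1) in_components_subset[OF C'(2)] by blast
    then have "face_normal T' F = m'"
      by (intro outward_normal_local(1)[where e = e and z = y, OF outward_normal_norm[OF m'] e(2)])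
         (use y in \<open>auto simp: dist_commute\<close>)
    then show ?thesis using m' by simp
  qed
  have TF: "T \<in> face_elements \<T> F" using T\<T> FT by (simp add: face_elements_def)
  have opposite: "face_normal T' F = - m" if T': "T' \<in> face_elements \<T> F" "T' \<noteq> T" for T'
  proof -
    have "face_normal T' F \<noteq> m"
      using same_normal_same_element[OF T\<T>(1) fe(3)[OF T'(1)] m(1)] normal[OF T'(1)] T'(2) by metis
    moreover have "z \<in> frontier T'" using face_subset_frontier[OF fe(4)[OF T'(1)]] zF by blast
    then have "outward_normal T' z N \<or> outward_normal T' z (- N)" by (rule generic[OF fe(3)[OF T'(1)]])
    then have "face_normal T' F = N \<or> face_normal T' F = - N"
      using outward_normal_unique[OF _ normal[OF T'(1)]] by blast
    ultimately show ?thesis using m(2) by auto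
  qed
  have mn: "m \<noteq> 0" using outward_normal_norm[OF m(1)] by auto
  show False
  proof (cases "\<exists>T'\<in>face_elements \<T> F. T' \<noteq> T")
    case False
    then have "face_elements \<T> F = {T}" using TF by blast
    then have "\<kappa> T *\<^sub>R m = 0" using jump0[OF FF] nT by simp
    then show False using nz T\<T>(2) mn by simp
  next
    case True
    then obtain T' where T': "T' \<in> face_elements \<T> F" "T' \<noteq> T" by blast
    have oT': "outward_normal T' z (- m)" using normal[OF T'(1)] opposite[OF T'] by simp
    have "T'' = T'" if T'': "T'' \<in> face_elements \<T> F" "T'' \<noteq> T" for T''
    proof -
      have "outward_normal T'' z (- m)" using normal[OF T''(1)] opposite[OF T''] by simp
      then show ?thesis by (rule same_normal_same_element[OF fe(3)[OF T''(1)] fe(3)[OF T'(1)] _ oT'])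
    qed
    then have "face_elements \<T> F = {T, T'}" using TF T' by blast
    then have "\<kappa> T *\<^sub>R m - \<kappa> T' *\<^sub>R m = 0" using jump0[OF FF] T' nT opposite[OF T'] by simp
    then have "(\<kappa> T - \<kappa> T') *\<^sub>R m = 0" by (simp add: scaleR_left_diff_distrib)
    then have "\<kappa> T' = \<kappa> T0" using mn T\<T>(2) by simp
    then have "T' \<in> \<A>" using fe(3)[OF T'(1)] by (simp add: \<A>_def)
    obtain d where d: "d > 0" "\<And>w. dist z w < d \<Longrightarrow> w \<in> T \<longleftrightarrow> (w - z) \<bullet> m \<le> 0" using outward_normalE[OF m(1)] by blast
    obtain e where e: "e > 0" "\<And>w. dist z w < e \<Longrightarrow> w \<in> T' \<longleftrightarrow> (w - z) \<bullet> (- m) \<le> 0" using outward_normalE[OF oT'] by blast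
    \<comment> \<open>The two elements fill opposite half balls and both belong to
      \<open>\<A>\<close>, so z would be interior to \<open>A\<close>.\<close>
    have "ball z (min d e) \<subseteq> T \<union> T'"
    proof
      fix w assume "w \<in> ball z (min d e)"
      then show "w \<in> T \<union> T'" using d(2)[of w] e(2)[of w] by (cases "(w - z) \<bullet> m \<le> 0") auto
    qed
    also have "\<dots> \<subseteq> A" using T(1) \<open>T' \<in> \<A>\<close> unfolding A_def by blast
    finally have "z \<in> interior A" using d(1) e(1) by (intro interiorI[of "ball z (min d e)"]) auto
    then show False using notint by blast
  qed
qed

text \<open>The volume part makes the gradient vanish, so v is constant on each connected interior.
  Its jumps are then constant on faces of positive measure, so the face part makes them zero, and
  \<open>piecewise_constant_without_jumps\<close> applies.\<close>

theorem DG_norm_eq_zero: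
  assumes v: "v \<in> V" and a: "continuous_on (closure D) a" "\<And>x. x \<in> closure D \<Longrightarrow> 0 < a x" and \<eta>: "\<eta> > 0"
    and zero: "DG_norm \<T> a \<eta> v = 0" and T: "T \<in> \<T>" and x: "x \<in> interior T"
  shows "v x = 0"
proof -
  have a0: "0 \<le> a x" if "x \<in> closure D" for x using a(2)[OF that] by simp
  have vol0: "0 \<le> vol_dens a v v T x" if "T \<in> \<T>" "x \<in> T" for T x
    unfolding vol_dens_def using element(8)[OF that(1)] that(2) a0 by auto
  have I1: "0 \<le> integral\<^sup>L (lebesgue_on T) (vol_dens a v v T)" if "T \<in> \<T>" for T
    using vol0 that by (intro integral_nonneg_AE AE_I2) auto
  have I2: "0 \<le> (\<integral>x. \<eta> / hF F * (J F v x \<bullet> J F v x) \<partial>face_measure F)" if "F \<in> \<F>" for F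
    using \<eta> face_size_pos[OF that] by (intro integral_nonneg_AE AE_I2) auto
  have "(DG_norm \<T> a \<eta> v)\<^sup>2 = Phi (vol_dens a v v) (\<lambda>F x. \<eta> / hF F * (J F v x \<bullet> J F v x))"
    by (rule DG_norm_Phi(1)[OF v a(1) _ \<eta>]) (rule a0)
  then have sum0: "(\<Sum>T\<in>\<T>. integral\<^sup>L (lebesgue_on T) (vol_dens a v v T)) +
      (\<Sum>F\<in>\<F>. \<integral>x. \<eta> / hF F * (J F v x \<bullet> J F v x) \<partial>face_measure F) = 0"
    using zero by (simp add: Phi_def)
  have s1: "0 \<le> (\<Sum>T\<in>\<T>. integral\<^sup>L (lebesgue_on T) (vol_dens a v v T))" by (rule sum_nonneg[OF I1])
  have s2: "0 \<le> (\<Sum>F\<in>\<F>. \<integral>x. \<eta> / hF F * (J F v x \<bullet> J F v x) \<partial>face_measure F)" by (rule sum_nonneg[OF I2])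
  have z1: "integral\<^sup>L (lebesgue_on T) (vol_dens a v v T) = 0" if "T \<in> \<T>" for T
    using sum0 s1 s2 sum_nonneg_eq_0_iff[OF finite_mesh I1] that by (simp add: add_nonneg_eq_0_iff)
  have z2: "(\<integral>x. \<eta> / hF F * (J F v x \<bullet> J F v x) \<partial>face_measure F) = 0" if "F \<in> \<F>" for F
  proof -
    have "(\<Sum>F\<in>\<F>. \<integral>x. \<eta> / hF F * (J F v x \<bullet> J F v x) \<partial>face_measure F) = 0"
      using sum0 s1 s2 add_nonneg_eq_0_iff[OF s1 s2] by blast
    then show ?thesis
      using sum_nonneg_eq_0_iff[of \<F> "\<lambda>F. \<integral>x. \<eta> / hF F * (J F v x \<bullet> J F v x) \<partial>face_measure F"] finite_faces I2 that
      by blast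
  qed
  have "\<exists>\<kappa>. \<forall>x\<in>interior T. v x = \<kappa>" if T: "T \<in> \<T>" for T
  proof -
    obtain x0 where x0: "x0 \<in> interior T" using element(5)[OF T] by blast
    have "gtr T v x = 0" if x: "x \<in> interior T" for x
    proof -
      have "vol_dens a v v T x = 0"
      proof (rule continuous_nonneg_integral_zero[OF element(2)[OF T] _ _ z1[OF T] x])
        show "continuous_on T (vol_dens a v v T)" using dens_continuous(1)[OF v v a(1)] T by (auto simp: mesh_continuous_def)
      qed (use vol0 T in blast)
      moreover have "x \<in> closure D" using x interior_subset element(8)[OF T] by blast
      then have "a x \<noteq> 0" using a(2) by fastforce
      ultimately show ?thesis by (simp add: vol_dens_def)
    qed
    then have d0: "(v has_derivative (\<lambda>h. 0)) (at x)" if "x \<in> interior T" for x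
      using traceE(5)[OF v T that] that by simp
    have "v x = v x0" if "x \<in> interior T" for x
      by (rule has_derivative_zero_unique_connected[OF open_interior element(4)[OF T] d0 that x0])
    then show ?thesis by blast
  qed
  then have "\<forall>T\<in>\<T>. \<exists>\<kappa>. \<forall>x\<in>interior T. v x = \<kappa>" by blast
  from bchoice[OF this] obtain \<kappa> where \<kappa>: "\<And>T x. T \<in> \<T> \<Longrightarrow> x \<in> interior T \<Longrightarrow> v x = \<kappa> T" by blast
  have tr: "interior_trace T v x = \<kappa> T" if "T \<in> \<T>" "x \<in> T" for T x
    by (rule interior_trace_eq[OF element(3)[OF that(1)] that(2) continuous_on_const \<kappa>[OF that(1)]])
  have "\<kappa> T = 0"
  proof (rule piecewise_constant_without_jumps[OF _ T])
    fix F assume F: "F \<in> \<F>"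
    let ?j = "\<Sum>T\<in>face_elements \<T> F. \<kappa> T *\<^sub>R face_normal T F"
    have Jj: "J F v x = ?j" if "x \<in> F" for x
      unfolding jump_def using face_elements[OF F] that by (intro sum.cong) (auto simp: tr)
    have "(\<integral>x. \<eta> / hF F * (J F v x \<bullet> J F v x) \<partial>face_measure F) = (\<integral>x. \<eta> / hF F * (?j \<bullet> ?j) \<partial>face_measure F)"
      by (rule Bochner_Integration.integral_cong[OF refl]) (simp add: space_face[OF F] Jj)
    also have "\<dots> = measure (face_measure F) F * (\<eta> / hF F * (?j \<bullet> ?j))"
      by (simp add: space_face[OF F])
    finally have "measure (face_measure F) F * (\<eta> / hF F * (?j \<bullet> ?j)) = 0" unfolding z2[OF F] by (rule sym)
    moreover have "measure (face_measure F) F > 0"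
      using flat_set_mesh_face[OF F] flat_set.measure_face_pos by metis
    ultimately show "?j = 0" using \<eta> face_size_pos[OF F] by simp
  qed
  then show ?thesis using \<kappa>[OF T x] by simp
qed

end

section \<open>Parametric regularity\<close>

text \<open>For a continuous function the set where it exceeds its essential supremum is open and
  null, hence empty; closure points follow by continuity.\<close>

lemma Linf_norm_bound:
  fixes D :: "'a::euclidean_space set"
  assumes D: "open D" "D \<noteq> {}" "compact (closure D)" and g: "continuous_on (closure D) g"
  shows "\<And>x. x \<in> closure D \<Longrightarrow> \<bar>g x\<bar> \<le> Linf_norm D g" "0 \<le> Linf_norm D g"
proof -
  define e where "e = esssup (lebesgue_on D) (\<lambda>x. ereal \<bar>g x\<bar>)"
  have DL: "D \<in> sets lebesgue" using D(1) by simp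
  have gD: "continuous_on D g" using g closure_subset by (rule continuous_on_subset)
  obtain B where B: "\<And>x. x \<in> closure D \<Longrightarrow> \<bar>g x\<bar> \<le> B"
    using compact_imp_bounded[OF compact_continuous_image[OF g D(3)]] by (auto simp: bounded_iff)
  have meas: "(\<lambda>x. ereal \<bar>g x\<bar>) \<in> borel_measurable (lebesgue_on D)"
    using continuous_imp_measurable_on_sets_lebesgue[OF gD DL] by measurable
  \<comment> \<open>Finiteness is essential: \<open>real_of_ereal\<close> sends infinite values to
    0.\<close>
  have "e \<le> ereal B"
    unfolding e_def by (rule esssup_I[OF meas]) (use B closure_subset[of D] in \<open>auto intro!: AE_I2\<close>)
  have AE: "AE x in lebesgue. x \<in> D \<longrightarrow> ereal \<bar>g x\<bar> \<le> e"
    using esssup_AE[where M = "lebesgue_on D" and f = "\<lambda>x. ereal \<bar>g x\<bar>"] DL by (simp add: e_def AE_restrict_space_iff)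
  have le: "ereal \<bar>g x\<bar> \<le> e" if x: "x \<in> D" for x
  proof (rule ccontr)
    assume not: "\<not> ereal \<bar>g x\<bar> \<le> e"
    let ?O = "{y \<in> D. \<not> ereal \<bar>g y\<bar> \<le> e}"
    have "?O = D \<inter> (\<lambda>y. ereal \<bar>g y\<bar>) -` {e<..}" by auto
    moreover have "open (D \<inter> (\<lambda>y. ereal \<bar>g y\<bar>) -` {e<..})"
      by (intro continuous_open_preimage D(1) continuous_on_ereal continuous_on_rabs gD) simp
    ultimately have "open ?O" by simp
    have "{y \<in> space lebesgue. \<not> (y \<in> D \<longrightarrow> ereal \<bar>g y\<bar> \<le> e)} \<in> null_sets lebesgue"
      using AE by (rule completion.AE_iff_null_sets[THEN iffD1])
    then have "negligible ?O" by (simp add: negligible_iff_null_sets)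
    then show False using open_not_negligible[OF \<open>open ?O\<close>] x not by blast
  qed
  obtain x\<^sub>0 where x\<^sub>0: "x\<^sub>0 \<in> D" using D(2) by blast
  have "0 \<le> e" using le[OF x\<^sub>0] by (metis abs_ge_zero ereal_less_eq(5) order_trans)
  with \<open>e \<le> ereal B\<close> obtain r where r: "e = ereal r" by (cases e) auto
  then have L: "Linf_norm D g = r" by (simp add: Linf_norm_def e_def)
  show "0 \<le> Linf_norm D g" using \<open>0 \<le> e\<close> r L by simp
  show "\<bar>g x\<bar> \<le> Linf_norm D g" if "x \<in> closure D" for x
    unfolding L by (rule continuous_le_on_closure[OF continuous_on_rabs[OF g] that]) (use le r in simp)
qed

context dg_mesh
begin

text \<open>The difference of two forms is the form of the differences, bounded through
  \<open>DG_form_bound\<close>. This is why the y-derivatives of the coefficient must exist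
  uniformly in x.\<close>

lemma DG_form_tendsto:
  assumes w: "w \<in> V" and v: "v \<in> V" and \<theta>: "\<bar>\<theta>\<bar> \<le> 1"
    and b: "uniform_limit (closure D) b l F" "\<forall>\<^sub>F t in F. continuous_on (closure D) (b t)" "continuous_on (closure D) l"
    and e: "(e \<longlongrightarrow> m) F"
  shows "((\<lambda>t. DG_form \<theta> \<T> (b t) (e t) w v) \<longlongrightarrow> DG_form \<theta> \<T> l m w v) F"
proof (rule tendstoI)
  fix \<epsilon> :: real assume \<epsilon>: "\<epsilon> > 0"
  \<comment> \<open>Star norms for coefficient 1 and penalty 1, a reference that stays fixed while t
    varies.\<close>
  define K where "K = DG_norm_star \<T> (\<lambda>_. 1) 1 w * DG_norm_star \<T> (\<lambda>_. 1) 1 v"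
  define \<delta> where "\<delta> = \<epsilon> / (2 * (\<bar>K\<bar> + 1))"
  have \<delta>: "\<delta> > 0" using \<epsilon> by (simp add: \<delta>_def add_nonneg_pos)
  have "\<forall>\<^sub>F t in F. \<forall>x\<in>closure D. dist (b t x) (l x) < \<delta>" by (rule uniform_limitD[OF b(1) \<delta>])
  moreover have "\<forall>\<^sub>F t in F. dist (e t) m < \<delta>" by (rule tendstoD[OF e \<delta>])
  ultimately show "\<forall>\<^sub>F t in F. dist (DG_form \<theta> \<T> (b t) (e t) w v) (DG_form \<theta> \<T> l m w v) < \<epsilon>"
    using b(2)
  proof eventually_elim
    case (elim t)
    have c: "continuous_on (closure D) (\<lambda>x. b t x + (- 1) * l x)"
      by (intro continuous_on_add continuous_on_mult continuous_on_const elim(3) b(3))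
    have "DG_form \<theta> \<T> (\<lambda>x. b t x + (- 1) * l x) (e t + (- 1) * m) w v =
       DG_form \<theta> \<T> (b t) (e t) w v + (- 1) * DG_form \<theta> \<T> l m w v"
      by (rule DG_form_coeff_add_scaled[OF w v elim(3) b(3) refl])
    moreover have "\<bar>DG_form \<theta> \<T> (\<lambda>x. b t x + (- 1) * l x) (e t + (- 1) * m) w v\<bar> \<le>
       (\<delta> + \<delta>) * DG_norm_star \<T> (\<lambda>_. 1) 1 w * DG_norm_star \<T> (\<lambda>_. 1) 1 v"
    proof (rule DG_form_bound[OF w v c _ _ _ _ _ _ _ \<theta>])
      show "\<bar>b t x + (- 1) * l x\<bar> \<le> \<delta> * 1" if "x \<in> closure D" for x
        using elim(1) that by (fastforce simp: dist_real_def)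
      show "\<bar>e t + (- 1) * m\<bar> \<le> \<delta> * 1" using elim(2) by (simp add: dist_real_def)
    qed (use \<delta> in auto)
    moreover have "(\<delta> + \<delta>) * K < \<epsilon>"
    proof -
      have "(\<delta> + \<delta>) * K \<le> (\<delta> + \<delta>) * \<bar>K\<bar>" using \<delta> by (intro mult_left_mono) auto
      also have "\<dots> < (\<delta> + \<delta>) * (\<bar>K\<bar> + 1)" using \<delta> by (intro mult_strict_left_mono) auto
      also have "\<dots> = \<epsilon>" unfolding \<delta>_def by (simp add: field_simps add_nonneg_eq_0_iff)
      finally show ?thesis .
    qed
    ultimately show ?case by (simp add: dist_real_def K_def mult.assoc)
  qed
qed

end

text \<open>A uniform limit of continuous difference quotients is continuous. The form with
  differentiated data thus has a continuous coefficient, as all lemmas on the form require.\<close>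

lemma mixed_partials_continuous:
  fixes a :: "'a::topological_space \<Rightarrow> param \<Rightarrow> real"
  assumes limpt: "\<And>y j. y \<in> U \<Longrightarrow> y j islimpt coord_slice U y j"
    and cont: "\<And>y. y \<in> U \<Longrightarrow> continuous_on K (\<lambda>x. a x y)"
    and smooth: "has_mixed_partials_uniformly K U a" and "finsupp m" "y \<in> U"
  shows "continuous_on K (\<lambda>x. mixed_partial U m (a x) y)"
proof -
  have "\<forall>y\<in>U. continuous_on K (\<lambda>x. mixed_partial U m (a x) y)"
    using \<open>finsupp m\<close>
  proof (induction m rule: multi_index_induct)
    case zero
    then show ?case using cont by simp
  next
    case (top \<mu> j)
    show ?case
    proof
      fix y assume y: "y \<in> U"
      let ?F = "at (y j) within coord_slice U y j"
      have lim: "uniform_limit K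
          (\<lambda>t x. (mixed_partial U \<mu> (a x) (y(j := t)) - mixed_partial U \<mu> (a x) y) / (t - y j))
          (\<lambda>x. mixed_partial U (\<mu>(j := Suc (\<mu> j))) (a x) y) ?F"
        using smooth top.hyps(1) y unfolding has_mixed_partials_uniformly_def by blast
      have "\<forall>\<^sub>F t in ?F. t \<in> coord_slice U y j \<and> t \<noteq> y j" by (auto simp: eventually_at intro!: exI[of _ 1])
      then have "\<forall>\<^sub>F t in ?F. continuous_on K
          (\<lambda>x. (mixed_partial U \<mu> (a x) (y(j := t)) - mixed_partial U \<mu> (a x) y) / (t - y j))"
      proof eventually_elim
        case (elim t)
        then have "y(j := t) \<in> U" by (simp add: coord_slice_def)
        then show ?case using top.IH y elim by (intro continuous_on_divide continuous_on_diff continuous_on_const) auto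
      qed
      then show "continuous_on K (\<lambda>x. mixed_partial U (\<mu>(j := Suc (\<mu> j))) (a x) y)"
        by (rule uniform_limit_theorem[OF _ lim]) (use limpt[OF y] in \<open>simp add: trivial_limit_within\<close>)
    qed
  qed
  then show ?thesis using \<open>y \<in> U\<close> by blast
qed

text \<open>One mesh of the sequence with all parameters. The constants stem from data shared by all
  meshes, so estimates derived here are uniform in h.\<close>

locale dg_parametric = dg_mesh D \<T> k
  for D :: "'a::euclidean_space set" and \<T> k +
  fixes U :: "param set" and a :: "'a \<Rightarrow> param \<Rightarrow> real" and \<eta> :: "param \<Rightarrow> real" and f :: "'a \<Rightarrow> real"
    and u :: "'a \<Rightarrow> param \<Rightarrow> real" and \<theta> \<tau> C_tr C_equiv :: real
  assumes D_nonempty: "D \<noteq> {}"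
    and limpt: "y \<in> U \<Longrightarrow> y j islimpt coord_slice U y j"
    and coeff_cont: "y \<in> U \<Longrightarrow> continuous_on (closure D) (\<lambda>x. a x y)"
    and coeff_pos: "y \<in> U \<Longrightarrow> 0 < coeff_min D (\<lambda>x. a x y)"
    and coeff_smooth: "has_mixed_partials_uniformly (closure D) U a"
    and penalty_pos: "y \<in> U \<Longrightarrow> 0 < \<eta> y"
    and penalty_smooth: "has_mixed_partials U \<eta>"
    and theta: "\<theta> \<in> {-1, 0, 1}"
    and trace_ineq: "\<lbrakk>v \<in> DG_space D \<T> k; T \<in> \<T>; F \<in> faces T\<rbrakk> \<Longrightarrow>
          sqrt (diameter T) * L2norm (face_measure F) (interior_trace T v) \<le> C_tr * L2norm (lebesgue_on T) v"
    and solution: "y \<in> U \<Longrightarrow> DG_solution D \<T> k \<theta> (\<lambda>x. a x y) (\<eta> y) f (\<lambda>x. u x y)"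
    and equiv_pos: "0 < C_equiv"
    and norm_equiv: "\<lbrakk>y \<in> U; v \<in> DG_space D \<T> k\<rbrakk> \<Longrightarrow>
          DG_norm_star \<T> (\<lambda>x. a x y) (\<eta> y) v \<le> C_equiv * DG_norm \<T> (\<lambda>x. a x y) (\<eta> y) v"
    and tau: "1 < \<tau>"
    and penalty: "y \<in> U \<Longrightarrow>
          \<eta> y \<ge> \<tau> * ((coeff_max D (\<lambda>x. a x y))\<^sup>2 * C_tr\<^sup>2 * real (max_faces \<T>) * (\<theta> - 1)\<^sup>2
                       / (4 * coeff_min D (\<lambda>x. a x y)))"
begin

abbreviation da where "da m y \<equiv> (\<lambda>x. mixed_partial U m (a x) y)"
abbreviation d\<eta> where "d\<eta> m y \<equiv> mixed_partial U m \<eta> y"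
abbreviation energy where "energy y \<equiv> DG_norm \<T> (\<lambda>x. a x y) (\<eta> y)"

definition coercivity_const :: real where
  "coercivity_const = (if \<theta> = 1 then 1 else 1 - 1 / sqrt \<tau>)"

lemma coercivity_const_pos: "0 < coercivity_const"
  using tau by (simp add: coercivity_const_def)

lemma theta_abs: "\<bar>\<theta>\<bar> \<le> 1"
  using theta by auto

lemma coeff_bounds:
  assumes "y \<in> U" "x \<in> closure D"
  shows "coeff_min D (\<lambda>x. a x y) \<le> a x y" "a x y \<le> coeff_max D (\<lambda>x. a x y)" "0 < a x y"
proof -
  have "bounded ((\<lambda>x. a x y) ` closure D)"
    by (rule compact_imp_bounded[OF compact_continuous_image[OF coeff_cont[OF assms(1)] D_compact]])
  then show "coeff_min D (\<lambda>x. a x y) \<le> a x y" "a x y \<le> coeff_max D (\<lambda>x. a x y)"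
    unfolding coeff_min_def coeff_max_def
    using assms(2) by (auto intro!: cINF_lower cSUP_upper bounded_imp_bdd_below bounded_imp_bdd_above)
  then show "0 < a x y" using coeff_pos[OF assms(1)] by linarith
qed

lemma coercive:
  assumes y: "y \<in> U" and v: "v \<in> V"
  shows "coercivity_const * (energy y v)\<^sup>2 \<le> DG_form \<theta> \<T> (\<lambda>x. a x y) (\<eta> y) v v"
proof (cases "\<theta> = 1")
  case True
  have c: "coercivity_const = 1" unfolding coercivity_const_def using True by simp
  have e: "DG_form \<theta> \<T> (\<lambda>x. a x y) (\<eta> y) v v = (energy y v)\<^sup>2"
    unfolding True by (rule DG_form_symmetric_part[OF v coeff_cont[OF y] _ penalty_pos[OF y]]) (rule coeff_bounds(3)[OF y])
  show ?thesis unfolding e c by simp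
next
  case False
  have "(1 - 1 / sqrt \<tau>) * (energy y v)\<^sup>2 \<le> DG_form \<theta> \<T> (\<lambda>x. a x y) (\<eta> y) v v"
    by (rule DG_form_coercive[OF v coeff_cont[OF y] coeff_bounds(1)[OF y] coeff_bounds(2)[OF y] coeff_pos[OF y]
          penalty_pos[OF y] tau trace_ineq penalty[OF y]])
  then show ?thesis using False by (simp add: coercivity_const_def)
qed

lemma da_continuous: "finsupp m \<Longrightarrow> y \<in> U \<Longrightarrow> continuous_on (closure D) (da m y)"
  by (rule mixed_partials_continuous[OF limpt coeff_cont coeff_smooth])

text \<open>The basis depends on the mesh and the degree but not on y, so the whole parameter
  dependence of the solution sits in its coordinates.\<close>

definition \<Phi> :: "('a \<Rightarrow> real) set" where
  "\<Phi> = (SOME \<Phi>. spans \<Phi> \<and> (\<forall>c. (\<forall>T\<in>\<T>. \<forall>x\<in>interior T. (\<Sum>\<phi>\<in>\<Phi>. c \<phi> * \<phi> x) = 0) \<longrightarrow> (\<forall>\<phi>\<in>\<Phi>. c \<phi> = 0)))"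

lemma \<Phi>_basis: "spans \<Phi> \<and> (\<forall>c. (\<forall>T\<in>\<T>. \<forall>x\<in>interior T. (\<Sum>\<phi>\<in>\<Phi>. c \<phi> * \<phi> x) = 0) \<longrightarrow> (\<forall>\<phi>\<in>\<Phi>. c \<phi> = 0))"
  unfolding \<Phi>_def
proof (rule someI_ex)
  obtain \<Phi>' where "spans \<Phi>'"
    "\<And>c \<phi>. (\<And>T x. T \<in> \<T> \<Longrightarrow> x \<in> interior T \<Longrightarrow> (\<Sum>\<phi>\<in>\<Phi>'. c \<phi> * \<phi> x) = 0) \<Longrightarrow> \<phi> \<in> \<Phi>' \<Longrightarrow> c \<phi> = 0"
    by (rule basis_exists) blast
  then show "\<exists>\<Phi>. spans \<Phi> \<and> (\<forall>c. (\<forall>T\<in>\<T>. \<forall>x\<in>interior T. (\<Sum>\<phi>\<in>\<Phi>. c \<phi> * \<phi> x) = 0) \<longrightarrow> (\<forall>\<phi>\<in>\<Phi>. c \<phi> = 0))"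
    by (intro exI[of _ \<Phi>'] conjI allI impI ballI) blast+
qed

lemma \<Phi>_finite: "finite \<Phi>" and \<Phi>_V: "\<phi> \<in> \<Phi> \<Longrightarrow> \<phi> \<in> V"
  using \<Phi>_basis by (auto simp: spans_def)

definition coord :: "param \<Rightarrow> ('a \<Rightarrow> real) \<Rightarrow> real" where
  "coord y = (SOME c. \<forall>T\<in>\<T>. \<forall>x\<in>interior T. u x y = (\<Sum>\<phi>\<in>\<Phi>. c \<phi> * \<phi> x))"

lemma coord:
  assumes "y \<in> U"
  shows "\<forall>T\<in>\<T>. \<forall>x\<in>interior T. u x y = (\<Sum>\<phi>\<in>\<Phi>. coord y \<phi> * \<phi> x)"
  unfolding coord_def
proof (rule someI_ex[of "\<lambda>c. \<forall>T\<in>\<T>. \<forall>x\<in>interior T. u x y = (\<Sum>\<phi>\<in>\<Phi>. c \<phi> * \<phi> x)"])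
  have uV: "(\<lambda>x. u x y) \<in> V" using solution[OF assms] by (simp add: DG_solution_def)
  have "\<forall>v\<in>V. \<exists>c. \<forall>T\<in>\<T>. \<forall>x\<in>interior T. v x = (\<Sum>\<phi>\<in>\<Phi>. c \<phi> * \<phi> x)"
    using \<Phi>_basis unfolding spans_def by (elim conjE)
  from bspec[OF this uV] show "\<exists>c. \<forall>T\<in>\<T>. \<forall>x\<in>interior T. u x y = (\<Sum>\<phi>\<in>\<Phi>. c \<phi> * \<phi> x)" .
qed

text \<open>The row p is the test function and the column q the trial function, hence the exchanged
  arguments.\<close>

definition stiffness :: "(nat \<Rightarrow> nat) \<Rightarrow> param \<Rightarrow> ('a \<Rightarrow> real) \<Rightarrow> ('a \<Rightarrow> real) \<Rightarrow> real" where
  "stiffness m y p q = DG_form \<theta> \<T> (da m y) (d\<eta> m y) q p"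

text \<open>By linearity the difference quotient of an entry is the form with difference quotients
  as coefficient and penalty, which converge uniformly and as numbers, respectively.\<close>

lemma stiffness_deriv:
  assumes m: "finsupp m" and y: "y \<in> U" and p: "p \<in> \<Phi>" and q: "q \<in> \<Phi>"
  shows "((\<lambda>t. stiffness m (y(j := t)) p q) has_real_derivative stiffness (m(j := Suc (m j))) y p q)
    (at (y j) within coord_slice U y j)"
  unfolding has_field_derivative_iff
proof (rule Lim_transform_eventually)
  let ?F = "at (y j) within coord_slice U y j" and ?m = "m(j := Suc (m j))"
  let ?b = "\<lambda>t x. (da m (y(j := t)) x - da m y x) / (t - y j)"
  let ?e = "\<lambda>t. (d\<eta> m (y(j := t)) - d\<eta> m y) / (t - y j)"
  note pV = \<Phi>_V[OF p] and qV = \<Phi>_V[OF q]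
  have U: "\<forall>\<^sub>F t in ?F. y(j := t) \<in> U \<and> t \<noteq> y j"
    by (auto simp: eventually_at coord_slice_def intro!: exI[of _ 1])
  have bc: "continuous_on (closure D) (?b t)" if "y(j := t) \<in> U" "t \<noteq> y j" for t
    using da_continuous[OF m y] da_continuous[OF m that(1)] that(2)
    by (intro continuous_on_divide continuous_on_diff continuous_on_const) auto
  show "((\<lambda>t. DG_form \<theta> \<T> (?b t) (?e t) q p) \<longlongrightarrow> stiffness ?m y p q) ?F"
    unfolding stiffness_def
  proof (rule DG_form_tendsto[OF qV pV theta_abs])
    show "uniform_limit (closure D) ?b (da ?m y) ?F"
      using coeff_smooth m y unfolding has_mixed_partials_uniformly_def by blast
    show "\<forall>\<^sub>F t in ?F. continuous_on (closure D) (?b t)" using U by eventually_elim (use bc in blast)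
    show "continuous_on (closure D) (da ?m y)" by (rule da_continuous[OF finsupp_upd[OF m] y])
    have "((\<lambda>t. d\<eta> m (y(j := t))) has_real_derivative d\<eta> ?m y) ?F"
      using penalty_smooth m y unfolding has_mixed_partials_def by blast
    then show "(?e \<longlongrightarrow> d\<eta> ?m y) ?F" by (simp add: has_field_derivative_iff)
  qed
  show "\<forall>\<^sub>F t in ?F. DG_form \<theta> \<T> (?b t) (?e t) q p = (stiffness m (y(j := t)) p q - stiffness m (y(j := y j)) p q) / (t - y j)"
    using U
  proof eventually_elim
    case (elim t)
    have "DG_form \<theta> \<T> (da m (y(j := t))) (d\<eta> m y + (t - y j) * ?e t) q p =
        DG_form \<theta> \<T> (da m y) (d\<eta> m y) q p + (t - y j) * DG_form \<theta> \<T> (?b t) (?e t) q p"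
      by (rule DG_form_coeff_add_scaled[OF qV pV da_continuous[OF m y] bc]) (use elim in auto)
    then show ?case using elim by (simp add: stiffness_def)
  qed
qed

lemma combination_\<Phi>:
  assumes "\<And>T x. T \<in> \<T> \<Longrightarrow> x \<in> interior T \<Longrightarrow> w x = (\<Sum>q\<in>\<Phi>. c q * q x)"
  shows "is_combination \<Phi> c (\<lambda>q. q) w"
  using assms \<Phi>_finite \<Phi>_V by (simp add: is_combination_def)

lemma stiffness_row:
  assumes "is_combination \<Phi> c (\<lambda>q. q) w" "finsupp m" "y \<in> U" "p \<in> \<Phi>"
  shows "(\<Sum>q\<in>\<Phi>. stiffness m y p q * c q) = DG_form \<theta> \<T> (da m y) (d\<eta> m y) w p"
  unfolding DG_form_left_combination[OF assms(1) \<Phi>_V[OF assms(4)] da_continuous[OF assms(2,3)]]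
  by (simp add: stiffness_def mult.commute)

text \<open>A kernel vector is the coordinate vector of some w with B(w, w) = 0. Coercivity and
  definiteness make w vanish in all interiors, and independence of the basis finishes.\<close>

lemma stiffness_nonsingular:
  assumes y: "y \<in> U" and zero: "\<And>p. p \<in> \<Phi> \<Longrightarrow> (\<Sum>q\<in>\<Phi>. stiffness (\<lambda>_. 0) y p q * z q) = 0" and q: "q \<in> \<Phi>"
  shows "z q = 0"
proof -
  define w where "w x = (\<Sum>q\<in>\<Phi>. z q * q x)" for x
  have comb: "is_combination \<Phi> z (\<lambda>q. q) w" by (rule combination_\<Phi>) (simp add: w_def)
  note wV = combination(3)[OF comb]
  have "DG_form \<theta> \<T> (\<lambda>x. a x y) (\<eta> y) w p = 0" if "p \<in> \<Phi>" for p
    using stiffness_row[OF comb finsupp_zero y that] zero[OF that] by simp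
  then have "DG_form \<theta> \<T> (\<lambda>x. a x y) (\<eta> y) w w = 0"
    unfolding DG_form_right_combination[OF comb wV coeff_cont[OF y]] by simp
  then have "coercivity_const * (energy y w)\<^sup>2 \<le> 0" using coercive[OF y wV] by simp
  then have "energy y w = 0"
    using coercivity_const_pos by (simp add: mult_le_0_iff)
  then have "w x = 0" if "T \<in> \<T>" "x \<in> interior T" for T x
    using DG_norm_eq_zero[OF wV coeff_cont[OF y] coeff_bounds(3)[OF y] penalty_pos[OF y] _ that] by blast
  then show ?thesis using \<Phi>_basis q unfolding w_def by blast
qed

text \<open>The Galerkin equations tested with the basis. The load vector depends on f but not on y,
  so it drops out of every differentiated equation.\<close>

sublocale parametric_linear_system U \<Phi> \<Phi> stiffness "\<lambda>p. \<integral>x. f x * p x \<partial>lebesgue_on D" coord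
proof
  show "(\<Sum>q\<in>\<Phi>. stiffness (\<lambda>_. 0) y p q * coord y q) = (\<integral>x. f x * p x \<partial>lebesgue_on D)"
    if y: "y \<in> U" and p: "p \<in> \<Phi>" for y p
  proof -
    have comb: "is_combination \<Phi> (coord y) (\<lambda>q. q) (\<lambda>x. u x y)"
      by (rule combination_\<Phi>) (use coord[OF y] in blast)
    show ?thesis
      unfolding stiffness_row[OF comb finsupp_zero y p]
      using solution[OF y] \<Phi>_V[OF p] by (simp add: DG_solution_def)
  qed
qed (use limpt \<Phi>_finite stiffness_deriv stiffness_nonsingular in auto)

text \<open>At a fixed interior point the solution is a combination of its coordinates with weights
  free of y, so smoothness of the coordinates passes to it.\<close>

lemma solution_mixed_partials:
  assumes T: "T \<in> \<T>" and x: "x \<in> interior T"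
  shows "has_mixed_partials U (u x)"
    "finsupp \<nu> \<Longrightarrow> y \<in> U \<Longrightarrow> mixed_partial U \<nu> (u x) y = (\<Sum>q\<in>\<Phi>. sol_deriv \<nu> y q * q x)"
proof -
  define G where "G \<nu> y = (\<Sum>q\<in>\<Phi>. sol_deriv \<nu> y q * q x)" for \<nu> y
  have G0: "G (\<lambda>_. 0) y = u x y" if "y \<in> U" for y
    using coord[OF that] T x by (simp add: G_def sol_deriv_def)
  have Gd: "((\<lambda>t. G \<nu> (y(j := t))) has_real_derivative G (\<nu>(j := Suc (\<nu> j))) y) (at (y j) within coord_slice U y j)"
    if \<nu>: "finsupp \<nu>" and y: "y \<in> U" for \<nu> j y
    unfolding G_def
  proof (rule DERIV_sum, rule DERIV_cmult_right)
    fix q assume "q \<in> \<Phi>"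
    then show "((\<lambda>t. sol_deriv \<nu> (y(j := t)) q) has_real_derivative sol_deriv (\<nu>(j := Suc (\<nu> j))) y q)
        (at (y j) within coord_slice U y j)"
      using smooth_and_leibniz(2)[OF \<nu>, of j] y unfolding sol_differentiable_def by blast
  qed
  show "has_mixed_partials U (u x)"
    by (rule mixed_partials_eqI(2)[of U G, OF limpt G0 Gd])
  show "mixed_partial U \<nu> (u x) y = (\<Sum>q\<in>\<Phi>. sol_deriv \<nu> y q * q x)" if "finsupp \<nu>" "y \<in> U"
    using mixed_partials_eqI(1)[of U G, OF limpt G0 Gd that] by (simp add: G_def)
qed

section \<open>The differentiated Galerkin equation and the energy estimate\<close>

abbreviation du where "du \<nu> y \<equiv> (\<lambda>x. mixed_partial U \<nu> (u x) y)"

lemma du_combination: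
  assumes "finsupp \<nu>" "y \<in> U"
  shows "is_combination \<Phi> (sol_deriv \<nu> y) (\<lambda>q. q) (du \<nu> y)"
  by (rule combination_\<Phi>) (rule solution_mixed_partials(2)[OF _ _ assms])

lemma du_in_V: "finsupp \<nu> \<Longrightarrow> y \<in> U \<Longrightarrow> du \<nu> y \<in> V"
  using combination(3)[OF du_combination] .

text \<open>The Leibniz identity is available row by row. Weighting the rows with the coordinates of
  the \<nu>-th derivative makes that derivative the test function.\<close>

lemma leibniz_tested:
  assumes \<nu>: "finsupp \<nu>" "\<nu> \<noteq> (\<lambda>_. 0)" and y: "y \<in> U"
  shows "(\<Sum>m | m \<le> \<nu>. real (multi_binomial \<nu> m) *
      DG_form \<theta> \<T> (da m y) (d\<eta> m y) (du (\<lambda>j. \<nu> j - m j) y) (du \<nu> y)) = 0"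
proof -
  let ?d = "sol_deriv \<nu> y" and ?w = "\<lambda>m. du (\<lambda>j. \<nu> j - m j) y"
  have row: "(\<Sum>m | m \<le> \<nu>. real (multi_binomial \<nu> m) * DG_form \<theta> \<T> (da m y) (d\<eta> m y) (?w m) p) = 0" if p: "p \<in> \<Phi>" for p
  proof -
    have "(\<Sum>m | m \<le> \<nu>. real (multi_binomial \<nu> m) * row_sum m (\<lambda>i. \<nu> i - m i) y p) = 0"
      using smooth_and_leibniz(1)[OF \<nu>(1)] y p \<nu>(2) unfolding leibniz_def by auto
    moreover have "row_sum m (\<lambda>i. \<nu> i - m i) y p = DG_form \<theta> \<T> (da m y) (d\<eta> m y) (?w m) p" if "m \<le> \<nu>" for m
      unfolding row_sum_def
      by (rule stiffness_row[OF du_combination[OF finsupp_diff[OF \<nu>(1)] y] finsupp_le[OF \<nu>(1) that] y p])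
    ultimately show ?thesis by simp
  qed
  have "(\<Sum>m | m \<le> \<nu>. real (multi_binomial \<nu> m) * DG_form \<theta> \<T> (da m y) (d\<eta> m y) (?w m) (du \<nu> y)) =
     (\<Sum>m | m \<le> \<nu>. \<Sum>p\<in>\<Phi>. ?d p * (real (multi_binomial \<nu> m) * DG_form \<theta> \<T> (da m y) (d\<eta> m y) (?w m) p))"
  proof (rule sum.cong[OF refl])
    fix m assume "m \<in> {m. m \<le> \<nu>}"
    then have m: "finsupp m" using finsupp_le[OF \<nu>(1)] by blast
    show "real (multi_binomial \<nu> m) * DG_form \<theta> \<T> (da m y) (d\<eta> m y) (?w m) (du \<nu> y) =
      (\<Sum>p\<in>\<Phi>. ?d p * (real (multi_binomial \<nu> m) * DG_form \<theta> \<T> (da m y) (d\<eta> m y) (?w m) p))"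
      unfolding DG_form_right_combination[OF du_combination[OF \<nu>(1) y] du_in_V[OF finsupp_diff[OF \<nu>(1)] y] da_continuous[OF m y]]
      by (simp add: sum_distrib_left mult_ac)
  qed
  also have "\<dots> = (\<Sum>p\<in>\<Phi>. ?d p * (\<Sum>m | m \<le> \<nu>. real (multi_binomial \<nu> m) * DG_form \<theta> \<T> (da m y) (d\<eta> m y) (?w m) p))"
    unfolding sum_distrib_left by (rule sum.swap)
  also have "\<dots> = 0" using row by simp
  finally show ?thesis .
qed

lemma energy_nonneg: "y \<in> U \<Longrightarrow> 0 \<le> energy y v"
  unfolding DG_norm_def using penalty_pos face_size_pos
  by (intro real_sqrt_ge_zero add_nonneg_nonneg sum_nonneg mult_nonneg_nonneg) (auto simp: less_imp_le)

text \<open>The two relative sizes serve as M and M' in \<open>DG_form_bound\<close>;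
  \<open>C_equiv\<close> enters once for each star norm.\<close>

lemma form_derivative_bound:
  assumes m: "finsupp m" and y: "y \<in> U" and w: "w \<in> V" and v: "v \<in> V"
  shows "\<bar>DG_form \<theta> \<T> (da m y) (d\<eta> m y) w v\<bar> \<le>
    C_equiv\<^sup>2 * (Linf_norm D (\<lambda>x. mixed_partial U m (a x) y / a x y) + \<bar>d\<eta> m y / \<eta> y\<bar>) * energy y w * energy y v"
proof -
  define L where "L = Linf_norm D (\<lambda>x. mixed_partial U m (a x) y / a x y)"
  define M' where "M' = \<bar>d\<eta> m y / \<eta> y\<bar>"
  have "continuous_on (closure D) (\<lambda>x. mixed_partial U m (a x) y / a x y)"
    using coeff_bounds(3)[OF y] by (intro continuous_on_divide da_continuous m y coeff_cont) fastforce+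
  note Lb = Linf_norm_bound[OF D_open D_nonempty D_compact this, folded L_def]
  have b: "\<bar>da m y x\<bar> \<le> L * a x y" if "x \<in> closure D" for x
    using Lb(1)[OF that] coeff_bounds(3)[OF y that] by (simp add: abs_divide pos_divide_le_eq)
  have e: "\<bar>d\<eta> m y\<bar> \<le> M' * \<eta> y" using penalty_pos[OF y] by (simp add: M'_def abs_divide)
  have nonneg: "0 \<le> L + M'" using Lb(2) by (simp add: M'_def)
  have star: "0 \<le> DG_norm_star \<T> (\<lambda>x. a x y) (\<eta> y) v" for v
    unfolding DG_norm_star_def using penalty_pos[OF y] face_size_pos
    by (intro real_sqrt_ge_zero add_nonneg_nonneg sum_nonneg mult_nonneg_nonneg) (auto simp: less_imp_le)
  have "\<bar>DG_form \<theta> \<T> (da m y) (d\<eta> m y) w v\<bar> \<le>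
     (L + M') * DG_norm_star \<T> (\<lambda>x. a x y) (\<eta> y) w * DG_norm_star \<T> (\<lambda>x. a x y) (\<eta> y) v"
    by (rule DG_form_bound[OF w v da_continuous[OF m y] coeff_cont[OF y] coeff_bounds(3)[OF y] penalty_pos[OF y]
          b Lb(2) e _ theta_abs]) (simp_all add: M'_def)
  also have "\<dots> \<le> (L + M') * (C_equiv * energy y w) * (C_equiv * energy y v)"
    using norm_equiv[OF y w] norm_equiv[OF y v] nonneg star equiv_pos energy_nonneg[OF y]
    by (intro mult_mono mult_left_mono mult_nonneg_nonneg) auto
  also have "\<dots> = C_equiv\<^sup>2 * (L + M') * energy y w * energy y v" by (simp add: power2_eq_square)
  finally show ?thesis unfolding L_def M'_def .
qed

theorem energy_estimate:
  assumes \<nu>: "finsupp \<nu>" "\<nu> \<noteq> (\<lambda>_. 0)" and y: "y \<in> U"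
  shows "energy y (du \<nu> y) \<le> C_equiv\<^sup>2 / coercivity_const *
    (\<Sum>m | m \<noteq> (\<lambda>_. 0) \<and> m \<le> \<nu>. real (multi_binomial \<nu> m) *
      (Linf_norm D (\<lambda>x. mixed_partial U m (a x) y / a x y) + \<bar>d\<eta> m y / \<eta> y\<bar>) * energy y (du (\<lambda>j. \<nu> j - m j) y))"
proof -
  let ?I = "{m. m \<noteq> (\<lambda>_. 0) \<and> m \<le> \<nu>}"
  define g where "g m = Linf_norm D (\<lambda>x. mixed_partial U m (a x) y / a x y) + \<bar>d\<eta> m y / \<eta> y\<bar>" for m
  define w where "w m = du (\<lambda>j. \<nu> j - m j) y" for m
  define R where "R = (\<Sum>m\<in>?I. real (multi_binomial \<nu> m) * g m * energy y (w m))"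
  let ?n = "energy y (du \<nu> y)"
  note vV = du_in_V[OF \<nu>(1) y]
  have g: "0 \<le> g m" if "m \<le> \<nu>" for m
  proof -
    have "continuous_on (closure D) (\<lambda>x. mixed_partial U m (a x) y / a x y)"
      using coeff_bounds(3)[OF y] by (intro continuous_on_divide da_continuous finsupp_le[OF \<nu>(1) that] y coeff_cont) fastforce+
    from Linf_norm_bound(2)[OF D_open D_nonempty D_compact this] show ?thesis by (simp add: g_def)
  qed
  have R: "0 \<le> R" unfolding R_def using g energy_nonneg[OF y] by (intro sum_nonneg mult_nonneg_nonneg) auto
  have "DG_form \<theta> \<T> (\<lambda>x. a x y) (\<eta> y) (du \<nu> y) (du \<nu> y) =
     - (\<Sum>m\<in>?I. real (multi_binomial \<nu> m) * DG_form \<theta> \<T> (da m y) (d\<eta> m y) (w m) (du \<nu> y))"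
    using leibniz_tested[OF \<nu> y] unfolding leibniz_split[OF \<nu>(1)] w_def by simp
  also have "\<dots> \<le> (\<Sum>m\<in>?I. \<bar>real (multi_binomial \<nu> m) * DG_form \<theta> \<T> (da m y) (d\<eta> m y) (w m) (du \<nu> y)\<bar>)"
    by (rule order_trans[OF abs_ge_minus_self sum_abs])
  also have "\<dots> \<le> (\<Sum>m\<in>?I. real (multi_binomial \<nu> m) * (C_equiv\<^sup>2 * g m * energy y (w m) * ?n))"
    unfolding abs_mult g_def w_def
    using form_derivative_bound[OF finsupp_le[OF \<nu>(1)] y du_in_V[OF finsupp_diff[OF \<nu>(1)] y] vV]
    by (intro sum_mono mult_mono) auto
  also have "\<dots> = C_equiv\<^sup>2 * R * ?n" unfolding R_def by (simp add: sum_distrib_left sum_distrib_right mult_ac)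
  finally have est: "coercivity_const * ?n\<^sup>2 \<le> C_equiv\<^sup>2 * R * ?n" using coercive[OF y vV] by linarith
  have "?n \<le> C_equiv\<^sup>2 / coercivity_const * R"
  \<comment> \<open>One factor of the norm is cancelled, which needs it to be positive; if it is
    zero, the claim reduces to \<open>R\<close> being nonnegative.\<close>
  proof (cases "?n = 0")
    case True
    show ?thesis unfolding True using R coercivity_const_pos by simp
  next
    case False
    then have pos: "?n > 0" using energy_nonneg[OF y, of "du \<nu> y"] by linarith
    have "(coercivity_const * ?n) * ?n \<le> (C_equiv\<^sup>2 * R) * ?n" using est by (simp add: power2_eq_square mult.assoc)
    then have "coercivity_const * ?n \<le> C_equiv\<^sup>2 * R" using pos by (rule mult_right_le_imp_le)
    then show ?thesis using coercivity_const_pos by (simp add: pos_le_divide_eq mult.commute)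
  qed
  then show ?thesis unfolding R_def g_def w_def .
qed

end

text \<open>\<open>mixed_partial\<close> is a total operator, so the estimate speaks of true
  derivatives only together with the first two conjuncts: the derivatives exist at every interior
  point of an element and belong to the discrete space.\<close>

theorem theorem5p5:
  fixes D :: "'a::euclidean_space set"
    and U :: "(nat \<Rightarrow> real) set"
    and a :: "'a \<Rightarrow> (nat \<Rightarrow> real) \<Rightarrow> real"
    and \<eta> :: "(nat \<Rightarrow> real) \<Rightarrow> real"
    and f :: "'a \<Rightarrow> real"
    and \<T> :: "nat \<Rightarrow> 'a set set"
    and k :: nat
    and \<theta> \<tau> \<tau>' C_tr C_equiv :: real
    and u :: "nat \<Rightarrow> 'a \<Rightarrow> (nat \<Rightarrow> real) \<Rightarrow> real"
  assumes dim: "DIM('a) \<in> {1, 2, 3}"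
    and domain: "D \<noteq> {}" "open D" "convex D" "polytope (closure D)"
    and params: "U \<noteq> {}" "\<And>y j. y \<in> U \<Longrightarrow> y j islimpt coord_slice U y j"
    and source: "f \<in> L2 D"
    and coeff_cont: "\<And>y. y \<in> U \<Longrightarrow> continuous_on (closure D) (\<lambda>x. a x y)"
    and coeff_pos: "\<And>y. y \<in> U \<Longrightarrow> 0 < coeff_min D (\<lambda>x. a x y)"
    and coeff_smooth: "has_mixed_partials_uniformly (closure D) U a"
    and penalty_pos: "\<And>y. y \<in> U \<Longrightarrow> 0 < \<eta> y"
    and penalty_smooth: "has_mixed_partials U \<eta>"
    and mesh: "regular_mesh_sequence D \<T>"
    and theta: "\<theta> \<in> {-1, 0, 1}"
    and trace_ineq: "\<And>h v T F. \<lbrakk>v \<in> DG_space D (\<T> h) k; T \<in> \<T> h; F \<in> faces T\<rbrakk> \<Longrightarrow>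
          sqrt (diameter T) * L2norm (face_measure F) (interior_trace T v) \<le> C_tr * L2norm (lebesgue_on T) v"
    and solution: "\<And>h y. y \<in> U \<Longrightarrow>
          DG_solution D (\<T> h) k \<theta> (\<lambda>x. a x y) (\<eta> y) f (\<lambda>x. u h x y)"
    and equiv_pos: "0 < C_equiv"
    and norm_equiv: "\<And>h y v. \<lbrakk>y \<in> U; v \<in> DG_space D (\<T> h) k\<rbrakk> \<Longrightarrow>
          DG_norm_star (\<T> h) (\<lambda>x. a x y) (\<eta> y) v \<le> C_equiv * DG_norm (\<T> h) (\<lambda>x. a x y) (\<eta> y) v"
    and tau: "1 < \<tau>" "0 < \<tau>'"
    and penalty1: "\<And>h y. y \<in> U \<Longrightarrow>
          \<eta> y \<ge> \<tau> * ((coeff_max D (\<lambda>x. a x y))\<^sup>2 * C_tr\<^sup>2 * real (max_faces (\<T> h)) * (\<theta> - 1)\<^sup>2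
                       / (4 * coeff_min D (\<lambda>x. a x y)))"
    and penalty2: "\<And>y. y \<in> U \<Longrightarrow>
          \<eta> y \<ge> \<tau>' * ((coeff_max D (\<lambda>x. a x y))\<^sup>2 / coeff_min D (\<lambda>x. a x y))"
  shows
    "(\<forall>h. \<forall>T\<in>\<T> h. \<forall>x\<in>interior T. has_mixed_partials U (u h x)) \<and>
     (\<forall>h \<nu>. \<forall>y\<in>U. finsupp \<nu> \<longrightarrow>
        (\<lambda>x. mixed_partial U \<nu> (u h x) y) \<in> DG_space D (\<T> h) k) \<and>
     (\<exists>C_DG' C_DG. 0 < C_DG' \<and> 0 < C_DG \<and> C_DG = C_equiv\<^sup>2 * C_DG' \<and> (\<theta> = 1 \<longrightarrow> C_DG' = 1) \<and>
        (\<forall>h \<nu>. \<forall>y\<in>U. finsupp \<nu> \<longrightarrow> \<nu> \<noteq> (\<lambda>_. 0) \<longrightarrow>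
           DG_norm (\<T> h) (\<lambda>x. a x y) (\<eta> y) (\<lambda>x. mixed_partial U \<nu> (u h x) y)
           \<le> C_DG * (\<Sum>m | m \<noteq> (\<lambda>_. 0) \<and> m \<le> \<nu>. real (multi_binomial \<nu> m) *
                (Linf_norm D (\<lambda>x. mixed_partial U m (a x) y / a x y)
                   + \<bar>mixed_partial U m \<eta> y / \<eta> y\<bar>) *
                DG_norm (\<T> h) (\<lambda>x. a x y) (\<eta> y)
                  (\<lambda>x. mixed_partial U (\<lambda>j. \<nu> j - m j) (u h x) y))))"
proof (intro conjI allI ballI impI)
  have param: "dg_parametric D (\<T> h) k U a \<eta> f (u h) \<theta> \<tau> C_tr C_equiv" for h
  proof
    show "polyhedral_mesh D (\<T> h)" using mesh by (simp add: regular_mesh_sequence_def)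
    show "compact (closure D)" using domain(4) by (rule polytope_imp_compact)
  qed (use domain params coeff_cont coeff_pos coeff_smooth penalty_pos penalty_smooth theta trace_ineq solution
      equiv_pos norm_equiv tau penalty1 in auto)
  show "has_mixed_partials U (u h x)" if "T \<in> \<T> h" "x \<in> interior T" for h T x
    by (rule dg_parametric.solution_mixed_partials(1)[OF param that])
  show "(\<lambda>x. mixed_partial U \<nu> (u h x) y) \<in> DG_space D (\<T> h) k" if "y \<in> U" "finsupp \<nu>" for h \<nu> y
    by (rule dg_parametric.du_in_V[OF param that(2,1)])
  \<comment> \<open>The coercivity constant, fixed before any mesh or parameter; its reciprocal is
    C_DG', which equals 1 when \<theta> = 1.\<close>
  define \<kappa> where "\<kappa> = (if \<theta> = 1 then 1 else 1 - 1 / sqrt \<tau>)"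
  have \<kappa>: "0 < \<kappa>" using tau by (simp add: \<kappa>_def)
  show "\<exists>C_DG' C_DG. 0 < C_DG' \<and> 0 < C_DG \<and> C_DG = C_equiv\<^sup>2 * C_DG' \<and> (\<theta> = 1 \<longrightarrow> C_DG' = 1) \<and>
        (\<forall>h \<nu>. \<forall>y\<in>U. finsupp \<nu> \<longrightarrow> \<nu> \<noteq> (\<lambda>_. 0) \<longrightarrow>
           DG_norm (\<T> h) (\<lambda>x. a x y) (\<eta> y) (\<lambda>x. mixed_partial U \<nu> (u h x) y)
           \<le> C_DG * (\<Sum>m | m \<noteq> (\<lambda>_. 0) \<and> m \<le> \<nu>. real (multi_binomial \<nu> m) *
                (Linf_norm D (\<lambda>x. mixed_partial U m (a x) y / a x y)
                   + \<bar>mixed_partial U m \<eta> y / \<eta> y\<bar>) *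
                DG_norm (\<T> h) (\<lambda>x. a x y) (\<eta> y)
                  (\<lambda>x. mixed_partial U (\<lambda>j. \<nu> j - m j) (u h x) y)))"
  proof (rule exI[of _ "1 / \<kappa>"], rule exI[of _ "C_equiv\<^sup>2 / \<kappa>"], intro conjI allI ballI impI)
    fix h \<nu> y assume "y \<in> U" "finsupp \<nu>" "\<nu> \<noteq> (\<lambda>_. 0)"
    then show "DG_norm (\<T> h) (\<lambda>x. a x y) (\<eta> y) (\<lambda>x. mixed_partial U \<nu> (u h x) y)
           \<le> C_equiv\<^sup>2 / \<kappa> * (\<Sum>m | m \<noteq> (\<lambda>_. 0) \<and> m \<le> \<nu>. real (multi_binomial \<nu> m) *
                (Linf_norm D (\<lambda>x. mixed_partial U m (a x) y / a x y)
                   + \<bar>mixed_partial U m \<eta> y / \<eta> y\<bar>) *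
                DG_norm (\<T> h) (\<lambda>x. a x y) (\<eta> y)
                  (\<lambda>x. mixed_partial U (\<lambda>j. \<nu> j - m j) (u h x) y))"
      using dg_parametric.energy_estimate[OF param] unfolding dg_parametric.coercivity_const_def[OF param] \<kappa>_def
      by blast
  qed (use \<kappa> equiv_pos in \<open>auto simp: \<kappa>_def\<close>)
qed

end
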